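(* Let $\mathcal{D} \subset \mathbb{R}^2$ be a regular (balanced) quadriculated disk and let $\mathcal{R}_N=\mathcal{D}\times[0,N]$. Let $M$ be a nonnegative even integer such that for all $N\in\mathbb{N}$ and all $\mathbf{t}_0,\mathbf{t}_1\in\mathcal{T}(\mathcal{R}_N)$, $\operatorname{Tw}(\mathbf{t}_0)=\operatorname{Tw}(\mathbf{t}_1)$ implies $\mathbf{t}_0\ast\mathbf{t}_{\mathrm{vert},M}\approx\mathbf{t}_1\ast\mathbf{t}_{\mathrm{vert},M}$. Call a connected component under flips of $\mathcal{T}(\mathcal{R}_N)$ fat if it includes at least one tiling with at least $M$ vertical floors, and thin otherwise. Then there exist constants $c_{\mathcal{D}} \in \mathbb{Q}$, $b \in \mathbb{R}$ and $\tilde c \in (0,1)$ such that, for all $N \in \mathbb{N}$, the properties below hold. 1. If $\mathbf{t}$ is a tiling of $\mathcal{R}_N$ then $\operatorname{Tw}(\mathbf{t}) \in \mathbb{Z} \cap [-c_{\mathcal{D}}N, c_{\mathcal{D}}N]$. 2. For $t \in \mathbb{Z} \cap [-c_{\mathcal{D}}N+b,\,c_{\mathcal{D}}N-b]$, there exists exactly one fat component $\mathcal{F}_{N,t} \subseteq \mathcal{T}(\mathcal{R}_N)$ with $\operatorname{Tw}(\mathcal{F}_{N,t}) = t$. 3. For $t \in \mathbb{Z}$, there exists at most one fat component $\mathcal{F}_{N,t}$ with $\operatorname{Tw}(\mathcal{F}_{N,t}) = t$. 4. Let $\theta_N$ be the number of tilings in all thin components of $\mathcal{T}(\mathcal{R}_N)$.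 Then, as $N$ goes to infinity, $\theta_N = |\mathcal{T}(\mathcal{R}_N)| \, o(\tilde c^N)$.
   Context: Quadriculated disk: a set $\mathcal{D}\subset\mathbb{R}^2$ which is the union of finitely many closed unit squares with vertices in $\mathbb{Z}^2$ and is homeomorphic to the closed unit disk. Unit squares carry a checkerboard coloring and $\mathcal{D}$ is always assumed balanced (equal numbers of white and black squares). Tilings: $\mathcal{R}_N=\mathcal{D}\times[0,N]\subset\mathbb{R}^3$ is a union of closed unit cubes with vertices in $\mathbb{Z}^3$. A domino is the union of two unit cubes sharing a face; a tiling is a set of dominoes with disjoint interiors whose union is $\mathcal{R}_N$. $\mathcal{T}(\mathcal{R}_N)$ is the set of tilings. A domino is vertical if it is in the direction of the third axis. The $k$-th floor is $\mathcal{D}\times[k-1,k]$; a floor of a tiling is vertical if all dominoes of the tiling intersecting its interior are vertical. For $N$ even, $\mathbf{t}_{\mathrm{vert},N}\in\mathcal{T}(\mathcal{R}_N)$ is the tiling with all dominoes vertical. Concatenation (stacking) of $\mathbf{t}_0\in\mathcal{T}(\mathcal{R}_{N_0})$ and $\mathbf{t}_1\in\mathcal{T}(\mathcal{R}_{N_1})$ is $\mathbf{t}_0\ast\mathbf{t}_1\in\mathcal{T}(\mathcal{R}_{N_0+N_1})$. Flips: a flip removes two adjacent parallel dominoes (whose union is a $2\times2\times1$ block) and places them back in the other position. $\mathbf{t}_0\approx\mathbf{t}_1$ means that the two tilings of $\mathcal{R}_N$ are joined by a finite sequence of flips; the $\approx$-classes are the connected components under flips. For $\mathbf{t}_i\in\mathcal{T}(\mathcal{R}_{N_i})$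 with $N_0\equiv N_1\pmod 2$, write $\mathbf{t}_0\sim\mathbf{t}_1$ if there exists $N\equiv N_0\pmod 2$, $N\ge\max\{N_0,N_1\}$, with $\mathbf{t}_0\ast\mathbf{t}_{\mathrm{vert},N-N_0}\approx\mathbf{t}_1\ast\mathbf{t}_{\mathrm{vert},N-N_1}$. Twist: color unit cubes black and white in a checkerboard pattern. For a domino $d$, let $v(d)\in\{\pm e_1,\pm e_2,\pm e_3\}$ be the center of its black cube minus the center of its white cube. Fix $u\in\{\pm e_1,\pm e_2\}$. The (open) $u$-shade of $d$ is $S^u(d)=\operatorname{int}\big((\bigcup_{s\ge 0}(d+su))\smallsetminus d\big)$. Set $\tau^u(d_0,d_1)=\frac14\det(v(d_1),v(d_0),u)$ if $d_1\cap S^u(d_0)\neq\emptyset$ and $0$ otherwise. Then $\operatorname{Tw}(\mathbf{t})=\sum_{d_0,d_1\in\mathbf{t}}\tau^u(d_0,d_1)$; this is an integer, independent of $u$, invariant under flips and additive under concatenation. For a component $\mathcal{C}$ with $\mathbf{t}\in\mathcal{C}$, $\operatorname{Tw}(\mathcal{C})=\operatorname{Tw}(\mathbf{t})$. Regular: $\mathcal{D}$ is regular if for every $N$ and any tilings $\mathbf{t}_0,\mathbf{t}_1$ of $\mathcal{R}_N$, $\operatorname{Tw}(\mathbf{t}_0)=\operatorname{Tw}(\mathbf{t}_1)$ implies $\mathbf{t}_0\sim\mathbf{t}_1$. Such an $M$ is known to exist if the regular disk $\mathcal{D}$ contains a $2\times3$ rectangle. *)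

theory Defs
  imports "HOL-Analysis.Analysis" "HOL-Library.Landau_Symbols"
begin

text \<open>Unit cells of the integer lattice are indexed by their least vertex; they are the unit
  squares for dimension 2 and the unit cubes for dimension 3.\<close>

definition unit_cell :: "int ^ 'n \<Rightarrow> (real ^ 'n) set" where
  "unit_cell a = {x. \<forall>i. of_int (a $ i) \<le> x $ i \<and> x $ i \<le> of_int (a $ i) + 1}"

definition cell_center :: "int ^ 'n \<Rightarrow> real ^ 'n" where
  "cell_center a = (\<chi> i. of_int (a $ i) + 1 / 2)"

definition black_cell :: "int ^ 'n \<Rightarrow> bool" where
  "black_cell a \<longleftrightarrow> even (\<Sum>i\<in>UNIV. a $ i)"

definition quadriculated_disk :: "(real ^ 2) set \<Rightarrow> bool" where
  "quadriculated_disk D \<longleftrightarrow>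
     (\<exists>A. finite A \<and> D = (\<Union>a\<in>A. unit_cell a)) \<and>
     D homeomorphic (cball 0 1 :: (real ^ 2) set)"

definition balanced :: "(real ^ 2) set \<Rightarrow> bool" where
  "balanced D \<longleftrightarrow>
     card {a. unit_cell a \<subseteq> D \<and> black_cell a} = card {a. unit_cell a \<subseteq> D \<and> \<not> black_cell a}"

text \<open>The product of \<open>D\<close> with the interval from \<open>p\<close> to \<open>q\<close>.\<close>

definition slab :: "(real ^ 2) set \<Rightarrow> real \<Rightarrow> real \<Rightarrow> (real ^ 3) set" where
  "slab D p q = {x. (vector [x $ 1, x $ 2] :: real ^ 2) \<in> D \<and> p \<le> x $ 3 \<and> x $ 3 \<le> q}"

text \<open>For a quadriculated disk \<open>D\<close> and \<open>N \<ge> 1\<close> this is \<open>slab D 0 N\<close>. Taking the union of the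
  cubes makes the cylinder of height 0 empty (rather than a flat copy of \<open>D\<close>), so that its only
  tiling is the empty one, which is neutral for concatenation.\<close>

definition cylinder :: "(real ^ 2) set \<Rightarrow> nat \<Rightarrow> (real ^ 3) set" where
  "cylinder D N = \<Union> {unit_cell a | a. unit_cell a \<subseteq> slab D 0 (real N)}"

definition domino :: "(real ^ 3) set \<Rightarrow> bool" where
  "domino d \<longleftrightarrow> (\<exists>a i. d = unit_cell a \<union> unit_cell (a + axis i 1))"

definition vertical_domino :: "(real ^ 3) set \<Rightarrow> bool" where
  "vertical_domino d \<longleftrightarrow> (\<exists>a. d = unit_cell a \<union> unit_cell (a + axis 3 1))"

definition tilings :: "(real ^ 2) set \<Rightarrow> nat \<Rightarrow> (real ^ 3) set set set" where
  "tilings D N =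
     {t. (\<forall>d\<in>t. domino d) \<and> pairwise (\<lambda>d e. interior d \<inter> interior e = {}) t \<and> \<Union> t = cylinder D N}"

text \<open>The \<open>k\<close>-th floor is \<open>slab D (k - 1) k\<close>, for \<open>1 \<le> k \<le> N\<close>.\<close>

definition vertical_floor :: "(real ^ 2) set \<Rightarrow> (real ^ 3) set set \<Rightarrow> nat \<Rightarrow> bool" where
  "vertical_floor D t k \<longleftrightarrow>
     (\<forall>d\<in>t. d \<inter> interior (slab D (real k - 1) (real k)) \<noteq> {} \<longrightarrow> vertical_domino d)"

text \<open>The tiling by vertical dominoes; only meaningful for even \<open>N\<close>.\<close>

definition vert_tiling :: "(real ^ 2) set \<Rightarrow> nat \<Rightarrow> (real ^ 3) set set" where
  "vert_tiling D N =
     {d. \<exists>a. d = unit_cell a \<union> unit_cell (a + axis 3 1) \<and> even (a $ 3) \<and> d \<subseteq> cylinder D N}"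

text \<open>Stacking \<open>t1\<close> on top of a tiling \<open>t0\<close> of the cylinder of height \<open>N0\<close>.\<close>

definition stack :: "nat \<Rightarrow> (real ^ 3) set set \<Rightarrow> (real ^ 3) set set \<Rightarrow> (real ^ 3) set set" where
  "stack N0 t0 t1 = t0 \<union> (\<lambda>d. (+) (axis 3 (real N0)) ` d) ` t1"

definition flip :: "(real ^ 3) set set \<Rightarrow> (real ^ 3) set set \<Rightarrow> bool" where
  "flip t t' \<longleftrightarrow>
     (\<exists>a i j. i \<noteq> j \<and>
        (let d0 = unit_cell a \<union> unit_cell (a + axis i 1);
             d1 = unit_cell (a + axis j 1) \<union> unit_cell (a + axis i 1 + axis j 1);
             e0 = unit_cell a \<union> unit_cell (a + axis j 1);
             e1 = unit_cell (a + axis i 1) \<union> unit_cell (a + axis i 1 + axis j 1)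
         in d0 \<in> t \<and> d1 \<in> t \<and> t' = (t - {d0, d1}) \<union> {e0, e1}))"

abbreviation flip_equiv :: "(real ^ 3) set set \<Rightarrow> (real ^ 3) set set \<Rightarrow> bool" where
  "flip_equiv \<equiv> flip\<^sup>*\<^sup>*"

definition flip_components :: "(real ^ 2) set \<Rightarrow> nat \<Rightarrow> (real ^ 3) set set set set" where
  "flip_components D N = {{t' \<in> tilings D N. flip_equiv t t'} | t. t \<in> tilings D N}"

definition stably_equiv ::
    "(real ^ 2) set \<Rightarrow> nat \<Rightarrow> (real ^ 3) set set \<Rightarrow> nat \<Rightarrow> (real ^ 3) set set \<Rightarrow> bool" where
  "stably_equiv D N0 t0 N1 t1 \<longleftrightarrow>
     (\<exists>N. N mod 2 = N0 mod 2 \<and> N mod 2 = N1 mod 2 \<and> max N0 N1 \<le> N \<and>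
        flip_equiv (stack N0 t0 (vert_tiling D (N - N0))) (stack N1 t1 (vert_tiling D (N - N1))))"

definition domino_vector :: "(real ^ 3) set \<Rightarrow> real ^ 3" where
  "domino_vector d =
     (THE v. \<exists>a b. d = unit_cell a \<union> unit_cell b \<and> black_cell a \<and> \<not> black_cell b \<and>
        v = cell_center a - cell_center b)"

definition shade :: "real ^ 3 \<Rightarrow> (real ^ 3) set \<Rightarrow> (real ^ 3) set" where
  "shade u d = interior ((\<Union>s\<in>{0..}. (+) (s *\<^sub>R u) ` d) - d)"

definition pair_twist :: "real ^ 3 \<Rightarrow> (real ^ 3) set \<Rightarrow> (real ^ 3) set \<Rightarrow> real" where
  "pair_twist u d0 d1 =
     (if d1 \<inter> shade u d0 \<noteq> {}
      then 1 / 4 * det (vector [domino_vector d1, domino_vector d0, u] :: real ^ 3 ^ 3)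
      else 0)"

definition twist :: "real ^ 3 \<Rightarrow> (real ^ 3) set set \<Rightarrow> real" where
  "twist u t = (\<Sum>d0\<in>t. \<Sum>d1\<in>t. pair_twist u d0 d1)"

text \<open>The common value of the twist on a flip component.\<close>

definition component_twist :: "real ^ 3 \<Rightarrow> (real ^ 3) set set set \<Rightarrow> real" where
  "component_twist u C = the_elem (twist u ` C)"

definition regular_disk :: "real ^ 3 \<Rightarrow> (real ^ 2) set \<Rightarrow> bool" where
  "regular_disk u D \<longleftrightarrow>
     (\<forall>N. \<forall>t0\<in>tilings D N. \<forall>t1\<in>tilings D N. twist u t0 = twist u t1 \<longrightarrow> stably_equiv D N t0 N t1)"

definition fat_components :: "(real ^ 2) set \<Rightarrow> nat \<Rightarrow> nat \<Rightarrow> (real ^ 3) set set set set" where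
  "fat_components D M N =
     {C \<in> flip_components D N. \<exists>t\<in>C. M \<le> card {k \<in> {1..N}. vertical_floor D t k}}"

definition thin_components :: "(real ^ 2) set \<Rightarrow> nat \<Rightarrow> nat \<Rightarrow> (real ^ 3) set set set set" where
  "thin_components D M N = flip_components D N - fat_components D M N"

end

(* Slice a tiling into floors. The vertical dominoes crossing from floor k to floor k + 1 form a plug,
  a balanced set of cells, so a tiling is a closed walk of plugs, and its twist is a quarter of a sum of
  floor contributions that are bilinear in the horizontal dominoes and the plugs. Symmetry of the
  bilinear form gives invariance under flips, and modulo 4 the contribution of a floor is a
  coboundary, so the twist is an integer.

  The growth rate c is the largest mean contribution of a closed walk. It is attained on a walk of
  bounded length, hence rational. Up to exchanging the two colours, adding or removing a domino of a
  plug moves a particle to an adjacent free cell, so any two balanced plugs are joined by walks.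
  If some cell has three neighbours, exchanging two particles around it has twist 1 or -1; if no cell
  has, the disk is a path or a square of four cells and all twists vanish. Repeating an optimal walk and
  correcting by such exchanges realises every twist up to a bounded distance from the extreme values.

  Flips let the dominoes of a floor pass through a vertical floor, so M vertical floors can be collected
  on top and the hypothesis on M applies. Finally, between any two plugs there is a block of fixed
  height with M vertical floors, so that having fewer is exponentially unlikely. *)

theory Submission
  imports Defs
begin


section \<open>The twist of plug sequences\<close>

text \<open>Everything inside the interior range rests on a dichotomy. If the maximal rate is 0, any
  positive \<open>b\<close> makes the interval of admissible \<open>t\<close> empty and nothing has
  to be built. If it is positive, some closed walk has nonzero value; paths exclude this by a
  potential quadratic in the charges of initial segments, squares by inspection, so a branching cell
  must exist and supplies single units of twist. The height has to match exactly, including its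
  parity. An empty floor complements a plug, so the natural moves take two floors each; odd heights
  need one closed walk of odd length, obtained from the full plug. Cells touching only in a corner
  are not adjacent. Hence the connectedness of the cells is taken from the disk without its lattice
  points, and rings are treated through the connected complement of the disk. Collecting vertical
  floors preserves the value, so two fat components are compared at height \<open>N - M\<close>. The
  constant \<open>b\<close> pays for reaching the optimal loop, for exchanges, parity and the
  \<open>M\<close> vertical floors; \<open>c'\<close> is the square root of a decay rate, which
  turns a bound into a little-o.\<close>

type_synonym cell = "int \<times> int"

definition nbr :: "cell \<Rightarrow> cell \<Rightarrow> bool" where
  "nbr a b \<longleftrightarrow> \<bar>fst a - fst b\<bar> + \<bar>snd a - snd b\<bar> = 1"

definition chi :: "cell \<Rightarrow> int" where
  "chi a = (if even (fst a + snd a) then 1 else - 1)"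

text \<open>The sign of the displacement along the row, weighted by the two colours so that it
  reproduces the determinant in the twist. Shades run along rows, so different rows do not
  interact.\<close>

definition rk :: "cell \<Rightarrow> cell \<Rightarrow> int" where
  "rk a b = (if snd a = snd b then chi a * chi b * sgn (fst b - fst a) else 0)"

text \<open>For a domino \<open>{a, b}\<close> transverse to the direction \<open>u\<close> of the shades, \<open>phi {a, b} s\<close> is, up to a
  sign depending on the heights, four times the twist of this domino with a vertical domino over the
  cell \<open>s\<close>; the first coordinate of a cell runs along \<open>u\<close>. It vanishes if \<open>a\<close> and \<open>b\<close> are in the same row.\<close>

definition phi :: "cell set \<Rightarrow> cell \<Rightarrow> int" where
  "phi h s = (\<Sum>a\<in>h. \<Sum>b\<in>h. (snd b - snd a) * rk a s)"

lemma nbr_sym: "nbr a b \<Longrightarrow> nbr b a"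
  by (auto simp: nbr_def)

lemma nbr_neq: "nbr a b \<Longrightarrow> a \<noteq> b"
  by (auto simp: nbr_def)

lemma nbr_chi: "nbr a b \<Longrightarrow> chi b = - chi a"
proof -
  assume "nbr a b"
  then have "odd (fst a - fst b + (snd a - snd b))"
    unfolding nbr_def by presburger
  then show ?thesis by (auto simp: chi_def)
qed

lemma chi_square [simp]: "chi a * chi a = 1"
  by (simp add: chi_def)

lemma chi_cases: "chi a = 1 \<or> chi a = -1"
  by (simp add: chi_def)

lemma chi_nz [simp]: "chi a \<noteq> 0"
  by (simp add: chi_def)

lemma phi_pair: "a \<noteq> b \<Longrightarrow> phi {a, b} s = (snd b - snd a) * (rk a s - rk b s)"
  by (simp add: phi_def algebra_simps)

lemma phi_horizontal: "phi {(x, y), (x + 1, y)} s = 0"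
  by (simp add: phi_pair)

lemma phi_vertical: "phi {(x, y), (x, y + 1)} s = rk (x, y) s - rk (x, y + 1) s"
  by (simp add: phi_pair)

lemma nbr_cases:
  assumes "nbr a b"
  obtains (hor) x y where "{a, b} = {(x, y), (x + 1, y)}"
  | (ver) x y where "{a, b} = {(x, y), (x, y + 1)}"
proof -
  obtain x y x' y' where ab: "a = (x, y)" "b = (x', y')" by (metis surj_pair)
  have "(y = y' \<and> (x' = x + 1 \<or> x = x' + 1)) \<or> (x = x' \<and> (y' = y + 1 \<or> y = y' + 1))"
    using assms by (auto simp: nbr_def ab abs_if split: if_splits)
  then show thesis
    using hor[of x y] hor[of x' y] ver[of x y] ver[of x y'] by (auto simp: ab insert_commute)
qed

lemma chi_right [simp]: "chi (x + 1, y) = - chi (x, y)"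
  and chi_up [simp]: "chi (x, y + 1) = - chi (x, y)"
  by (auto simp: chi_def)

lemma rk_antisym: "rk b a = - rk a b"
  by (auto simp: rk_def sgn_if)

lemma rk_self [simp]: "rk a a = 0"
  by (simp add: rk_def)

text \<open>The two cells have opposite colours, and a cell outside the pair lies on the same side
  of both.\<close>

lemma rk_hor_sum: "s \<noteq> (x, y) \<Longrightarrow> s \<noteq> (x + 1, y) \<Longrightarrow> rk s (x, y) + rk s (x + 1, y) = 0"
  by (cases s) (auto simp: rk_def sgn_if)

definition is_dom :: "cell set \<Rightarrow> bool" where
  "is_dom h \<longleftrightarrow> (\<exists>a b. h = {a, b} \<and> nbr a b)"

lemma is_dom_hor: "is_dom {(x, y), (x + 1, y)}"
  and is_dom_ver: "is_dom {(x, y), (x, y + 1)}"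
  unfolding is_dom_def nbr_def by force+

lemma is_dom_cases:
  assumes "is_dom h"
  obtains (hor) x y where "h = {(x, y), (x + 1, y)}"
  | (ver) x y where "h = {(x, y), (x, y + 1)}"
  using assms nbr_cases unfolding is_dom_def by metis

lemma is_dom_finite [simp]: "is_dom h \<Longrightarrow> finite h"
  by (auto simp: is_dom_def)

lemma is_dom_chi: "is_dom h \<Longrightarrow> sum chi h = 0"
  by (erule is_dom_cases) auto

lemma is_dom_nonempty: "is_dom h \<Longrightarrow> h \<noteq> {}"
  by (auto simp: is_dom_def)

lemma phi_self: "is_dom h \<Longrightarrow> sum (phi h) h = 0"
  by (erule is_dom_cases) (auto simp: phi_horizontal phi_vertical rk_def)

text \<open>If one domino lies in a row, its own \<open>phi\<close> vanishes and its two cells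
  cancel in that of the other. For two transverse dominoes in the same pair of rows, the two rows
  cancel; if they share one row only, it is the upper one for one domino and the lower one for the
  other, and this sign offsets the antisymmetry of \<open>rk\<close>.\<close>

lemma phi_sym:
  assumes "is_dom h" "is_dom h'" "h \<inter> h' = {}"
  shows "sum (phi h) h' = sum (phi h') h"
  using assms(1)
proof (cases rule: is_dom_cases)
  case (hor x y)
  note h = hor
  show ?thesis using assms(2)
  proof (cases rule: is_dom_cases)
    case (hor x' y')
    then show ?thesis by (simp add: h phi_horizontal)
  next
    case (ver x' y')
    have "rk (x', y') (x, y) + rk (x', y') (x + 1, y) = 0"
      "rk (x', y' + 1) (x, y) + rk (x', y' + 1) (x + 1, y) = 0"
      using assms(3) by (intro rk_hor_sum; auto simp: h ver)+
    then show ?thesis by (simp add: h ver phi_horizontal phi_vertical)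
  qed
next
  case (ver x y)
  note h = ver
  show ?thesis using assms(2)
  proof (cases rule: is_dom_cases)
    case (hor x' y')
    have "rk (x, y) (x', y') + rk (x, y) (x' + 1, y') = 0"
      "rk (x, y + 1) (x', y') + rk (x, y + 1) (x' + 1, y') = 0"
      using assms(3) by (intro rk_hor_sum; auto simp: h hor)+
    then show ?thesis by (simp add: h hor phi_horizontal phi_vertical)
  next
    case (ver x' y')
    have "x \<noteq> x'" if "y = y' \<or> y = y' + 1 \<or> y' = y + 1"
      using assms(3) that by (auto simp: h ver)
    then show ?thesis by (auto simp: h ver phi_vertical rk_def sgn_if)
  qed
qed

subsection \<open>Floors and walks of plugs\<close>

locale region =
  fixes S :: "cell set"
  assumes finite_S: "finite S"
begin

definition matchings :: "cell set set set" where
  "matchings = {f. (\<forall>h\<in>f. is_dom h \<and> h \<subseteq> S) \<and> pairwise disjnt f}"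

text \<open>The plug above a floor with horizontal dominoes \<open>f\<close> whose plug from below is \<open>p\<close>.\<close>

definition nxt :: "cell set \<Rightarrow> cell set set \<Rightarrow> cell set" where
  "nxt p f = S - p - \<Union>f"

fun walk :: "cell set \<Rightarrow> cell set set list \<Rightarrow> cell set \<Rightarrow> bool" where
  "walk p [] q \<longleftrightarrow> p = q"
| "walk p (f # fs) q \<longleftrightarrow> f \<in> matchings \<and> \<Union>f \<inter> p = {} \<and> walk (nxt p f) fs q"

text \<open>Colours alternate with height, so over the same cell a vertical domino entering from
  below and one leaving above count with opposite signs. Up to a global sign, the value is four
  times the twist contributed by the floor.\<close>

definition G :: "cell set \<Rightarrow> cell set set \<Rightarrow> int" where
  "G p f = (\<Sum>h\<in>f. sum (phi h) p - sum (phi h) (nxt p f))"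

fun Gs :: "cell set \<Rightarrow> cell set set list \<Rightarrow> int" where
  "Gs p [] = 0"
| "Gs p (f # fs) = G p f + Gs (nxt p f) fs"

definition plug :: "cell set \<Rightarrow> cell set set list \<Rightarrow> cell set" where
  "plug p fs = foldl nxt p fs"

lemma plug_simps [simp]:
  "plug p [] = p" "plug p (f # fs) = plug (nxt p f) fs" "plug p (xs @ ys) = plug (plug p xs) ys"
  by (simp_all add: plug_def)

lemma walk_plug: "walk p fs q \<Longrightarrow> plug p fs = q"
  by (induction fs arbitrary: p) auto

lemma walk_append: "walk p (xs @ ys) q \<longleftrightarrow> walk p xs (plug p xs) \<and> walk (plug p xs) ys q"
  by (induction xs arbitrary: p) auto

lemma walk_appendI: "walk p xs r \<Longrightarrow> walk r ys q \<Longrightarrow> walk p (xs @ ys) q"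
  using walk_append walk_plug by metis

lemma Gs_append: "Gs p (xs @ ys) = Gs p xs + Gs (plug p xs) ys"
  by (induction xs arbitrary: p) auto

lemma nxt_subset: "nxt p f \<subseteq> S"
  by (auto simp: nxt_def)

lemma plug_subset: "p \<subseteq> S \<Longrightarrow> plug p fs \<subseteq> S"
  by (induction fs arbitrary: p) (auto simp: nxt_subset)

lemma nxt_nxt: "p \<subseteq> S \<Longrightarrow> \<Union>f \<inter> p = {} \<Longrightarrow> nxt (nxt p f) f = p"
  by (auto simp: nxt_def)

lemma nxt_disj: "\<Union>f \<inter> nxt p f = {}"
  by (auto simp: nxt_def)

lemma finite_matchings: "finite matchings"
proof -
  have "matchings \<subseteq> Pow (Pow S)" by (auto simp: matchings_def)
  then show ?thesis using finite_S by (meson finite_Pow_iff finite_subset)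
qed

lemma matching_finite:
  assumes "f \<in> matchings"
  shows "finite f"
proof (rule finite_subset)
  show "f \<subseteq> Pow S" using assms by (auto simp: matchings_def)
qed (simp add: finite_S)

lemma matching_Union: "f \<in> matchings \<Longrightarrow> \<Union>f \<subseteq> S"
  by (auto simp: matchings_def)

lemma matching_empty [simp]: "{} \<in> matchings"
  by (auto simp: matchings_def)

lemma sum_matching:
  fixes g :: "cell \<Rightarrow> int"
  assumes "f \<in> matchings"
  shows "sum g (\<Union>f) = (\<Sum>h\<in>f. sum g h)"
  using assms by (subst sum.Union_disjoint) (auto simp: matchings_def pairwise_def disjnt_def)

lemma sum_split:
  fixes g :: "cell \<Rightarrow> int"
  assumes "f \<in> matchings" "p \<subseteq> S" "\<Union>f \<inter> p = {}"
  shows "sum g S = sum g p + sum g (nxt p f) + (\<Sum>h\<in>f. sum g h)"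
proof -
  have S: "S = p \<union> nxt p f \<union> \<Union>f"
    using assms(2) matching_Union[OF assms(1)] unfolding nxt_def by blast
  have fin: "finite p" "finite (nxt p f)" "finite (\<Union>f)"
    using finite_S S by (metis finite_Un)+
  have "sum g (p \<union> nxt p f \<union> \<Union>f) = sum g p + sum g (nxt p f) + sum g (\<Union>f)"
    using fin assms(3) by (subst sum.union_disjoint, auto simp: nxt_def)+
  then show ?thesis using S sum_matching[OF assms(1)] by metis
qed

lemma chg_nxt:
  assumes "f \<in> matchings" "p \<subseteq> S" "\<Union>f \<inter> p = {}" "sum chi S = 0" "sum chi p = 0"
  shows "sum chi (nxt p f) = 0"
proof -
  have "(\<Sum>h\<in>f. sum chi h) = 0"
    using assms(1) by (intro sum.neutral) (auto simp: matchings_def is_dom_chi)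
  then show ?thesis using sum_split[OF assms(1-3), of chi] assms(4,5) by simp
qed

lemma walk_balanced:
  assumes "sum chi S = 0" "p \<subseteq> S" "sum chi p = 0" "walk p fs q"
  shows "q \<subseteq> S \<and> sum chi q = 0"
  using assms(2-4)
proof (induction fs arbitrary: p)
  case (Cons f fs)
  then show ?case using chg_nxt[of f p] assms(1) Cons.IH[OF nxt_subset] by simp
qed simp

lemma walk_matchings: "walk p fs q \<Longrightarrow> set fs \<subseteq> matchings"
  by (induction fs arbitrary: p) auto

text \<open>The self term vanishes and, by symmetry, the pairing of \<open>h\<close> with the rest
  of its floor is read from the other dominoes. The left side does not depend on the floor, which
  allows two floors containing \<open>h\<close> to be compared.\<close>

lemma phi_split:
  assumes "f \<in> matchings" "p \<subseteq> S" "\<Union>f \<inter> p = {}" "h \<in> f"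
  shows "sum (phi h) S = sum (phi h) p + sum (phi h) (nxt p f) + (\<Sum>h'\<in>f - {h}. sum (phi h') h)"
proof -
  have "(\<Sum>h'\<in>f. sum (phi h) h') = sum (phi h) h + (\<Sum>h'\<in>f - {h}. sum (phi h) h')"
    using assms(4) matching_finite[OF assms(1)] by (simp add: sum.remove)
  moreover have "sum (phi h) h = 0" using assms by (auto simp: matchings_def phi_self)
  moreover have "sum (phi h) h' = sum (phi h') h" if "h' \<in> f - {h}" for h'
  proof (rule phi_sym)
    have "h' \<in> f" "h \<noteq> h'" using that by auto
    then show "is_dom h" "is_dom h'" "h \<inter> h' = {}"
      using assms(1,4) unfolding matchings_def pairwise_def disjnt_def by blast+
  qed
  then have "(\<Sum>h'\<in>f - {h}. sum (phi h) h') = (\<Sum>h'\<in>f - {h}. sum (phi h') h)"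
    by (rule sum.cong[OF refl])
  ultimately show ?thesis using sum_split[OF assms(1-3), of "phi h"] by simp
qed

lemma G_empty [simp]: "G p {} = 0"
  by (simp add: G_def)

lemma G_rev: "p \<subseteq> S \<Longrightarrow> \<Union>f \<inter> p = {} \<Longrightarrow> G (nxt p f) f = - G p f"
  by (simp add: G_def nxt_nxt sum_negf[symmetric])

text \<open>Reflection in a horizontal plane exchanges the two plugs of each floor and so reverses
  the sign of its contribution. Attainable values are therefore symmetric about 0, and connecting
  walks can be undone.\<close>

lemma walk_rev:
  assumes "p \<subseteq> S" "walk p fs q"
  shows "walk q (rev fs) p \<and> Gs q (rev fs) = - Gs p fs"
  using assms
proof (induction fs arbitrary: p)
  case (Cons f fs)
  have IH: "walk q (rev fs) (nxt p f) \<and> Gs q (rev fs) = - Gs (nxt p f) fs"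
    using Cons nxt_subset by auto
  have "plug q (rev fs) = nxt p f" using IH walk_plug by blast
  then show ?case using IH Cons.prems nxt_disj[of f p]
    by (auto simp: walk_append Gs_append nxt_nxt G_rev)
qed auto

subsection \<open>Invariance under flips\<close>

text \<open>Removing \<open>h\<close> from both floors adds its cells to the plug in between. What
  the other dominoes gain by this is matched with what \<open>h\<close> contributed by applying
  \<open>phi_split\<close> to \<open>h\<close> in either floor: both expansions equal
  \<open>sum (phi h) S\<close>.\<close>

lemma G_vertical_flip:
  assumes f: "insert h f \<in> matchings" "h \<notin> f" and f': "insert h f' \<in> matchings" "h \<notin> f'"
    and p: "p \<subseteq> S" "\<Union>(insert h f) \<inter> p = {}" and q: "q = nxt p (insert h f)"
    and f'q: "\<Union>(insert h f') \<inter> q = {}"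
  shows "G p (insert h f) + G q (insert h f') = G p f + G (nxt p f) f'"
    and "nxt p f = q \<union> h" and "nxt (nxt p f) f' = nxt q (insert h f')"
proof -
  have hS: "h \<subseteq> S" and dh: "is_dom h" using f by (auto simp: matchings_def)
  have hf: "h \<inter> h' = {}" if "h' \<in> f" for h' 
    using f that by (auto simp: matchings_def pairwise_def disjnt_def)
  have hf': "h \<inter> h' = {}" if "h' \<in> f'" for h' 
    using f' that by (auto simp: matchings_def pairwise_def disjnt_def)
  show qh: "nxt p f = q \<union> h"
    using hS p hf by (fastforce simp: q nxt_def)
  show r: "nxt (nxt p f) f' = nxt q (insert h f')"
    unfolding qh by (auto simp: nxt_def)
  define r where "r = nxt q (insert h f')"
  have finf: "finite f" "finite f'" using f f' matching_finite by (metis finite_insert)+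
  have qS: "q \<subseteq> S" using q nxt_subset by simp
  have finq: "finite q" using qS finite_S finite_subset by blast
  have finh: "finite h" using dh by simp
  have hq: "q \<inter> h = {}" using q by (auto simp: nxt_def)
  have Gf: "G p f = (\<Sum>h'\<in>f. sum (phi h') p - sum (phi h') q) - (\<Sum>h'\<in>f. sum (phi h') h)"
    unfolding G_def qh using finq finh hq
    by (simp add: sum.union_disjoint sum_subtractf sum.distrib algebra_simps)
  have Gf': "G (nxt p f) f' = (\<Sum>h'\<in>f'. sum (phi h') q - sum (phi h') r) + (\<Sum>h'\<in>f'. sum (phi h') h)"
    unfolding G_def r unfolding qh r_def using finq finh hq
    by (simp add: sum.union_disjoint sum_subtractf sum.distrib algebra_simps)
  have Gh: "G p (insert h f) = (\<Sum>h'\<in>f. sum (phi h') p - sum (phi h') q) + sum (phi h) p - sum (phi h) q"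
    unfolding G_def q[symmetric] using f finf by simp
  have Gh': "G q (insert h f') = (\<Sum>h'\<in>f'. sum (phi h') q - sum (phi h') r) + sum (phi h) q - sum (phi h) r"
    unfolding G_def r_def[symmetric] using f' finf by simp
  have "sum (phi h) S = sum (phi h) p + sum (phi h) q + (\<Sum>h'\<in>f. sum (phi h') h)"
    using phi_split[OF f(1) p, of h] f(2) q by simp
  moreover have "sum (phi h) S = sum (phi h) q + sum (phi h) r + (\<Sum>h'\<in>f'. sum (phi h') h)"
    using phi_split[OF f'(1) qS f'q, of h] f'(2) r_def by simp
  ultimately show "G p (insert h f) + G q (insert h f') = G p f + G (nxt p f) f'"
    unfolding Gf Gf' Gh Gh' by simp
qed

text \<open>Dominoes along the rows contribute nothing. The two transverse dominoes replacing them
  cancel at every cell outside the square, and the square meets neither plug.\<close>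

lemma G_horizontal_flip:
  assumes f: "insert h1 (insert h2 f) \<in> matchings" "h1 \<notin> f" "h2 \<notin> f"
    and h: "h1 = {(x, y), (x + 1, y)}" "h2 = {(x, y + 1), (x + 1, y + 1)}"
    and k: "k1 = {(x, y), (x, y + 1)}" "k2 = {(x + 1, y), (x + 1, y + 1)}"
    and p: "p \<subseteq> S" "\<Union>(insert h1 (insert h2 f)) \<inter> p = {}"
  shows "G p (insert k1 (insert k2 f)) = G p (insert h1 (insert h2 f))"
    and "nxt p (insert k1 (insert k2 f)) = nxt p (insert h1 (insert h2 f))"
    and "insert k1 (insert k2 f) \<in> matchings" "k1 \<notin> f" "k2 \<notin> f"
proof -
  show n: "nxt p (insert k1 (insert k2 f)) = nxt p (insert h1 (insert h2 f))"
    by (auto simp: nxt_def h k)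
  have hf: "h' \<inter> {(x, y), (x + 1, y), (x, y + 1), (x + 1, y + 1)} = {}" if "h' \<in> f" for h'
  proof -
    have "h' \<noteq> h1" "h' \<noteq> h2" using that f by auto
    then have "disjnt h' h1" "disjnt h' h2"
      using f(1) that by (auto simp: matchings_def pairwise_def)
    then show ?thesis by (auto simp: h disjnt_def)
  qed
  show kf: "k1 \<notin> f" "k2 \<notin> f" using hf by (auto simp: k)
  show "insert k1 (insert k2 f) \<in> matchings"
  proof -
    have "is_dom k1" "is_dom k2" unfolding k by (rule is_dom_ver)+
    moreover have "disjnt k1 k2" by (auto simp: k)
    moreover have "disjnt k1 h'" "disjnt k2 h'" if "h' \<in> f" for h'
      using hf[OF that] by (auto simp: k disjnt_def)
    moreover have "k1 \<subseteq> S" "k2 \<subseteq> S" using f(1) by (auto simp: matchings_def h k)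
    ultimately show ?thesis using f(1)
      by (auto simp: matchings_def pairwise_insert disjnt_sym)
  qed
  have fin: "finite f" using matching_finite[OF f(1)] by simp
  have k12: "k1 \<noteq> k2" "h1 \<noteq> h2" by (auto simp: k h doubleton_eq_iff)
  have z: "phi k1 s + phi k2 s = 0" if "s \<notin> {(x, y), (x + 1, y), (x, y + 1), (x + 1, y + 1)}" for s
    using that by (cases s) (auto simp: k phi_vertical phi_pair rk_def sgn_if)
  have "sum (phi k1) p + sum (phi k2) p = 0"
    unfolding sum.distrib[symmetric] using p(2) by (intro sum.neutral ballI z) (auto simp: h)
  moreover have "sum (phi k1) q + sum (phi k2) q = 0" if "q = nxt p (insert h1 (insert h2 f))" for q
    unfolding sum.distrib[symmetric] that by (intro sum.neutral ballI z) (auto simp: h nxt_def)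
  moreover have "phi h1 = (\<lambda>s. 0)" "phi h2 = (\<lambda>s. 0)" by (auto simp: h phi_horizontal)
  ultimately show "G p (insert k1 (insert k2 f)) = G p (insert h1 (insert h2 f))"
    unfolding G_def n using fin kf f k12 by (simp add: algebra_simps)
qed

end


section \<open>Integrality of the twist\<close>

definition pre :: "int \<Rightarrow> cell set \<Rightarrow> int" where
  "pre y X = (\<Sum>a\<in>X. of_bool (snd a \<le> y))"

text \<open>For a domino, the sum selects the upper cell if two rows are crossed, and is empty if
  the domino lies inside a row.\<close>

definition nu :: "cell set \<Rightarrow> cell \<Rightarrow> int" where
  "nu h s = (\<Sum>a\<in>h. if \<exists>b\<in>h. snd b < snd a then rk a s else 0)"

lemma even_sum_diff:
  fixes f g :: "'a \<Rightarrow> int"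
  assumes "\<And>i. i \<in> A \<Longrightarrow> even (f i - g i)"
  shows "even (sum f A - sum g A)"
  unfolding sum_subtractf[symmetric] using assms by (rule dvd_sum)

text \<open>Lower minus upper is the sum minus twice the upper. The upper term is odd exactly if the
  domino crosses into the row of \<open>s\<close>, that is, if just one of its cells lies below this
  row.\<close>

lemma phi_nu:
  assumes "is_dom h" "s \<notin> h"
  shows "phi h s = (\<Sum>a\<in>h. rk a s) - 2 * nu h s" and "even (nu h s - pre (snd s - 1) h)"
proof -
  have "phi h s = (\<Sum>a\<in>h. rk a s) - 2 * nu h s \<and> even (nu h s - pre (snd s - 1) h)"
    using assms(1)
  proof (cases rule: is_dom_cases)
    case (hor x y)
    have "rk s (x, y) + rk s (x + 1, y) = 0"
      using assms(2) by (intro rk_hor_sum) (auto simp: hor)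
    then have "rk (x, y) s + rk (x + 1, y) s = 0"
      by (metis rk_antisym add.inverse_neutral minus_add_distrib add.commute)
    moreover have "pre (snd s - 1) h = 2 * of_bool (y \<le> snd s - 1)"
      by (simp add: hor pre_def del: sum_of_bool_eq)
    ultimately show ?thesis by (auto simp: hor phi_horizontal nu_def)
  next
    case (ver x y)
    have "even (rk (x, y + 1) s - of_bool (snd s = y + 1))"
      using assms(2) by (cases s) (auto simp: ver rk_def sgn_if chi_def)
    moreover have "pre (snd s - 1) h = of_bool (y \<le> snd s - 1) + of_bool (y + 1 \<le> snd s - 1)"
      by (simp add: ver pre_def del: sum_of_bool_eq)
    ultimately show ?thesis by (auto simp: ver phi_vertical nu_def)
  qed
  then show "phi h s = (\<Sum>a\<in>h. rk a s) - 2 * nu h s" "even (nu h s - pre (snd s - 1) h)"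
    by auto
qed

lemma rk_sum_neg: "(\<Sum>s\<in>X. \<Sum>a\<in>Y. rk s a) = - (\<Sum>s\<in>X. \<Sum>a\<in>Y. rk a s)"
proof -
  have "(\<Sum>s\<in>X. \<Sum>a\<in>Y. rk s a) = (\<Sum>s\<in>X. \<Sum>a\<in>Y. - rk a s)"
    by (intro sum.cong refl rk_antisym)
  then show ?thesis by (simp add: sum_negf)
qed

lemma even_sum_chi_iff: "even (sum chi p) \<longleftrightarrow> even (card p)"
proof (cases "finite p")
  case True
  have "even (sum chi p - (\<Sum>a\<in>p. 1))"
    by (rule even_sum_diff) (auto simp: chi_def)
  then show ?thesis by auto
qed auto

context region
begin

text \<open>Counting rows modulo 2, the number of dominoes of a floor crossing from one row to the next is
  determined by the numbers of cells of the plugs below the crossing. Everything in the contribution of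
  the floor except \<open>card p * card q\<close> then splits into a term in \<open>p\<close> and a term in \<open>q\<close>.\<close>

definition row_pot :: "cell set \<Rightarrow> int" where
  "row_pot p = (\<Sum>s\<in>p. pre (snd s - 1) S + pre (snd s - 1) p)"

text \<open>\<open>nu\<close> enters \<open>phi\<close> with a factor 2, so modulo 4 only its parity
  matters and row counts may replace it; the \<open>rk\<close> term is exact.\<close>

definition pot :: "cell set \<Rightarrow> int" where
  "pot p = 2 * row_pot p - (\<Sum>s\<in>p. \<Sum>a\<in>S. rk a s)"

lemma G_mod4:
  assumes f: "f \<in> matchings" and p: "p \<subseteq> S" "\<Union>f \<inter> p = {}" and ev: "even (card p)"
  shows "4 dvd G p f - (pot (nxt p f) - pot p)"
proof -
  define q where "q = nxt p f"
  have fq: "\<Union>f \<inter> q = {}" and pq: "p \<inter> q = {}" by (auto simp: q_def nxt_def)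
  have fin: "finite p" "finite q"
    using p(1) finite_S nxt_subset[of p f] finite_subset unfolding q_def by blast+
  note split = sum_split[OF f p, folded q_def]
  \<comment> \<open>By antisymmetry a plug does not interact with itself, and the two plugs interact
    through the single number \<open>Kpq\<close>.\<close>
  have rk0: "(\<Sum>s\<in>X. \<Sum>a\<in>X. rk a s) = 0" for X
    using sum.swap[of "\<lambda>a s. rk a s" X X] rk_sum_neg[of X X] by simp
  define Kpq where "Kpq = (\<Sum>s\<in>p. \<Sum>a\<in>q. rk a s)"
  have Kqp: "(\<Sum>s\<in>q. \<Sum>a\<in>p. rk a s) = - Kpq"
    unfolding Kpq_def using sum.swap[of "\<lambda>a s. rk a s" p q] rk_sum_neg[of p q] by simp
  have phif: "(\<Sum>h\<in>f. sum (phi h) X) = (\<Sum>s\<in>X. \<Sum>h\<in>f. \<Sum>a\<in>h. rk a s) - 2 * (\<Sum>s\<in>X. \<Sum>h\<in>f. nu h s)"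
    if "\<Union>f \<inter> X = {}" for X
  proof -
    have "(\<Sum>h\<in>f. sum (phi h) X) = (\<Sum>h\<in>f. \<Sum>s\<in>X. (\<Sum>a\<in>h. rk a s) - 2 * nu h s)"
      using f that by (intro sum.cong refl phi_nu(1)) (auto simp: matchings_def)
    also have "\<dots> = (\<Sum>s\<in>X. \<Sum>h\<in>f. (\<Sum>a\<in>h. rk a s) - 2 * nu h s)" by (rule sum.swap)
    finally show ?thesis by (simp add: sum_subtractf sum_distrib_left)
  qed
  have Sf: "(\<Sum>s\<in>X. \<Sum>h\<in>f. \<Sum>a\<in>h. rk a s)
      = (\<Sum>s\<in>X. \<Sum>a\<in>S. rk a s) - (\<Sum>s\<in>X. \<Sum>a\<in>p. rk a s) - (\<Sum>s\<in>X. \<Sum>a\<in>q. rk a s)" for X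
    unfolding sum_subtractf[symmetric] by (rule sum.cong[OF refl]) (use split[of "\<lambda>a. rk a s" for s] in simp)
  define nup nuq where "nup = (\<Sum>s\<in>p. \<Sum>h\<in>f. nu h s)" and "nuq = (\<Sum>s\<in>q. \<Sum>h\<in>f. nu h s)"
  have G: "G p f = (\<Sum>s\<in>p. \<Sum>a\<in>S. rk a s) - (\<Sum>s\<in>q. \<Sum>a\<in>S. rk a s) - 2 * Kpq - 2 * nup + 2 * nuq"
    unfolding G_def q_def[symmetric] sum_subtractf phif[OF p(2)] phif[OF fq] Sf nup_def nuq_def
    by (simp add: rk0 Kqp Kpq_def[symmetric])
  \<comment> \<open>Modulo 2, the floor cells below the row of \<open>s\<close> are all cells of the
    region there plus those of both plugs.\<close>
  have nuX: "even ((\<Sum>s\<in>X. \<Sum>h\<in>f. nu h s)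
      - (\<Sum>s\<in>X. pre (snd s - 1) S + pre (snd s - 1) p + pre (snd s - 1) q))"
    if "\<Union>f \<inter> X = {}" for X
  proof (rule even_sum_diff)
    fix s assume s: "s \<in> X"
    have "even ((\<Sum>h\<in>f. nu h s) - (\<Sum>h\<in>f. pre (snd s - 1) h))"
      using f that s by (intro even_sum_diff phi_nu(2)) (auto simp: matchings_def)
    moreover have "(\<Sum>h\<in>f. pre (snd s - 1) h) = pre (snd s - 1) S - pre (snd s - 1) p - pre (snd s - 1) q"
      using split[of "\<lambda>a. of_bool (snd a \<le> snd s - 1)"] unfolding pre_def by linarith
    ultimately show "even ((\<Sum>h\<in>f. nu h s) - (pre (snd s - 1) S + pre (snd s - 1) p + pre (snd s - 1) q))"
      by simp
  qed
  \<comment> \<open>\<open>rk\<close> is odd for distinct cells of one row, so modulo 2 this counts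
    the pairs in a common row.\<close>
  have Kev: "even (Kpq - (\<Sum>s\<in>p. pre (snd s) q - pre (snd s - 1) q))"
    unfolding Kpq_def pre_def sum_subtractf[symmetric]
    by (intro dvd_sum) (use pq in \<open>auto simp: rk_def chi_def sgn_if split: if_splits\<close>)
  \<comment> \<open>Each pair is counted once: either the cell of \<open>q\<close> is not above that
    of \<open>p\<close>, or it is strictly above.\<close>
  have cross: "(\<Sum>s\<in>p. pre (snd s) q) + (\<Sum>s\<in>q. pre (snd s - 1) p) = int (card p) * int (card q)"
  proof -
    have "(\<Sum>s\<in>q. pre (snd s - 1) p) = (\<Sum>s\<in>p. \<Sum>a\<in>q. of_bool (snd s \<le> snd a - 1))"
      unfolding pre_def by (rule sum.swap)
    then have "(\<Sum>s\<in>p. pre (snd s) q) + (\<Sum>s\<in>q. pre (snd s - 1) p)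
        = (\<Sum>s\<in>p. \<Sum>a\<in>q. of_bool (snd a \<le> snd s) + of_bool (snd s \<le> snd a - 1))"
      by (simp only: pre_def sum.distrib)
    also have "\<dots> = (\<Sum>s\<in>p. \<Sum>a\<in>q. 1)"
      by (intro sum.cong refl) auto
    finally have "(\<Sum>s\<in>p. pre (snd s) q) + (\<Sum>s\<in>q. pre (snd s - 1) p) = (\<Sum>s\<in>p. \<Sum>a\<in>q. 1)" .
    then show ?thesis by simp
  qed
  define A B C D where "A = (\<Sum>s\<in>p. pre (snd s) q)" and "B = (\<Sum>s\<in>p. pre (snd s - 1) q)"
    and "C = (\<Sum>s\<in>q. pre (snd s - 1) p)" and "D = row_pot p"
  have 1: "even (nup - (D + B))"
    using nuX[OF p(2)] by (simp add: nup_def B_def D_def row_pot_def sum.distrib)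
  have 2: "even (nuq - (row_pot q + C))"
    using nuX[OF fq] by (simp add: nuq_def C_def row_pot_def sum.distrib algebra_simps)
  have 3: "even (Kpq - (A - B))" using Kev by (simp add: A_def B_def sum_subtractf)
  \<comment> \<open>The mixed term \<open>card p * card q\<close> disappears because
    \<open>card p\<close> is even, as for every balanced plug.\<close>
  have 4: "even (A + C)" using cross ev by (simp add: A_def C_def)
  have "even (nuq - nup - Kpq - (row_pot q - row_pot p))"
    using 1 2 3 4 D_def by presburger
  then have "2 * 2 dvd 2 * (nuq - nup - Kpq - (row_pot q - row_pot p))"
    by (rule mult_dvd_mono[OF dvd_refl])
  moreover have "G p f - (pot (nxt p f) - pot p) = 2 * (nuq - nup - Kpq - (row_pot q - row_pot p))"
    unfolding G pot_def q_def[symmetric] by (simp add: algebra_simps)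
  ultimately show ?thesis by simp
qed

lemma Gs_mod4:
  assumes "sum chi S = 0" "p \<subseteq> S" "sum chi p = 0" "walk p fs q"
  shows "4 dvd Gs p fs - (pot q - pot p)"
  using assms(2-4)
proof (induction fs arbitrary: p)
  case (Cons f fs)
  have f: "f \<in> matchings" "\<Union>f \<inter> p = {}" using Cons.prems by auto
  have "4 dvd Gs (nxt p f) fs - (pot q - pot (nxt p f))"
    using Cons f chg_nxt[OF f(1) Cons.prems(1) f(2) assms(1)] nxt_subset by simp
  moreover have "4 dvd G p f - (pot (nxt p f) - pot p)"
    using G_mod4 f Cons.prems even_sum_chi_iff[of p] by simp
  ultimately have "4 dvd (Gs (nxt p f) fs - (pot q - pot (nxt p f))) + (G p f - (pot (nxt p f) - pot p))"
    by (rule dvd_add)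
  then show ?case by (simp add: algebra_simps)
qed simp

end


section \<open>Connectivity of balanced plugs\<close>

context region
begin

text \<open>An empty floor replaces a plug by its complement; counting floors in pairs undoes this,
  so that plugs can be compared directly.\<close>

definition reach :: "cell set \<Rightarrow> cell set \<Rightarrow> int \<Rightarrow> bool" where
  "reach p q w \<longleftrightarrow> (\<exists>fs. even (length fs) \<and> walk p fs q \<and> Gs p fs = w)"

lemma reach_refl: "reach p p 0"
  unfolding reach_def by (intro exI[of _ "[]"]) simp

lemma reach_trans: "reach p q v \<Longrightarrow> reach q r w \<Longrightarrow> reach p r (v + w)"
  unfolding reach_def
proof (elim exE conjE)
  fix xs ys assume "even (length xs)" "walk p xs q" "Gs p xs = v"
    "even (length ys)" "walk q ys r" "Gs q ys = w"
  then show "\<exists>fs. even (length fs) \<and> walk p fs r \<and> Gs p fs = v + w"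
    using walk_plug[of p xs q] by (intro exI[of _ "xs @ ys"]) (simp add: walk_append Gs_append)
qed

lemma reach_sym: "p \<subseteq> S \<Longrightarrow> reach p q w \<Longrightarrow> reach q p (- w)"
  unfolding reach_def using walk_rev by (metis length_rev)

lemma singleton_matching: "is_dom h \<Longrightarrow> h \<subseteq> S \<Longrightarrow> {h} \<in> matchings"
  by (simp add: matchings_def)

text \<open>The floor \<open>{h}\<close> leads to the complement of \<open>p \<union> h\<close>, and
  the empty floor above it complements again without contributing.\<close>

lemma reach_add:
  assumes "p \<subseteq> S" "is_dom h" "h \<subseteq> S" "h \<inter> p = {}"
  shows "reach p (p \<union> h) (2 * sum (phi h) p - sum (phi h) S)"
proof -
  have m: "{h} \<in> matchings" using assms(2,3) by (rule singleton_matching)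
  have "nxt (nxt p {h}) {} = p \<union> h" using assms by (auto simp: nxt_def)
  then have w: "walk p [{h}, {}] (p \<union> h)" using m assms(4) by simp
  have "sum (phi h) S = sum (phi h) p + sum (phi h) (nxt p {h})"
    using phi_split[OF m assms(1) _ , of h] assms(4) by simp
  then have "Gs p [{h}, {}] = 2 * sum (phi h) p - sum (phi h) S"
    by (simp add: G_def)
  then show ?thesis using w unfolding reach_def by (intro exI[of _ "[{h}, {}]"]) simp
qed

lemma reach_remove:
  assumes "p \<subseteq> S" "is_dom h" "h \<subseteq> S" "h \<inter> p = {}"
  shows "reach (p \<union> h) p (sum (phi h) S - 2 * sum (phi h) p)"
  using reach_sym[OF assms(1) reach_add[OF assms]] by simp

definition black :: "cell set" where
  "black = {a \<in> S. chi a = 1}"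

text \<open>Exchanging the two sides of the checkerboard turns the addition or removal of a domino
  into the hop of a particle to an adjacent free cell.\<close>

definition particles :: "cell set \<Rightarrow> cell set" where
  "particles p = (p - black) \<union> (black - p)"

lemma particles_particles: "particles (particles p) = p"
  by (auto simp: particles_def)

lemma particles_subset: "p \<subseteq> S \<Longrightarrow> particles p \<subseteq> S"
  by (auto simp: particles_def black_def)

text \<open>A particle is a white cell of the plug or a black cell missing from it. Balanced plugs
  are thus those with as many particles as there are black cells, and balance becomes conservation
  of particles.\<close>

lemma sum_chi_particles:
  assumes "p \<subseteq> S"
  shows "sum chi p = int (card black) - int (card (particles p))"
proof -
  have fin: "finite p" "finite black" using assms finite_S finite_subset by (auto simp: black_def)
  have "sum chi p = sum chi (p \<inter> black) + sum chi (p - black)"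
    using fin by (metis sum.Int_Diff)
  also have "sum chi (p \<inter> black) = (\<Sum>a\<in>p \<inter> black. 1)"
    by (rule sum.cong) (auto simp: black_def)
  also have "sum chi (p - black) = (\<Sum>a\<in>p - black. - 1)"
    using assms chi_cases by (intro sum.cong) (auto simp: black_def)
  finally have "sum chi p = int (card (p \<inter> black)) - int (card (p - black))" by simp
  moreover have "card black = card (black \<inter> p) + card (black - p)"
    using fin by (metis card_Int_Diff)
  moreover have "card (particles p) = card (p - black) + card (black - p)"
    unfolding particles_def using fin by (intro card_Un_disjoint) auto
  ultimately show ?thesis by (simp add: Int_commute)
qed

definition hops :: "cell set \<Rightarrow> cell set \<Rightarrow> bool" where
  "hops X Y \<longleftrightarrow> (\<exists>w. reach (particles X) (particles Y) w)"

lemma hops_refl: "hops X X"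
  using reach_refl by (auto simp: hops_def)

lemma hops_trans: "hops X Y \<Longrightarrow> hops Y Z \<Longrightarrow> hops X Z"
  using reach_trans unfolding hops_def by blast

text \<open>A hop from black to white adds the domino \<open>{a, b}\<close> to the plug, and a hop
  from white to black removes it.\<close>

lemma hops_step:
  assumes "X \<subseteq> S" "a \<in> X" "b \<in> S - X" "nbr a b"
  shows "hops X (insert b (X - {a}))"
proof -
  have h: "is_dom {a, b}" "{a, b} \<subseteq> S" using assms unfolding is_dom_def by blast+
  have ab: "a \<in> S" "a \<noteq> b" "chi b = - chi a" using assms nbr_chi nbr_neq by auto
  show ?thesis
  proof (cases "chi a = 1")
    case True
    have "{a, b} \<inter> particles X = {}" "particles (insert b (X - {a})) = particles X \<union> {a, b}"
      using assms ab True by (auto simp: particles_def black_def)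
    then show ?thesis using reach_add[OF particles_subset[OF assms(1)] h] by (auto simp: hops_def)
  next
    case False
    let ?p = "particles (insert b (X - {a}))"
    have "chi b = 1" using False ab chi_cases by fastforce
    then have "{a, b} \<inter> ?p = {}" "particles X = ?p \<union> {a, b}"
      using assms ab False by (auto simp: particles_def black_def)
    moreover have "?p \<subseteq> S" using assms by (intro particles_subset) auto
    ultimately show ?thesis using reach_remove[OF _ h] unfolding hops_def by metis
  qed
qed

definition adj :: "cell \<Rightarrow> cell \<Rightarrow> bool" where
  "adj a b \<longleftrightarrow> a \<in> S \<and> b \<in> S \<and> nbr a b"

text \<open>Particles are indistinguishable, so an occupied cell is no obstacle: if the last cell
  before the target is occupied, its particle moves on first and is then replaced by the one coming
  from \<open>a\<close>.\<close>

lemma hops_path: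
  assumes "adj\<^sup>*\<^sup>* a b" "X \<subseteq> S" "a \<in> X" "b \<in> S - X"
  shows "hops X (insert b (X - {a}))"
  using assms
proof (induction arbitrary: X rule: rtranclp_induct)
  case base
  then show ?case by simp
next
  case (step b b')
  have bb': "b \<in> S" "b' \<in> S" "nbr b b'" using step.hyps by (auto simp: adj_def)
  show ?case
  proof (cases "b \<in> X")
    case False
    have "hops X (insert b (X - {a}))" using step False bb' by blast
    moreover have "hops (insert b (X - {a})) (insert b' (insert b (X - {a}) - {b}))"
      using step.prems bb' by (intro hops_step) (auto dest: nbr_neq)
    moreover have "insert b' (insert b (X - {a}) - {b}) = insert b' (X - {a})" using False by auto
    ultimately show ?thesis using hops_trans by metis
  next
    case True
    have 1: "hops X (insert b' (X - {b}))"
      using step.prems bb' True by (intro hops_step) auto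
    show ?thesis
    proof (cases "a = b")
      case False
      have "hops (insert b' (X - {b})) (insert b (insert b' (X - {b}) - {a}))"
        using step.prems bb' False by (intro step.IH) (auto dest: nbr_neq)
      moreover have "insert b (insert b' (X - {b}) - {a}) = insert b' (X - {a})"
        using False True step.prems by auto
      ultimately show ?thesis using 1 hops_trans by metis
    qed (use 1 in auto)
  qed
qed

end

locale connected_region = region +
  assumes connected: "a \<in> S \<Longrightarrow> b \<in> S \<Longrightarrow> adj\<^sup>*\<^sup>* a b"
    and charge_S: "sum chi S = 0"
begin

lemma hops_card:
  assumes "X \<subseteq> S" "Y \<subseteq> S" "card X = card Y"
  shows "hops X Y"
  using assms
proof (induction "card (X - Y)" arbitrary: X)
  case 0
  have "finite X" "finite Y" using 0 finite_S finite_subset by blast+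
  then have "X \<subseteq> Y" using 0 by auto
  then show ?case using 0 \<open>finite Y\<close> card_subset_eq hops_refl by metis
next
  case (Suc n)
  have fin: "finite X" "finite Y" using Suc finite_S finite_subset by blast+
  obtain a where a: "a \<in> X - Y" using Suc.hyps(2) by (metis card.empty equals0I nat.distinct(1))
  have "\<not> Y \<subseteq> X" using a Suc.prems fin by (metis card_subset_eq DiffE)
  then obtain b where b: "b \<in> Y - X" by auto
  let ?X = "insert b (X - {a})"
  have "?X - Y = (X - Y) - {a}" using b by auto
  then have n: "n = card (?X - Y)" using Suc.hyps(2) a fin by simp
  have "card X > 0" using a fin by (metis DiffD1 card_gt_0_iff empty_iff)
  then have "card ?X = card Y" using a b fin Suc.prems by simp
  then have "hops ?X Y" using Suc.hyps(1)[OF n] a b Suc.prems by auto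
  moreover have "adj\<^sup>*\<^sup>* a b" using a b Suc.prems by (intro connected) auto
  then have "hops X ?X" using a b Suc.prems by (intro hops_path) auto
  ultimately show ?case using hops_trans by blast
qed

lemma reach_balanced:
  assumes "p \<subseteq> S" "sum chi p = 0" "q \<subseteq> S" "sum chi q = 0"
  obtains w where "reach p q w"
proof -
  have "card (particles p) = card (particles q)"
    using sum_chi_particles assms by simp
  then have "hops (particles p) (particles q)"
    using assms by (intro hops_card particles_subset)
  then show thesis using that unfolding hops_def particles_particles by blast
qed

text \<open>The full plug is balanced because the region is, so it is reached in an even number of
  floors; one empty floor then complements it back to the empty plug.\<close>

lemma odd_closed_walk: obtains fs where "odd (length fs)" "walk {} fs {}"
proof -
  obtain w where "reach {} S w" by (rule reach_balanced[of "{}" S]) (simp_all add: charge_S)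
  then obtain fs where "even (length fs)" "walk {} fs S" by (auto simp: reach_def)
  then have "odd (length (fs @ [{}]))" "walk {} (fs @ [{}]) {}"
    using walk_plug[of "{}" fs S] by (auto simp: walk_append nxt_def)
  then show thesis using that by blast
qed

subsection \<open>The exchange loop around a cell with three neighbours\<close>

text \<open>Six moves through the junction \<open>c\<close>: the places \<open>n1\<close>,
  \<open>n2\<close>, \<open>n3\<close> hold two equal items (particles if \<open>c\<close> is black,
  holes if it is white), and the free third place serves to swap them. Each of the three dominoes is
  added once and removed once, so the terms in \<open>S\<close> and in the bystanders
  \<open>p\<close> cancel.\<close>

lemma exchange_loop:
  assumes S: "c \<in> S" "n1 \<in> S" "n2 \<in> S" "n3 \<in> S"
    and n: "nbr c n1" "nbr c n2" "nbr c n3" "n1 \<noteq> n2" "n1 \<noteq> n3" "n2 \<noteq> n3"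
    and p: "p \<subseteq> S" "p \<inter> {c, n1, n2, n3} = {}"
  shows "reach (p \<union> {n1, n2, c}) (p \<union> {n1, n2, c})
    (2 * (phi {c, n1} n3 - phi {c, n1} n2 + phi {c, n2} n1 - phi {c, n2} n3
      + phi {c, n3} n2 - phi {c, n3} n1))"
proof -
  have fin: "finite p" using p finite_S finite_subset by blast
  have d: "is_dom {c, n1}" "is_dom {c, n2}" "is_dom {c, n3}" using n unfolding is_dom_def by blast+
  have cn: "c \<noteq> n1" "c \<noteq> n2" "c \<noteq> n3" using n nbr_neq by auto
  have 1: "reach (p \<union> {n1, n2, c}) (p \<union> {n2}) (sum (phi {c, n1}) S - 2 * sum (phi {c, n1}) (p \<union> {n2}))"
    using reach_remove[of "p \<union> {n2}" "{c, n1}"] S n p d cn by (auto simp: insert_commute)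
  have 2: "reach (p \<union> {n2}) (p \<union> {n2, n3, c}) (2 * sum (phi {c, n3}) (p \<union> {n2}) - sum (phi {c, n3}) S)"
    using reach_add[of "p \<union> {n2}" "{c, n3}"] S n p d cn by (auto simp: insert_commute)
  have 3: "reach (p \<union> {n2, n3, c}) (p \<union> {n3}) (sum (phi {c, n2}) S - 2 * sum (phi {c, n2}) (p \<union> {n3}))"
    using reach_remove[of "p \<union> {n3}" "{c, n2}"] S n p d cn by (auto simp: insert_commute)
  have 4: "reach (p \<union> {n3}) (p \<union> {n1, n3, c}) (2 * sum (phi {c, n1}) (p \<union> {n3}) - sum (phi {c, n1}) S)"
    using reach_add[of "p \<union> {n3}" "{c, n1}"] S n p d cn by (auto simp: insert_commute)
  have 5: "reach (p \<union> {n1, n3, c}) (p \<union> {n1}) (sum (phi {c, n3}) S - 2 * sum (phi {c, n3}) (p \<union> {n1}))"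
    using reach_remove[of "p \<union> {n1}" "{c, n3}"] S n p d cn by (auto simp: insert_commute)
  have 6: "reach (p \<union> {n1}) (p \<union> {n1, n2, c}) (2 * sum (phi {c, n2}) (p \<union> {n1}) - sum (phi {c, n2}) S)"
    using reach_add[of "p \<union> {n1}" "{c, n2}"] S n p d cn by (auto simp: insert_commute)
  have s: "sum g (p \<union> {n1}) = sum g p + g n1" "sum g (p \<union> {n2}) = sum g p + g n2"
    "sum g (p \<union> {n3}) = sum g p + g n3" for g :: "cell \<Rightarrow> int"
    using fin p by (auto simp: add.commute)
  show ?thesis
    using reach_trans[OF 1 reach_trans[OF 2 reach_trans[OF 3 reach_trans[OF 4 reach_trans[OF 5 6]]]]]
    unfolding s by (simp add: algebra_simps)
qed

lemma three_neighbours_unit_twist: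
  assumes S: "c \<in> S" "n1 \<in> S" "n2 \<in> S" "n3 \<in> S"
    and n: "nbr c n1" "nbr c n2" "nbr c n3" "n1 \<noteq> n2" "n1 \<noteq> n3" "n2 \<noteq> n3"
  obtains w where "reach {} {} w" "\<bar>w\<bar> = 4"
proof -
  let ?T = "{c, n1, n2, n3}"
  have ch: "chi n1 = - chi c" "chi n2 = - chi c" "chi n3 = - chi c" using n nbr_chi by auto
  have cn: "c \<noteq> n1" "c \<noteq> n2" "c \<noteq> n3" using n nbr_neq by auto
  have "sum chi S = sum chi (S - ?T) + sum chi ?T"
    using S finite_S by (intro sum.subset_diff) auto
  then have "sum chi (S - ?T) = 2 * chi c"
    using charge_S n cn ch by simp
  \<comment> \<open>Without a further cell of the colour of \<open>c\<close>, the rest of the region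
    could not have charge \<open>2 * chi c\<close>.\<close>
  moreover have "sum chi (S - ?T) = (\<Sum>a\<in>S - ?T. - chi c)" if "\<not> (\<exists>b\<in>S - ?T. chi b = chi c)"
  proof (rule sum.cong)
    fix a assume "a \<in> S - ?T"
    then show "chi a = - chi c" using that chi_cases[of a] chi_cases[of c] by force
  qed simp
  moreover have "2 * chi c \<noteq> (\<Sum>a\<in>S - ?T. - chi c)"
  proof
    assume "2 * chi c = (\<Sum>a\<in>S - ?T. - chi c)"
    then have "2 * chi c = - int (card (S - ?T)) * chi c" by simp
    then have "2 = - int (card (S - ?T))" by (metis chi_nz mult_cancel_right)
    then show False by simp
  qed
  ultimately obtain b where b: "b \<in> S - ?T" "chi b = chi c" by metis
  \<comment> \<open>The cell \<open>b\<close> compensates the charge \<open>- chi c\<close> of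
    \<open>{n1, n2, c}\<close>, so this plug is balanced and can be reached from the empty
    one.\<close>
  let ?q = "{b} \<union> {n1, n2, c}"
  have q: "?q \<subseteq> S" "sum chi ?q = 0" using S b n cn ch by auto
  obtain v where v: "reach {} ?q v" by (rule reach_balanced[of "{}" ?q]) (use q in simp_all)
  let ?w = "2 * (phi {c, n1} n3 - phi {c, n1} n2 + phi {c, n2} n1 - phi {c, n2} n3
      + phi {c, n3} n2 - phi {c, n3} n1)"
  have l: "reach ?q ?q ?w"
    using exchange_loop[OF S n, of "{b}"] b by auto
  have "v + (?w + - v) = ?w" by algebra
  then have "reach {} {} ?w"
    using reach_trans[OF v reach_trans[OF l reach_sym[OF empty_subsetI v]]] by metis
  moreover have "\<bar>?w\<bar> = 4"
  proof -
    obtain x y where c: "c = (x, y)" by (cases c)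
    let ?N = "{(x + 1, y), (x - 1, y), (x, y + 1), (x, y - 1)}"
    have N: "n \<in> ?N" if "nbr c n" for n
      using that by (cases n) (auto simp: c nbr_def abs_if split: if_splits)
    have ch: "chi (x - 1, y) = - chi (x, y)"
      using chi_right[of "x - 1" y] by simp
    have rk: "rk (x, y) (x + 1, y) = - 1" "rk (x, y) (x - 1, y) = 1"
      by (simp_all add: rk_def ch)
    have rk0: "rk a b = 0" if "snd a \<noteq> snd b" for a b using that by (simp add: rk_def)
    let ?R = "(x + 1, y)" and ?L = "(x - 1, y)" and ?U = "(x, y + 1)" and ?D = "(x, y - 1)"
    have t: "phi {(x, y), ?R} s = 0" "phi {(x, y), ?L} s = 0"
      "phi {(x, y), ?U} ?R = - 1" "phi {(x, y), ?U} ?L = 1" "phi {(x, y), ?U} ?D = 0"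
      "phi {(x, y), ?D} ?R = 1" "phi {(x, y), ?D} ?L = - 1" "phi {(x, y), ?D} ?U = 0" for s
      by (simp_all add: phi_pair rk rk0)
    \<comment> \<open>Only the values in the four directions matter; every choice of three different
      directions gives 4 or -4.\<close>
    have fin: "\<bar>2 * (f n1 n3 - f n1 n2 + f n2 n1 - f n2 n3 + f n3 n2 - f n3 n1)\<bar> = 4"
      if f: "\<And>s. f ?R s = 0" "\<And>s. f ?L s = 0" "f ?U ?R = - 1" "f ?U ?L = 1" "f ?U ?D = 0"
        "f ?D ?R = 1" "f ?D ?L = - 1" "f ?D ?U = 0" for f :: "cell \<Rightarrow> cell \<Rightarrow> int"
    proof -
      have "n1 = ?R \<or> n1 = ?L \<or> n1 = ?U \<or> n1 = ?D" "n2 = ?R \<or> n2 = ?L \<or> n2 = ?U \<or> n2 = ?D"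
        "n3 = ?R \<or> n3 = ?L \<or> n3 = ?U \<or> n3 = ?D"
        using N[OF n(1)] N[OF n(2)] N[OF n(3)] by blast+
      then show ?thesis using n(4-6)
        by (elim disjE; simp add: f)
    qed
    show ?thesis
      by (rule fin[of "\<lambda>a s. phi {c, a} s"]) (simp_all add: c t)
  qed
  ultimately show thesis by (rule that)
qed

end


section \<open>Paths of cells have twist zero\<close>

text \<open>Since every domino is a link between consecutive cells, a floor can be recovered from
  the charges that its two plugs place on initial segments of the path.\<close>

locale path_region = region +
  fixes xs :: "cell list"
  assumes distinct_xs: "distinct xs" and set_xs: "set xs = S"
    and nbr_xs: "Suc i < length xs \<Longrightarrow> nbr (xs ! i) (xs ! Suc i)"
    and dom_xs: "is_dom h \<Longrightarrow> h \<subseteq> S \<Longrightarrow> \<exists>i. Suc i < length xs \<and> h = {xs ! i, xs ! Suc i}"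
begin

definition ch :: "nat \<Rightarrow> int" where "ch i = chi (xs ! i)"

definition edge :: "nat \<Rightarrow> cell set" where "edge i = {xs ! i, xs ! Suc i}"

definition partial :: "nat \<Rightarrow> cell set \<Rightarrow> int" where
  "partial l p = (\<Sum>i\<le>l. if xs ! i \<in> p then ch i else 0)"

definition links :: "nat set" where "links = {j. Suc j < length xs}"

definition mat :: "nat \<Rightarrow> nat \<Rightarrow> int" where
  "mat j l = ch j * ch l * sum (phi (edge j)) (edge l)"

definition close :: "nat \<Rightarrow> nat \<Rightarrow> bool" where
  "close j l \<longleftrightarrow> j = Suc l \<or> l = Suc j"

definition diag :: "nat \<Rightarrow> int" where
  "diag j = (\<Sum>l\<in>links. if close j l then mat j l else 0)"

text \<open>The matrix \<open>mat\<close> is symmetric except next to the diagonal. There the edge \<open>j\<close> is used only if the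
  partial charges at \<open>j\<close> and at its neighbours agree, which allows moving those entries to the diagonal.\<close>

definition farmat :: "nat \<Rightarrow> nat \<Rightarrow> int" where
  "farmat j l = (if close j l then 0 else mat j l)"

text \<open>A quadratic form in the partial charges, chosen so that each floor contributes a
  difference of its values. The mixed terms of two successive plugs cancel by the symmetry of
  \<open>farmat\<close>.\<close>

definition path_pot :: "cell set \<Rightarrow> int" where
  "path_pot p = (\<Sum>j\<in>links. \<Sum>l\<in>links. farmat j l * (partial j S * partial l p - partial j p * partial l p))
    + (\<Sum>j\<in>links. diag j * (partial j S * partial j p - partial j p * partial j p))"

lemma finite_links: "finite links"
  by (rule finite_subset[of _ "{..length xs}"]) (auto simp: links_def)

lemma ch_Suc: "Suc i < length xs \<Longrightarrow> ch (Suc i) = - ch i"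
  using nbr_chi nbr_xs by (auto simp: ch_def)

lemma ch_square [simp]: "ch i * ch i = 1"
  by (simp add: ch_def)

lemma xs_eq: "i < length xs \<Longrightarrow> j < length xs \<Longrightarrow> xs ! i = xs ! j \<longleftrightarrow> i = j"
  using distinct_xs nth_eq_iff_index_eq by blast

lemma sum_index:
  fixes g :: "cell \<Rightarrow> int"
  assumes "p \<subseteq> S"
  shows "sum g p = (\<Sum>i<length xs. if xs ! i \<in> p then g (xs ! i) else 0)"
proof -
  have "sum g p = (\<Sum>s\<in>S. if s \<in> p then g s else 0)"
    using assms finite_S by (simp add: sum.If_cases Int_absorb1 inf_commute)
  also have "\<dots> = (\<Sum>s\<in>(\<lambda>i. xs ! i) ` {..<length xs}. if s \<in> p then g s else 0)"
    by (rule sum.cong) (auto simp: set_xs[symmetric] set_conv_nth simp del: split_paired_Ex)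
  also have "\<dots> = (\<Sum>i<length xs. if xs ! i \<in> p then g (xs ! i) else 0)"
    by (subst sum.reindex) (auto simp: inj_on_def xs_eq)
  finally show ?thesis .
qed

text \<open>Abel summation. Consecutive cells have opposite colours, which turns the usual
  differences of \<open>g\<close> into sums over links.\<close>

lemma sum_by_parts:
  fixes g :: "cell \<Rightarrow> int"
  assumes "m < length xs"
  shows "(\<Sum>i\<le>m. if xs ! i \<in> p then g (xs ! i) else 0)
    = (\<Sum>l<m. partial l p * ch l * (g (xs ! l) + g (xs ! Suc l))) + partial m p * ch m * g (xs ! m)"
  using assms
proof (induction m)
  case 0
  have e: "sum F {..0::nat} = F 0" for F :: "nat \<Rightarrow> int" by simp
  show ?case unfolding partial_def e by simp
next
  case (Suc m)
  have c: "ch (Suc m) = - ch m" using ch_Suc Suc.prems by auto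
  have pS: "partial (Suc m) p = partial m p + (if xs ! Suc m \<in> p then - ch m else 0)"
    by (simp add: partial_def c)
  have e: "- ch m * (ch m * z) = - z" for z
    by (simp add: mult.assoc[symmetric])
  show ?case using Suc e[of "g (xs ! Suc m)"] unfolding pS c
    by (simp add: algebra_simps)
qed

lemma sum_phi_edge: "Suc l < length xs \<Longrightarrow> sum g (edge l) = g (xs ! l) + g (xs ! Suc l)"
  for g :: "cell \<Rightarrow> int"
  by (simp add: edge_def xs_eq)

text \<open>The boundary term of the summation by parts is the total charge, which is 0.\<close>

lemma sum_links:
  fixes g :: "cell \<Rightarrow> int"
  assumes "p \<subseteq> S" "sum chi p = 0"
  shows "sum g p = (\<Sum>l\<in>links. partial l p * ch l * sum g (edge l))"
proof (cases "xs = []")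
  case True
  have "links = {}" unfolding links_def using True by simp
  moreover have "p = {}" using assms(1) set_xs True by auto
  ultimately show ?thesis by simp
next
  case False
  then obtain m where m: "length xs = Suc m" by (cases "length xs") auto
  have pm: "partial m p = sum chi p"
    unfolding sum_index[OF assms(1)] partial_def ch_def m lessThan_Suc_atMost by simp
  have "sum g p = (\<Sum>l<m. partial l p * ch l * (g (xs ! l) + g (xs ! Suc l)))"
    using sum_by_parts[of m p g] m assms(2) pm sum_index[OF assms(1), of g]
    by (simp add: lessThan_Suc_atMost)
  also have "\<dots> = (\<Sum>l\<in>links. partial l p * ch l * sum g (edge l))"
    by (rule sum.cong) (auto simp: links_def m sum_phi_edge)
  finally show ?thesis .
qed

lemma partial_sum:
  assumes "p \<subseteq> S" "l < length xs"
  shows "partial l p = (\<Sum>s\<in>p. if \<exists>i\<le>l. s = xs ! i then chi s else 0)"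
proof -
  have "(\<Sum>s\<in>p. if \<exists>i\<le>l. s = xs ! i then chi s else 0)
      = (\<Sum>i<length xs. if xs ! i \<in> p then (if \<exists>j\<le>l. xs ! i = xs ! j then chi (xs ! i) else 0) else 0)"
    by (rule sum_index[OF assms(1)])
  also have "\<dots> = (\<Sum>i<length xs. if i \<le> l then (if xs ! i \<in> p then ch i else 0) else 0)"
  proof (intro sum.cong refl)
    fix i assume "i \<in> {..<length xs}"
    then have "(\<exists>j\<le>l. xs ! i = xs ! j) \<longleftrightarrow> i \<le> l" using assms(2) xs_eq by auto
    then show "(if xs ! i \<in> p then (if \<exists>j\<le>l. xs ! i = xs ! j then chi (xs ! i) else 0) else 0)
      = (if i \<le> l then (if xs ! i \<in> p then ch i else 0) else 0)" by (simp add: ch_def)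
  qed
  also have "\<dots> = (\<Sum>i\<in>{..<length xs} \<inter> {i. i \<le> l}. if xs ! i \<in> p then ch i else 0)"
    by (simp add: sum.If_cases)
  also have "{..<length xs} \<inter> {i. i \<le> l} = {..l}" using assms(2) by auto
  finally show ?thesis by (simp add: partial_def)
qed

lemma matching_edges:
  assumes "f \<in> matchings"
  shows "f = edge ` {j \<in> links. edge j \<in> f}"
proof -
  have "\<exists>j\<in>links. h = edge j" if "h \<in> f" for h
    using dom_xs[of h] assms that by (auto simp: matchings_def links_def edge_def)
  then show ?thesis by auto
qed

lemma inj_edge: "inj_on edge links"
proof (rule inj_onI)
  fix i j assume "i \<in> links" "j \<in> links" and e: "edge i = edge j"
  then have l: "Suc i < length xs" "Suc j < length xs" by (auto simp: links_def)
  have "i = j \<or> i = Suc j" "j = i \<or> j = Suc i"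
    using e l xs_eq unfolding edge_def doubleton_eq_iff by (metis Suc_lessD)+
  then show "i = j" by auto
qed

lemma sum_matching_edges:
  fixes g :: "cell set \<Rightarrow> int"
  assumes "f \<in> matchings"
  shows "sum g f = (\<Sum>j\<in>links. if edge j \<in> f then g (edge j) else 0)"
proof -
  have "sum g f = sum g (edge ` {j \<in> links. edge j \<in> f})" using matching_edges[OF assms] by simp
  also have "\<dots> = (\<Sum>j\<in>{j \<in> links. edge j \<in> f}. g (edge j))"
    using inj_edge by (subst sum.reindex) (auto simp: inj_on_def)
  also have "\<dots> = (\<Sum>j\<in>links. if edge j \<in> f then g (edge j) else 0)"
    using finite_links by (simp add: sum.inter_filter)
  finally show ?thesis .
qed

text \<open>A link other than \<open>j\<close> lies wholly inside or wholly outside the initial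
  segment up to \<open>j\<close> and carries no charge into it; the link \<open>j\<close> alone is
  cut and leaves \<open>ch j\<close> there.\<close>

lemma edge_indicator:
  assumes "f \<in> matchings" "p \<subseteq> S" "\<Union>f \<inter> p = {}" "j \<in> links"
  shows "(if edge j \<in> f then ch j else 0) = partial j S - partial j p - partial j (nxt p f)"
proof -
  have j: "Suc j < length xs" using assms(4) by (simp add: links_def)
  let ?g = "\<lambda>s. if \<exists>i\<le>j. s = xs ! i then chi s else 0"
  have "(\<Sum>h\<in>f. sum ?g h) = (\<Sum>i\<in>links. if edge i \<in> f then sum ?g (edge i) else 0)"
    by (rule sum_matching_edges[OF assms(1)])
  also have "\<dots> = (\<Sum>i\<in>links. if i = j then (if edge j \<in> f then ch j else 0) else 0)"
  proof (intro sum.cong refl)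
    fix i assume "i \<in> links"
    then have i: "Suc i < length xs" by (simp add: links_def)
    have "(\<exists>k\<le>j. xs ! i = xs ! k) \<longleftrightarrow> i \<le> j" "(\<exists>k\<le>j. xs ! Suc i = xs ! k) \<longleftrightarrow> Suc i \<le> j"
      using i j xs_eq by auto
    then have "sum ?g (edge i) = (if i \<le> j then ch i else 0) + (if Suc i \<le> j then ch (Suc i) else 0)"
      using i by (simp add: sum_phi_edge ch_def)
    then have "sum ?g (edge i) = (if i = j then ch j else 0)"
      using ch_Suc[OF i] by auto
    then show "(if edge i \<in> f then sum ?g (edge i) else 0)
      = (if i = j then (if edge j \<in> f then ch j else 0) else 0)" by auto
  qed
  also have "\<dots> = (if edge j \<in> f then ch j else 0)"
    using assms(4) finite_links by simp
  finally show ?thesis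
    using sum_split[OF assms(1-3), of ?g] partial_sum[of _ j] assms(2) nxt_subset j by simp
qed

lemma mat_sym:
  assumes "j \<in> links" "l \<in> links"
  shows "farmat j l = farmat l j"
proof (cases "close j l \<or> j = l")
  case False
  have l: "Suc j < length xs" "Suc l < length xs" using assms by (auto simp: links_def)
  have "is_dom (edge j)" "is_dom (edge l)" using nbr_xs l unfolding is_dom_def edge_def by blast+
  moreover have "edge j \<inter> edge l = {}"
    using False l xs_eq[of j l] xs_eq[of j "Suc l"] xs_eq[of "Suc j" l] xs_eq[of "Suc j" "Suc l"]
    by (auto simp: edge_def close_def)
  ultimately show ?thesis using phi_sym by (auto simp: farmat_def mat_def close_def)
qed (auto simp: farmat_def close_def)

text \<open>Between the positions \<open>l\<close> and \<open>j\<close> only one cell of the link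
  \<open>j\<close> is passed, and it is not in \<open>p\<close>.\<close>

lemma partial_close:
  assumes "edge j \<inter> p = {}" "close j l" "j \<in> links" "l \<in> links"
  shows "partial l p = partial j p"
  using assms unfolding close_def
  by (auto simp: partial_def edge_def)

lemma G_path:
  assumes "sum chi S = 0" and f: "f \<in> matchings" and p: "p \<subseteq> S" "\<Union>f \<inter> p = {}" "sum chi p = 0"
  shows "G p f = path_pot p - path_pot (nxt p f)"
proof -
  define q where "q = nxt p f"
  have q: "q \<subseteq> S" "sum chi q = 0" "\<Union>f \<inter> q = {}"
    unfolding q_def using nxt_subset chg_nxt f p assms(1) nxt_disj by auto
  let ?P = "\<lambda>l. partial l p" and ?Q = "\<lambda>l. partial l q" and ?C = "\<lambda>l. partial l S"
  \<comment> \<open>The first factor is \<open>ch j\<close> if the link is used and 0 otherwise, so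
    the formula can be summed over all links. For a used link the adjacent partial charges agree
    with the one at \<open>j\<close>, and their entries move into \<open>diag\<close>.\<close>
  have row: "(if edge j \<in> f then sum (phi (edge j)) p - sum (phi (edge j)) q else 0)
      = (?C j - ?P j - ?Q j) * ((\<Sum>l\<in>links. farmat j l * (?P l - ?Q l)) + diag j * (?P j - ?Q j))"
    if j: "j \<in> links" for j
  proof (cases "edge j \<in> f")
    case True
    then have c: "?C j - ?P j - ?Q j = ch j"
      using edge_indicator[OF f p(1,2) j] by (simp add: q_def)
    have d: "edge j \<inter> p = {}" "edge j \<inter> q = {}" using True p(2) q(3) by auto
    have "sum (phi (edge j)) p - sum (phi (edge j)) q
      = (\<Sum>l\<in>links. (?P l - ?Q l) * ch l * sum (phi (edge j)) (edge l))"
      unfolding sum_links[OF p(1,3)] sum_links[OF q(1,2)] sum_subtractf[symmetric]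
      by (rule sum.cong) (auto simp: algebra_simps)
    also have "\<dots> = (\<Sum>l\<in>links. ch j * (mat j l * (?P l - ?Q l)))"
      by (rule sum.cong) (auto simp: mat_def mult.assoc[symmetric])
    also have "\<dots> = (\<Sum>l\<in>links. ch j * (farmat j l * (?P l - ?Q l)
        + (if close j l then mat j l else 0) * (?P j - ?Q j)))"
    proof (rule sum.cong[OF refl])
      fix l assume "l \<in> links"
      then show "ch j * (mat j l * (?P l - ?Q l)) = ch j * (farmat j l * (?P l - ?Q l)
        + (if close j l then mat j l else 0) * (?P j - ?Q j))"
        using partial_close[OF d(1) _ j] partial_close[OF d(2) _ j] by (simp add: farmat_def)
    qed
    also have "\<dots> = ch j * ((\<Sum>l\<in>links. farmat j l * (?P l - ?Q l)) + diag j * (?P j - ?Q j))"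
      by (simp add: diag_def sum_distrib_left sum_distrib_right sum.distrib distrib_left)
    finally show ?thesis using True c by simp
  next
    case False
    then have "?C j - ?P j - ?Q j = 0"
      using edge_indicator[OF f p(1,2) j] by (simp add: q_def)
    then show ?thesis using False by simp
  qed
  have "G p f = (\<Sum>j\<in>links. (?C j - ?P j - ?Q j) * ((\<Sum>l\<in>links. farmat j l * (?P l - ?Q l)) + diag j * (?P j - ?Q j)))"
    unfolding G_def q_def[symmetric] sum_matching_edges[OF f] by (rule sum.cong[OF refl row])
  also have "\<dots> = (\<Sum>j\<in>links. \<Sum>l\<in>links. farmat j l * ((?C j - ?P j - ?Q j) * (?P l - ?Q l)))
      + (\<Sum>j\<in>links. diag j * ((?C j - ?P j - ?Q j) * (?P j - ?Q j)))"
    by (simp add: distrib_left sum.distrib sum_distrib_left mult.left_commute)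
  finally have G: "G p f = \<dots>" .
  have cross: "(\<Sum>j\<in>links. \<Sum>l\<in>links. farmat j l * (?P j * ?Q l)) = (\<Sum>j\<in>links. \<Sum>l\<in>links. farmat j l * (?Q j * ?P l))"
  proof -
    have "(\<Sum>j\<in>links. \<Sum>l\<in>links. farmat j l * (?P j * ?Q l)) = (\<Sum>l\<in>links. \<Sum>j\<in>links. farmat j l * (?P j * ?Q l))"
      by (rule sum.swap)
    also have "\<dots> = (\<Sum>l\<in>links. \<Sum>j\<in>links. farmat l j * (?Q l * ?P j))"
      by (intro sum.cong refl) (use mat_sym in auto)
    finally show ?thesis .
  qed
  have 1: "farmat j l * ((?C j - ?P j - ?Q j) * (?P l - ?Q l))
    = farmat j l * (?C j * ?P l - ?P j * ?P l) - farmat j l * (?C j * ?Q l - ?Q j * ?Q l)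
      + farmat j l * (?P j * ?Q l) - farmat j l * (?Q j * ?P l)" for j l by algebra
  have 2: "diag j * ((?C j - ?P j - ?Q j) * (?P j - ?Q j))
    = diag j * (?C j * ?P j - ?P j * ?P j) - diag j * (?C j * ?Q j - ?Q j * ?Q j)" for j by algebra
  show ?thesis unfolding G 1 2 sum.distrib sum_subtractf path_pot_def q_def[symmetric]
    using cross by (simp add: sum_subtractf)
qed

lemma Gs_path:
  assumes "sum chi S = 0" "p \<subseteq> S" "sum chi p = 0" "walk p fs q"
  shows "Gs p fs = path_pot p - path_pot q"
  using assms(2-4)
proof (induction fs arbitrary: p)
  case (Cons f fs)
  then show ?case using G_path[of f p] assms(1) chg_nxt[of f p] nxt_subset by simp
qed simp

end

context region
begin

text \<open>A transverse domino leaves only the other column to a plug avoiding it. A balanced plug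
  then has none or both of its cells, and the contributions of the two rows cancel.\<close>

lemma Gs_square:
  assumes S: "S = {(x, y), (x + 1, y), (x, y + 1), (x + 1, y + 1)}"
    and "p \<subseteq> S" "sum chi p = 0" "walk p fs q"
  shows "Gs p fs = 0"
  using assms(2-4)
proof (induction fs arbitrary: p)
  case (Cons f fs)
  have chS: "sum chi S = 0" by (simp add: S)
  have f: "f \<in> matchings" "\<Union>f \<inter> p = {}" using Cons.prems by auto
  have pair: "X = {} \<or> X = {a, b}" if X: "X \<subseteq> {a, b}" "chi a = - chi b" "sum chi X = 0" for X a b
  proof -
    have "X = {} \<or> X = {a} \<or> X = {b} \<or> X = {a, b}" using X(1) by blast
    then show ?thesis using X(3) by auto
  qed
  have z: "sum (phi h) X = 0" if "h \<in> f" "X \<subseteq> S" "sum chi X = 0" "\<Union>f \<inter> X = {}" for h X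
  proof -
    have h: "is_dom h" "h \<subseteq> S" "X \<subseteq> S - h" using that f(1) by (auto simp: matchings_def)
    from h(1) show ?thesis
    proof (cases rule: is_dom_cases)
      case (hor a b)
      then show ?thesis by (simp add: phi_horizontal)
    next
      case (ver a b)
      then have "b = y" "a = x \<or> a = x + 1" using h(2) by (auto simp: S)
      then have "X \<subseteq> {(x + 1, y), (x + 1, y + 1)} \<and> a = x \<or> X \<subseteq> {(x, y), (x, y + 1)} \<and> a = x + 1"
        using h(3) ver by (auto simp: S)
      then have "(X = {} \<or> X = {(x + 1, y), (x + 1, y + 1)}) \<and> a = x \<or> (X = {} \<or> X = {(x, y), (x, y + 1)}) \<and> a = x + 1"
        using pair that(3) by (metis chi_up minus_minus)
      then show ?thesis using \<open>b = y\<close> by (auto simp: ver phi_vertical rk_def)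
    qed
  qed
  have n: "sum chi (nxt p f) = 0" using chg_nxt f Cons.prems chS by simp
  have "G p f = 0" unfolding G_def
    using z[OF _ Cons.prems(1,2) f(2)] z[OF _ nxt_subset n nxt_disj] by simp
  then show ?case using Cons n nxt_subset by simp
qed simp

end


section \<open>Regions without branching\<close>

lemma nbr_iff: "nbr (x, y) n \<longleftrightarrow> n \<in> {(x - 1, y), (x + 1, y), (x, y - 1), (x, y + 1)}"
  by (cases n) (auto simp: nbr_def abs_if split: if_splits)

text \<open>Connectedness of the complement under adjacency, phrased with sets \<open>Q\<close> so
  that the parity of crossings can serve directly as a test set.\<close>

definition co_connected :: "cell set \<Rightarrow> bool" where
  "co_connected S \<longleftrightarrow> (\<forall>Q. (\<forall>a b. a \<notin> S \<longrightarrow> b \<notin> S \<longrightarrow> nbr a b \<longrightarrow> (a \<in> Q \<longleftrightarrow> b \<in> Q)) \<longrightarrow>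
    (\<forall>a b. a \<notin> S \<longrightarrow> b \<notin> S \<longrightarrow> (a \<in> Q \<longleftrightarrow> b \<in> Q)))"

definition ind :: "cell set \<Rightarrow> int \<Rightarrow> int \<Rightarrow> int" where
  "ind S x y = of_bool ((x, y) \<in> S)"

text \<open>An upward ray along the grid line between the columns \<open>x - 1\<close> and
  \<open>x\<close> meets the adjacencies between these columns; those in rows above \<open>y\<close>
  are counted.\<close>

definition crossings :: "cell set \<Rightarrow> int \<Rightarrow> int \<Rightarrow> int" where
  "crossings S x y = (\<Sum>y'\<in>snd ` S. of_bool (y < y') * (ind S (x - 1) y' * ind S x y'))"

lemma crossings_up:
  assumes "(x, y + 1) \<notin> S"
  shows "crossings S x (y + 1) = crossings S x y"
  unfolding crossings_def
proof (rule sum.cong[OF refl])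
  fix y' show "of_bool (y + 1 < y') * (ind S (x - 1) y' * ind S x y') = of_bool (y < y') * (ind S (x - 1) y' * ind S x y')"
    using assms by (cases "y' = y + 1") (auto simp: ind_def)
qed

text \<open>Each cell of column \<open>x\<close> above \<open>y\<close> has two neighbours, so its
  horizontal ones number 2 minus its vertical ones, and every vertical adjacency is counted from
  both ends. As \<open>(x, y)\<close> is not in \<open>S\<close>, none is cut at the start of the
  ray.\<close>

lemma crossings_right:
  assumes fin: "finite S" and notin: "(x, y) \<notin> S"
    and deg: "\<And>x y. (x, y) \<in> S \<Longrightarrow> ind S (x - 1) y + ind S (x + 1) y + ind S x (y - 1) + ind S x (y + 1) = 2"
  shows "even (crossings S x y + crossings S (x + 1) y)"
proof -
  let ?Y = "snd ` S"
  have finY: "finite ?Y" using fin by simp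
  have "crossings S x y + crossings S (x + 1) y
    = (\<Sum>y'\<in>?Y. of_bool (y < y') * (ind S x y' * (ind S (x - 1) y' + ind S (x + 1) y')))"
    unfolding crossings_def sum.distrib[symmetric] by (rule sum.cong) (auto simp: algebra_simps)
  also have "\<dots> = (\<Sum>y'\<in>?Y. of_bool (y < y') * (ind S x y' * (2 - ind S x (y' - 1) - ind S x (y' + 1))))"
  proof (rule sum.cong[OF refl])
    fix y'
    show "of_bool (y < y') * (ind S x y' * (ind S (x - 1) y' + ind S (x + 1) y'))
      = of_bool (y < y') * (ind S x y' * (2 - ind S x (y' - 1) - ind S x (y' + 1)))"
    proof (cases "(x, y') \<in> S")
      case True
      then have "ind S (x - 1) y' + ind S (x + 1) y' = 2 - ind S x (y' - 1) - ind S x (y' + 1)"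
        using deg[OF True] by simp
      then show ?thesis by simp
    qed (simp add: ind_def)
  qed
  also have "\<dots> = 2 * (\<Sum>y'\<in>?Y. of_bool (y < y') * ind S x y')
      - (\<Sum>y'\<in>?Y. of_bool (y < y') * (ind S x y' * ind S x (y' - 1)))
      - (\<Sum>y'\<in>?Y. of_bool (y < y') * (ind S x y' * ind S x (y' + 1)))"
    by (simp add: sum_distrib_left sum_subtractf[symmetric] algebra_simps)
  also have "(\<Sum>y'\<in>?Y. of_bool (y < y') * (ind S x y' * ind S x (y' - 1)))
      = (\<Sum>y'\<in>{y'\<in>?Y. y < y' \<and> (x, y') \<in> S \<and> (x, y' - 1) \<in> S}. 1)"
    using finY by (intro sum.mono_neutral_cong_right) (auto simp: ind_def)
  also have "\<dots> = (\<Sum>y'\<in>{y'\<in>?Y. y < y' \<and> (x, y') \<in> S \<and> (x, y' + 1) \<in> S}. 1)"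
  proof (rule sum.reindex_bij_witness[of _ "\<lambda>z. z + 1" "\<lambda>z. z - 1"])
    fix a assume a: "a \<in> {y' \<in> ?Y. y < y' \<and> (x, y') \<in> S \<and> (x, y' - 1) \<in> S}"
    then have "a - 1 \<noteq> y" using notin by auto
    then show "a - 1 \<in> {y' \<in> ?Y. y < y' \<and> (x, y') \<in> S \<and> (x, y' + 1) \<in> S}"
      using a by (force simp: image_iff)
  qed (force simp: image_iff)+
  also have "\<dots> = (\<Sum>y'\<in>?Y. of_bool (y < y') * (ind S x y' * ind S x (y' + 1)))"
    using finY by (intro sum.mono_neutral_cong_left) (auto simp: ind_def)
  finally show ?thesis by simp
qed

text \<open>A ring of cells encloses a cell outside it, unless it is a square of four cells: the parity
  of the crossings with an upward ray is locally constant on the complement.\<close>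

lemma ring_is_square:
  assumes fin: "finite S" and ne: "S \<noteq> {}"
    and deg: "\<And>x y. (x, y) \<in> S \<Longrightarrow> ind S (x - 1) y + ind S (x + 1) y + ind S x (y - 1) + ind S x (y + 1) = 2"
    and conn: "\<And>a b. a \<in> S \<Longrightarrow> b \<in> S \<Longrightarrow> (\<lambda>a b. a \<in> S \<and> b \<in> S \<and> nbr a b)\<^sup>*\<^sup>* a b"
    and comp: "co_connected S"
  shows "\<exists>x y. S = {(x, y), (x + 1, y), (x, y + 1), (x + 1, y + 1)}"
proof -
  define Q where "Q = {a. even (crossings S (fst a) (snd a))}"
  have step: "a \<in> Q \<longleftrightarrow> b \<in> Q" if "a \<notin> S" "b \<notin> S" "nbr a b" for a b
    using that(3)
  proof (cases rule: nbr_cases)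
    case (hor x y)
    have "(x, y) \<in> {a, b}" unfolding hor by simp
    then have "(x, y) \<notin> S" using that(1,2) by auto
    then have "(x, y) \<in> Q \<longleftrightarrow> (x + 1, y) \<in> Q"
      using crossings_right[OF fin _ deg, of x y] by (auto simp: Q_def)
    then show ?thesis using hor by (metis doubleton_eq_iff)
  next
    case (ver x y)
    have "(x, y + 1) \<in> {a, b}" unfolding ver by simp
    then have "(x, y + 1) \<notin> S" using that(1,2) by auto
    then have "(x, y) \<in> Q \<longleftrightarrow> (x, y + 1) \<in> Q"
      using crossings_up[of x y S] by (auto simp: Q_def)
    then show ?thesis using ver by (metis doubleton_eq_iff)
  qed
  \<comment> \<open>The leftmost cell of the top row is a corner: its neighbours above and to the
    left are missing.\<close>
  define y where "y = Max (snd ` S)"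
  have ymax: "y' \<le> y" if "(x', y') \<in> S" for x' y'
    unfolding y_def using fin that by (intro Max_ge) force+
  define X where "X = {x. (x, y) \<in> S}"
  have "y \<in> snd ` S" unfolding y_def using fin ne by (intro Max_in) auto
  then have "X \<noteq> {}" by (auto simp: X_def)
  moreover have "X \<subseteq> fst ` S" by (force simp: X_def)
  ultimately have X: "finite X" "X \<noteq> {}" using fin by (auto intro: finite_subset)
  define x where "x = Min X"
  have s: "(x, y) \<in> S" using Min_in[OF X] by (simp add: x_def X_def)
  have xmin: "x \<le> x'" if "(x', y) \<in> S" for x'
    unfolding x_def using X that by (intro Min_le) (auto simp: X_def)
  have out: "(x, y + 1) \<notin> S" "(x - 1, y) \<notin> S" using ymax[of x "y + 1"] xmin[of "x - 1"] by auto
  then have n: "(x + 1, y) \<in> S" "(x, y - 1) \<in> S"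
    using deg[OF s] by (auto simp: ind_def of_bool_def split: if_splits)
  \<comment> \<open>If the cell diagonally inside the corner were missing, the ray from it would
    cross just one adjacency, that of the top row, whereas the ray from the cell above the corner
    crosses none.\<close>
  have z: "(x + 1, y - 1) \<in> S"
  proof (rule ccontr)
    assume z: "(x + 1, y - 1) \<notin> S"
    have w: "(x, y + 1) \<in> Q"
    proof -
      have "crossings S x (y + 1) = 0" unfolding crossings_def
        by (rule sum.neutral) (use ymax in \<open>force simp: ind_def\<close>)
      then show ?thesis by (simp add: Q_def)
    qed
    have "\<forall>a b. a \<notin> S \<longrightarrow> b \<notin> S \<longrightarrow> nbr a b \<longrightarrow> (a \<in> Q \<longleftrightarrow> b \<in> Q)"
      by (intro allI impI step)
    then have "\<forall>a b. a \<notin> S \<longrightarrow> b \<notin> S \<longrightarrow> (a \<in> Q \<longleftrightarrow> b \<in> Q)"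
      by (rule comp[unfolded co_connected_def, THEN spec, THEN mp])
    from this[THEN spec, THEN spec, THEN mp, THEN mp, OF out(1) z]
    have "(x + 1, y - 1) \<in> Q" using w by (rule iffD1)
    moreover have "crossings S (x + 1) (y - 1) = (\<Sum>y'\<in>snd ` S. if y' = y then 1 else 0)"
      unfolding crossings_def
    proof (rule sum.cong[OF refl])
      fix y' assume "y' \<in> snd ` S"
      then have "y' \<le> y" using ymax by force
      then show "of_bool (y - 1 < y') * (ind S (x + 1 - 1) y' * ind S (x + 1) y') = (if y' = y then 1 else 0)"
        using s n by (auto simp: ind_def)
    qed
    moreover have "y \<in> snd ` S" using s by force
    ultimately show False using fin by (simp add: Q_def)
  qed
  \<comment> \<open>Each of the four cells already has its two neighbours in the block, so
    connectedness leaves no other cell.\<close>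
  let ?B = "{(x, y - 1), (x + 1, y - 1), (x, y), (x + 1, y)}"
  have closed: "b \<in> ?B" if "a \<in> ?B" "b \<in> S" "nbr a b" for a b
  proof -
    obtain u v where b: "b = (u, v)" by (cases b)
    have e: "of_bool P + of_bool Q = (0::int) \<longleftrightarrow> \<not> P \<and> \<not> Q" for P Q by auto
    have "(x - 1, y - 1) \<notin> S \<and> (x, y - 2) \<notin> S" "(2 + x, y - 1) \<notin> S \<and> (x + 1, y - 2) \<notin> S"
      "(2 + x, y) \<notin> S \<and> (x + 1, y + 1) \<notin> S"
      using deg[OF n(2)] deg[OF z] deg[OF n(1)] s n z by (simp_all add: ind_def e)
    then have no: "(u, v) \<noteq> (x - 1, y - 1)" "(u, v) \<noteq> (x, y - 2)" "(u, v) \<noteq> (2 + x, y - 1)"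
      "(u, v) \<noteq> (x + 1, y - 2)" "(u, v) \<noteq> (x - 1, y)" "(u, v) \<noteq> (x, y + 1)"
      "(u, v) \<noteq> (2 + x, y)" "(u, v) \<noteq> (x + 1, y + 1)"
      using that(2) out unfolding b by metis+
    from that(1) consider "a = (x, y - 1)" | "a = (x + 1, y - 1)" | "a = (x, y)" | "a = (x + 1, y)" by blast
    then show ?thesis using that(3) no unfolding b
      by cases (simp_all add: nbr_iff, linarith+)
  qed
  have "b \<in> ?B" if b: "b \<in> S" for b
    using conn[OF s b]
  proof (induction rule: rtranclp_induct)
    case (step a b)
    then show ?case using closed by blast
  qed simp
  then have "S = ?B" using s n z by blast
  then show ?thesis by (intro exI[of _ x] exI[of _ "y - 1"]) simp
qed

section \<open>Hamiltonian paths when no cell has three neighbours\<close>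

context connected_region
begin

definition simple_path :: "cell list \<Rightarrow> bool" where
  "simple_path xs \<longleftrightarrow> distinct xs \<and> set xs \<subseteq> S \<and> (\<forall>i. Suc i < length xs \<longrightarrow> nbr (xs ! i) (xs ! Suc i))"

definition branching :: bool where
  "branching \<longleftrightarrow> (\<exists>c\<in>S. \<exists>n1\<in>S. \<exists>n2\<in>S. \<exists>n3\<in>S. nbr c n1 \<and> nbr c n2 \<and> nbr c n3 \<and>
    n1 \<noteq> n2 \<and> n1 \<noteq> n3 \<and> n2 \<noteq> n3)"

lemma not_branchingD:
  assumes "\<not> branching" "{c, n1, n2, n3} \<subseteq> S" "nbr c n1" "nbr c n2" "nbr c n3"
  shows "n1 = n2 \<or> n1 = n3 \<or> n2 = n3"
  using assms unfolding branching_def by (meson insert_subset)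

text \<open>A longest simple path visits every cell. Otherwise some path cell has a neighbour off
  the path: at an end it would extend the path, and in the interior it would be a third
  neighbour.\<close>

lemma hamiltonian_path:
  assumes ne: "S \<noteq> {}"
    and nobr: "\<not> branching"
  obtains xs where "simple_path xs" "set xs = S"
proof -
  note no3 = not_branchingD[OF nobr]
  have bound: "length xs < Suc (card S)" if "simple_path xs" for xs
    using that finite_S card_mono[of S "set xs"] distinct_card[of xs] by (auto simp: simple_path_def)
  obtain a where "a \<in> S" using ne by auto
  then have a: "simple_path [a]" by (simp add: simple_path_def)
  obtain xs where xs: "simple_path xs" and max: "\<And>ys. simple_path ys \<Longrightarrow> length ys \<le> length xs"
    using ex_has_greatest_nat[of simple_path "[a]" length "Suc (card S)"] a bound by (metis less_imp_le_nat)
  have "length xs \<ge> 1" using max[OF a] by simp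
  then have nexs: "xs \<noteq> []" by auto
  have "set xs = S"
  proof (rule ccontr)
    assume "set xs \<noteq> S"
    then obtain b where b: "b \<in> S" "b \<notin> set xs" using xs by (auto simp: simple_path_def)
    have "hd xs \<in> S" using xs nexs by (auto simp: simple_path_def)
    then have "adj\<^sup>*\<^sup>* (hd xs) b" using b connected by blast
    then have "b \<in> set xs \<or> (\<exists>c d. c \<in> set xs \<and> d \<in> S - set xs \<and> nbr c d)"
      by (induction rule: rtranclp_induct) (use nexs in \<open>auto simp: adj_def\<close>)
    then obtain c d where cd: "c \<in> set xs" "d \<in> S - set xs" "nbr c d" using b by blast
    obtain i where i: "i < length xs" "c = xs ! i" using cd(1) by (auto simp: in_set_conv_nth)
    have "simple_path (d # xs)" if "i = 0"
      unfolding simple_path_def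
    proof (intro conjI allI impI)
      fix j assume "Suc j < length (d # xs)"
      then show "nbr ((d # xs) ! j) ((d # xs) ! Suc j)"
        using xs cd i that nbr_sym by (cases j) (auto simp: simple_path_def)
    qed (use xs cd in \<open>auto simp: simple_path_def\<close>)
    then have i0: "i \<noteq> 0" using max by fastforce
    have "simple_path (xs @ [d])" if "Suc i = length xs"
      unfolding simple_path_def
    proof (intro conjI allI impI)
      fix j assume "Suc j < length (xs @ [d])"
      then show "nbr ((xs @ [d]) ! j) ((xs @ [d]) ! Suc j)"
        using xs cd i that by (cases "j = i") (auto simp: simple_path_def nth_append)
    qed (use xs cd in \<open>auto simp: simple_path_def\<close>)
    then have i1: "Suc i \<noteq> length xs" using max by fastforce
    obtain k where k: "i = Suc k" using i0 not0_implies_Suc by blast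
    have l: "k < length xs" "i < length xs" "Suc i < length xs" using k i i1 by auto
    have d: "xs ! m \<noteq> d" if "m < length xs" for m using cd(2) that nth_mem by auto
    have n: "nbr (xs ! i) (xs ! k)" "nbr (xs ! i) (xs ! Suc i)" "nbr (xs ! i) d"
      using xs l k nbr_sym[of "xs ! k"] cd(3) i(2) by (simp_all add: simple_path_def)
    have "xs ! k \<noteq> xs ! Suc i"
      using xs l k by (simp add: simple_path_def nth_eq_iff_index_eq)
    moreover have "xs ! m \<in> S" if "m < length xs" for m using xs that by (auto simp: simple_path_def)
    then have "{xs ! i, xs ! k, xs ! Suc i, d} \<subseteq> S" using l cd(2) by simp
    ultimately show False using no3[OF _ n] d[OF l(1)] d[OF l(3)] by blast
  qed
  then show thesis using that xs by blast
qed

text \<open>An interior cell of a Hamiltonian path has its two neighbours on the path, so only the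
  two ends can be joined by a further adjacency. Without it the region is a path; with it a ring,
  hence a square of four cells.\<close>

lemma no_branching_Gs:
  assumes ne: "S \<noteq> {}"
    and nobr: "\<not> branching"
    and comp: "co_connected S"
    and w: "walk {} fs {}"
  shows "Gs {} fs = 0"
proof -
  note no3 = not_branchingD[OF nobr]
  obtain xs where xs: "simple_path xs" "set xs = S" using hamiltonian_path[OF ne nobr] by metis
  let ?n = "length xs"
  have nb: "nbr (xs ! i) (xs ! Suc i)" if "Suc i < ?n" for i using xs that by (auto simp: simple_path_def)
  have dist: "xs ! i = xs ! j \<longleftrightarrow> i = j" if "i < ?n" "j < ?n" for i j
    using xs that by (auto simp: simple_path_def nth_eq_iff_index_eq)
  have inS: "xs ! i \<in> S" if "i < ?n" for i using xs that by auto
  have ends: "i = 0 \<and> Suc j = ?n" if ij: "i < j" "j < ?n" "nbr (xs ! i) (xs ! j)" "j \<noteq> Suc i" for i j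
  proof (intro conjI)
    show "i = 0"
    proof (rule ccontr)
      assume "i \<noteq> 0"
      then have "nbr (xs ! i) (xs ! (i - 1))" "nbr (xs ! i) (xs ! Suc i)"
        using nb[of "i - 1"] nb[of i] ij nbr_sym by auto
      then show False
        using no3[of "xs ! i" "xs ! (i - 1)" "xs ! Suc i" "xs ! j"] ij inS dist \<open>i \<noteq> 0\<close> by auto
    qed
    show "Suc j = ?n"
    proof (rule ccontr)
      assume "Suc j \<noteq> ?n"
      then have "nbr (xs ! j) (xs ! (j - 1))" "nbr (xs ! j) (xs ! Suc j)" "nbr (xs ! j) (xs ! i)"
        using nb[of "j - 1"] nb[of j] ij nbr_sym by auto
      moreover have "xs ! (j - 1) \<noteq> xs ! Suc j" "xs ! (j - 1) \<noteq> xs ! i" "xs ! Suc j \<noteq> xs ! i"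
        using dist ij \<open>Suc j \<noteq> ?n\<close> by auto
      ultimately show False
        using no3[of "xs ! j" "xs ! (j - 1)" "xs ! Suc j" "xs ! i"] ij inS \<open>Suc j \<noteq> ?n\<close> by auto
    qed
  qed
  show ?thesis
  \<comment> \<open>For two cells the ends are adjacent too, but this adjacency is the link of the
    path itself.\<close>
  proof (cases "?n > 2 \<and> nbr (xs ! 0) (xs ! (?n - 1))")
    case False
    interpret path_region S xs
    proof
      fix h assume h: "is_dom h" "h \<subseteq> S"
      then obtain a b where ab: "h = {a, b}" "nbr a b" by (auto simp: is_dom_def simp del: split_paired_Ex)
      obtain i j where ij: "i < ?n" "a = xs ! i" "j < ?n" "b = xs ! j"
        using h ab xs(2) by (metis in_set_conv_nth insert_subset)
      have "i \<noteq> j" using nbr_neq[OF ab(2)] ij by auto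
      have "j = Suc i \<or> i = Suc j"
      proof (rule ccontr)
        assume "\<not> (j = Suc i \<or> i = Suc j)"
        then have "i = 0 \<and> Suc j = ?n \<and> i < j \<or> j = 0 \<and> Suc i = ?n \<and> j < i"
          using ends[of i j] ends[of j i] ij ab nbr_sym \<open>i \<noteq> j\<close> by (metis linorder_neqE_nat)
        moreover have "?n > 2" using calculation \<open>\<not> (j = Suc i \<or> i = Suc j)\<close> by auto
        ultimately show False using False ij ab nbr_sym by (metis diff_Suc_1)
      qed
      then show "\<exists>i. Suc i < ?n \<and> h = {xs ! i, xs ! Suc i}"
        using ij ab by (auto simp: insert_commute)
    qed (use xs nb in \<open>auto simp: simple_path_def\<close>)
    show ?thesis using Gs_path[of "{}" fs "{}"] charge_S w by simp
  next
    case True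
    have two: "\<exists>b c. b \<in> S \<and> c \<in> S \<and> b \<noteq> c \<and> nbr a b \<and> nbr a c" if "a \<in> S" for a
    proof -
      have "a \<in> set xs" using that xs(2) by simp
      then obtain i where i: "i < ?n" "a = xs ! i" unfolding in_set_conv_nth by blast
      define b where "b = (if i = 0 then ?n - 1 else i - 1)"
      define c where "c = (if Suc i = ?n then 0 else Suc i)"
      have "nbr a (xs ! b)" "nbr a (xs ! c)" "b < ?n" "c < ?n" "b \<noteq> c"
        using True i nb[of i] nb[of "i - 1"] nbr_sym[of "xs ! (i - 1)" "xs ! i"]
          nbr_sym[of "xs ! 0" "xs ! (?n - 1)"] by (auto simp: b_def c_def dest: sym)
      then show ?thesis using inS dist by (intro exI[of _ "xs ! b"] exI[of _ "xs ! c"]) simp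
    qed
    have deg: "ind S (x - 1) y + ind S (x + 1) y + ind S x (y - 1) + ind S x (y + 1) = 2"
      if xy: "(x, y) \<in> S" for x y
    proof -
      let ?N = "{(x - 1, y), (x + 1, y), (x, y - 1), (x, y + 1)}"
      note N = nbr_iff[of x y]
      have "ind S (x - 1) y + ind S (x + 1) y + ind S x (y - 1) + ind S x (y + 1)
        = (\<Sum>a\<in>?N. if a \<in> S then 1 else 0)" by (simp add: ind_def)
      also have "\<dots> = int (card (?N \<inter> S))" by (simp add: sum.If_cases del: sum.insert)
      finally have e: "ind S (x - 1) y + ind S (x + 1) y + ind S x (y - 1) + ind S x (y + 1) = int (card (?N \<inter> S))" .
      obtain b c where bc: "b \<in> S" "c \<in> S" "b \<noteq> c" "nbr (x, y) b" "nbr (x, y) c"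
        using two[OF xy] by (elim exE conjE)
      have "n = b \<or> n = c" if "n \<in> ?N \<inter> S" for n
      proof -
        have n: "nbr (x, y) n" "n \<in> S" using that N by simp_all
        have "{(x, y), b, c, n} \<subseteq> S" using bc(1,2) n(2) xy by simp
        from no3[OF this bc(4,5) n(1)] show ?thesis using bc(3) by auto
      qed
      moreover have "b \<in> ?N \<inter> S" "c \<in> ?N \<inter> S" using bc N by simp_all
      ultimately have "?N \<inter> S = {b, c}" by (intro equalityI subsetI) auto
      then show ?thesis using e bc by simp
    qed
    have "\<exists>x y. S = {(x, y), (x + 1, y), (x, y + 1), (x + 1, y + 1)}"
      by (rule ring_is_square[OF finite_S ne deg connected[unfolded adj_def] comp])
    then obtain x y where "S = {(x, y), (x + 1, y), (x, y + 1), (x + 1, y + 1)}"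
      by (elim exE)
    then show ?thesis using Gs_square[of x y "{}" fs "{}"] w by simp
  qed
qed

end


section \<open>Maximal growth rate and interior twist values\<close>

context region
begin

lemma plug_take_walk:
  assumes "walk p fs q" "i \<le> j" "j \<le> length fs"
  shows "walk (plug p (take i fs)) (take (j - i) (drop i fs)) (plug p (take j fs))"
proof -
  have j: "take j fs = take i fs @ take (j - i) (drop i fs)"
    using assms(2,3) by (metis le_add_diff_inverse take_add)
  have fs: "fs = take j fs @ drop j fs" by simp
  have "walk p (take j fs) (plug p (take j fs))" using assms(1) fs walk_append by metis
  then show ?thesis unfolding j walk_append using walk_plug by auto
qed

definition loops :: "(cell set \<times> cell set set list) set" where
  "loops = {(p, fs). p \<subseteq> S \<and> sum chi p = 0 \<and> walk p fs p \<and> fs \<noteq> []}"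

text \<open>With more floors than possible plugs, some plug recurs, and the stretch between two
  occurrences can be cut out as a loop of its own.\<close>

lemma loop_split:
  assumes S0: "sum chi S = 0" and l: "(p, fs) \<in> loops" and long: "card (Pow S) < length fs"
  obtains q as bs where "(p, as) \<in> loops" "(q, bs) \<in> loops" "length fs = length as + length bs"
    "Gs p fs = Gs p as + Gs q bs"
proof -
  have p: "p \<subseteq> S" "sum chi p = 0" "walk p fs p" using l by (auto simp: loops_def)
  let ?P = "\<lambda>k. plug p (take k fs)"
  have "?P ` {..<length fs} \<subseteq> Pow S" using plug_subset[OF p(1)] by auto
  then have "\<not> inj_on ?P {..<length fs}"
    using card_inj_on_le[of ?P "{..<length fs}" "Pow S"] finite_S long by auto
  then obtain i j where ij: "i < j" "j < length fs" "?P i = ?P j"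
    unfolding inj_on_def by (metis lessThan_iff linorder_neqE_nat)
  let ?q = "?P i" and ?bs = "take (j - i) (drop i fs)" and ?as = "take i fs @ drop j fs"
  have fs: "fs = take i fs @ ?bs @ drop j fs"
    using ij by (metis append.assoc append_take_drop_id le_add_diff_inverse less_imp_le take_add)
  have w1: "walk p (take i fs) ?q" using plug_take_walk[OF p(3), of 0 i] ij by simp
  have w2: "walk ?q ?bs ?q" using plug_take_walk[OF p(3), of i j] ij by simp
  have w3: "walk ?q (drop j fs) p" using plug_take_walk[OF p(3), of j "length fs"] ij walk_plug[OF p(3)] by simp
  have "(p, ?as) \<in> loops"
    using p w1 w3 ij by (auto simp: loops_def intro: walk_appendI)
  moreover have "(?q, ?bs) \<in> loops"
    using walk_balanced[OF S0 p(1,2) w1] w2 ij by (auto simp: loops_def)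
  moreover have "length fs = length ?as + length ?bs" using ij by auto
  moreover have "Gs p fs = Gs p ?as + Gs ?q ?bs"
    using walk_plug[OF w2] by (subst fs) (simp add: Gs_append)
  ultimately show thesis by (rule that)
qed

text \<open>Only finitely many loops are short, and a longer one splits into two for which the
  inequality holds by induction and adds up. Cross-multiplied, the comparison of means stays in the
  integers.\<close>

lemma max_mean_loop:
  assumes S0: "sum chi S = 0"
  obtains q cs where "(q, cs) \<in> loops"
    "\<And>p fs. (p, fs) \<in> loops \<Longrightarrow> Gs p fs * int (length cs) \<le> Gs q cs * int (length fs)"
proof -
  define short where "short = {x \<in> loops. length (snd x) \<le> Suc (card (Pow S))}"
  have "short \<subseteq> Pow S \<times> {fs. set fs \<subseteq> matchings \<and> length fs \<le> Suc (card (Pow S))}"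
    unfolding short_def loops_def using walk_matchings by auto
  then have fin: "finite short"
    by (rule finite_subset) (simp add: finite_S finite_matchings finite_lists_length_le)
  have "card (Pow S) \<ge> 1" using finite_S by (simp add: card_Pow)
  then have "({}, [{}, {}]) \<in> short"
    by (auto simp: short_def loops_def nxt_def)
  then have ne: "short \<noteq> {}" by auto
  define m where "m = (\<lambda>x. real_of_int (Gs (fst x) (snd x)) / real (length (snd x)))"
  have "Max (m ` short) \<in> m ` short" using fin ne by (intro Max_in) auto
  then obtain x where x0: "x \<in> short" "Max (m ` short) = m x" by (rule imageE)
  have "m y \<le> m x" if "y \<in> short" for y
    unfolding x0(2)[symmetric] using fin that by (intro Max_ge) auto
  note x = x0(1) this
  obtain q cs where qc: "x = (q, cs)" by (cases x)
  have cs: "length cs > 0" using x(1) qc by (auto simp: short_def loops_def)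
  have "Gs p fs * int (length cs) \<le> Gs q cs * int (length fs)" if "(p, fs) \<in> loops" for p fs
    using that
  proof (induction "length fs" arbitrary: p fs rule: less_induct)
    case less
    show ?case
    proof (cases "length fs \<le> Suc (card (Pow S))")
      case True
      then have "m (p, fs) \<le> m x" using less x by (auto simp: short_def)
      moreover have "length fs > 0" using less by (auto simp: loops_def)
      ultimately have "real_of_int (Gs p fs) * real (length cs) \<le> real_of_int (Gs q cs) * real (length fs)"
        using cs by (simp add: m_def qc field_simps)
      then have "real_of_int (Gs p fs * int (length cs)) \<le> real_of_int (Gs q cs * int (length fs))" by simp
      then show ?thesis by (simp only: of_int_le_iff)
    next
      case False
      then have "card (Pow S) < length fs" by simp
      from loop_split[OF S0 less.prems this] obtain r as bs where s: "(p, as) \<in> loops" "(r, bs) \<in> loops" "length fs = length as + length bs"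
        "Gs p fs = Gs p as + Gs r bs"
        by metis
      have "length as < length fs" "length bs < length fs" using s by (auto simp: loops_def)
      then have "Gs p as * int (length cs) \<le> Gs q cs * int (length as)"
        "Gs r bs * int (length cs) \<le> Gs q cs * int (length bs)" using less.hyps s by auto
      then show ?thesis unfolding s(3,4) by (simp add: algebra_simps)
    qed
  qed
  moreover have "(q, cs) \<in> loops" using x(1) qc by (auto simp: short_def)
  ultimately show thesis using that by blast
qed

section \<open>Values of closed walks of prescribed length at the empty plug\<close>

definition achieves :: "nat \<Rightarrow> int \<Rightarrow> bool" where
  "achieves n w \<longleftrightarrow> (\<exists>fs. length fs = n \<and> walk {} fs {} \<and> Gs {} fs = w)"

lemma achieves_add: "achieves m v \<Longrightarrow> achieves n w \<Longrightarrow> achieves (m + n) (v + w)"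
  unfolding achieves_def
proof (elim exE conjE)
  fix xs ys assume "length xs = m" "walk {} xs {}" "Gs {} xs = v" "length ys = n" "walk {} ys {}" "Gs {} ys = w"
  then show "\<exists>fs. length fs = m + n \<and> walk {} fs {} \<and> Gs {} fs = v + w"
    using walk_plug[of "{}" xs "{}"] by (intro exI[of _ "xs @ ys"]) (simp add: walk_append Gs_append)
qed

lemma achieves_minus: "achieves n w \<Longrightarrow> achieves n (- w)"
  unfolding achieves_def using walk_rev[of "{}" _ "{}"] by (metis empty_subsetI length_rev)

lemma achieves_even: "even n \<Longrightarrow> achieves n 0"
proof (elim evenE)
  fix k assume n: "n = 2 * k"
  have "walk {} (replicate (2 * k) {}) {} \<and> Gs {} (replicate (2 * k) {}) = 0"
    by (induction k) (auto simp: nxt_def)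
  then show "achieves n 0" unfolding achieves_def n by (intro exI[of _ "replicate (2 * k) {}"]) simp
qed

lemma achieves_mult: "achieves n w \<Longrightarrow> achieves (n * k) (w * int k)"
proof (induction k)
  case 0
  then show ?case using achieves_even[of 0] by simp
next
  case (Suc k)
  then have "achieves (n + n * k) (w + w * int k)" by (intro achieves_add) auto
  then show ?case by (simp add: distrib_left)
qed

end

context connected_region
begin

lemma mod4: "achieves n w \<Longrightarrow> 4 dvd w"
  using Gs_mod4[OF charge_S, of "{}" _ "{}"] by (auto simp: achieves_def)

text \<open>Walk to the plug \<open>q\<close>, repeat the loop, and return along the reversed walk:
  the two connecting walks have opposite contributions and together an even length.\<close>

lemma loop_conjugate:
  assumes "(q, cs) \<in> loops"
  obtains a where "\<And>m. achieves (a + length cs * m) (Gs q cs * int m)" "even a"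
proof -
  have q: "q \<subseteq> S" "sum chi q = 0" "walk q cs q" using assms by (auto simp: loops_def)
  obtain v where "reach {} q v" by (rule reach_balanced[of "{}" q]) (use q in auto)
  then obtain fs where fs: "walk {} fs q" by (auto simp: reach_def)
  have rev: "walk q (rev fs) {}" "Gs q (rev fs) = - Gs {} fs" using walk_rev[OF _ fs] by auto
  have pow: "walk q (concat (replicate m cs)) q \<and> Gs q (concat (replicate m cs)) = Gs q cs * int m" for m
    by (induction m) (use q(3) walk_plug[OF q(3)] in \<open>auto simp: walk_append Gs_append algebra_simps\<close>)
  have "achieves (2 * length fs + length cs * m) (Gs q cs * int m)" for m
    unfolding achieves_def
  proof (intro exI conjI)
    let ?l = "concat (replicate m cs)"
    show "length (fs @ ?l @ rev fs) = 2 * length fs + length cs * m"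
      by (simp add: length_concat sum_list_replicate)
    show "walk {} (fs @ ?l @ rev fs) {}" using fs rev pow by (intro walk_appendI[of _ _ q]) auto
    have "plug q ?l = q" using pow walk_plug by blast
    then show "Gs {} (fs @ ?l @ rev fs) = Gs q cs * int m"
      using walk_plug[OF fs] pow rev by (simp add: Gs_append)
  qed
  then show thesis by (rule that) simp
qed

text \<open>Repetitions of the optimal loop give the bulk of the value, unit exchanges the
  remainder, and empty floors fill up the height. The \<open>M\<close> floors left out make room for
  the vertical floors of a fat component.\<close>

lemma interior_values:
  assumes ne: "S \<noteq> {}" and co: "co_connected S" and loop: "(q, cs) \<in> loops" and ev: "even M"
  obtains B where "B > 0"
    "\<And>N t. \<bar>4 * t\<bar> * int (length cs) + B \<le> Gs q cs * int N \<Longrightarrow> M \<le> N \<and> achieves (N - M) (4 * t)"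
proof (cases "Gs q cs \<le> 0")
  case True
  \<comment> \<open>If the maximal rate is not positive, the premise is contradictory already for
    the constant 1.\<close>
  have False if "\<bar>4 * t\<bar> * int (length cs) + 1 \<le> Gs q cs * int N" for t N
    using that mult_nonneg_nonneg[of "\<bar>4 * t\<bar>" "int (length cs)"] mult_nonpos_nonneg[OF True, of "int N"] by linarith
  then show thesis using that[of 1] by force
next
  case False
  define w where "w = Gs q cs"
  have w: "w > 0" using False by (simp add: w_def)
  obtain a where a: "\<And>m. achieves (a + length cs * m) (w * int m)" "even a"
    using loop_conjugate[OF loop] unfolding w_def by blast
  \<comment> \<open>A closed walk of positive value at the empty plug is impossible without a
    branching cell.\<close>
  have branching
  proof (rule ccontr)
    assume nb: "\<not> branching"
    obtain fs where "walk {} fs {}" "Gs {} fs = w * int 1" using a(1)[of 1] by (auto simp: achieves_def)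
    then show False using no_branching_Gs[OF ne nb co] w by simp
  qed
  then obtain c n1 n2 n3 where br: "c \<in> S" "n1 \<in> S" "n2 \<in> S" "n3 \<in> S"
    "nbr c n1" "nbr c n2" "nbr c n3" "n1 \<noteq> n2" "n1 \<noteq> n3" "n2 \<noteq> n3"
    unfolding branching_def by (elim bexE conjE)
  obtain v where v: "reach {} {} v" "\<bar>v\<bar> = 4" by (rule three_neighbours_unit_twist[OF br])
  then obtain n where n: "even n" "achieves n v" by (auto simp: reach_def achieves_def)
  have "achieves n 4" using n v(2) achieves_minus[OF n(2)] by (cases "v \<ge> 0") auto
  then have unit: "achieves (n * nat \<bar>k\<bar>) (4 * k)" for k
    using achieves_mult[of n 4 "nat \<bar>k\<bar>"] achieves_minus[of "n * nat \<bar>k\<bar>" "4 * \<bar>k\<bar>"]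
    by (cases "k \<ge> 0") auto
  obtain os where os: "odd (length os)" "walk {} os {}" by (rule odd_closed_walk)
  have "achieves (length os) (Gs {} os)" using os by (auto simp: achieves_def)
  moreover from mod4[OF this] obtain k where "Gs {} os = 4 * k" by (elim dvdE)
  ultimately have "achieves (length os + n * nat \<bar>- k\<bar>) (4 * k + 4 * - k)"
    using unit[of "- k"] by (intro achieves_add) auto
  \<comment> \<open>An odd length with value 0: the value of the odd walk is a multiple of 4 and is
    cancelled by exchanges.\<close>
  moreover define u where "u = length os + n * nat \<bar>k\<bar>"
  ultimately have u: "achieves u 0" "odd u" using os n by auto
  \<comment> \<open>Scaled by \<open>w\<close>, this pays for the way to the loop and back, at most
    \<open>w\<close> exchanges of \<open>n\<close> floors each, the parity correction and the
    reserve \<open>M\<close>; the summand 1 makes it positive.\<close>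
  define B where "B = w * (int a + int n * w + int u + int M + 1)"
  have B: "B > 0" unfolding B_def using w by (intro mult_pos_pos add_nonneg_pos add_nonneg_nonneg) auto
  have main: "M \<le> N \<and> achieves (N - M) (4 * t)"
    if t: "t \<ge> 0" and h: "4 * t * int (length cs) + B \<le> w * int N" for t N
  proof -
    \<comment> \<open>An even number of repetitions keeps the length even; the price is a remainder
      below \<open>2 * w\<close> instead of \<open>w\<close>.\<close>
    define m where "m = 2 * nat (4 * t div (2 * w))"
    define r where "r = 4 * t mod (2 * w)"
    have "int m = 2 * (4 * t div (2 * w))"
      using w t by (simp add: m_def pos_imp_zdiv_nonneg_iff del: div_mult_mult1)
    moreover have "4 * t = 2 * w * (4 * t div (2 * w)) + r" unfolding r_def by (rule mult_div_mod_eq[symmetric])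
    ultimately have tr: "4 * t = w * int m + r" "0 \<le> r" "r < 2 * w"
      using w by (simp_all add: r_def)
    have "4 dvd w * int m" using mod4[OF a(1)] .
    then have "4 dvd r" using tr(1) by (metis dvd_add_right_iff dvd_triv_left)
    then obtain k where k: "r = 4 * k" by (elim dvdE)
    have k0: "0 \<le> k" "k \<le> w" using k tr by auto
    define L where "L = a + length cs * m + n * nat \<bar>k\<bar>"
    have L: "achieves L (4 * t)" unfolding L_def tr(1) k by (intro achieves_add a unit)
    have evL: "even L" using a(2) n(1) by (simp add: L_def m_def)
    have "w * int m * int (length cs) \<le> 4 * t * int (length cs)"
      using tr by (intro mult_right_mono) auto
    then have "w * (int (length cs) * int m) + B \<le> w * int N" using h by (simp add: algebra_simps)
    then have "w * (int (length cs) * int m + (int a + int n * w + int u + int M + 1)) \<le> w * int N"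
      by (simp add: B_def algebra_simps)
    then have "int (length cs) * int m + (int a + int n * w + int u + int M + 1) \<le> int N"
      using w by (simp only: mult_le_cancel_left_pos)
    moreover have "int n * int (nat \<bar>k\<bar>) \<le> int n * w" using k0 by (intro mult_left_mono) auto
    ultimately have "int L + int u + int M \<le> int N" by (simp add: L_def)
    then have LN: "L + u + M \<le> N" by linarith
    show ?thesis
    proof (intro conjI)
      show "M \<le> N" using LN by simp
      show "achieves (N - M) (4 * t)"
      proof (cases "even N")
        case True
        then have "achieves (N - M - L) 0" using evL ev LN by (intro achieves_even) auto
        from achieves_add[OF L this] show ?thesis using LN by simp
      next
        case False
        then have "achieves (N - M - L - u) 0" using evL ev LN u(2) by (intro achieves_even) auto
        from achieves_add[OF L achieves_add[OF u(1) this]] show ?thesis using LN by simp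
      qed
    qed
  qed
  have "M \<le> N \<and> achieves (N - M) (4 * t)" if "\<bar>4 * t\<bar> * int (length cs) + B \<le> Gs q cs * int N" for N t
  proof (cases "t \<ge> 0")
    case True
    then show ?thesis using main[of t N] that by (simp add: w_def)
  next
    case False
    then have "M \<le> N \<and> achieves (N - M) (4 * - t)" using main[of "- t" N] that by (simp add: w_def)
    then show ?thesis using achieves_minus[of "N - M" "4 * - t"] by simp
  qed
  then show thesis using that B by blast
qed

end


section \<open>Moving vertical floors\<close>

context region
begin

text \<open>Only flips between two stacked copies of a horizontal domino and the vertical pair over
  its cells; these suffice to move vertical floors.\<close>

definition vflip :: "cell set set list \<Rightarrow> cell set set list \<Rightarrow> bool" where
  "vflip fs gs \<longleftrightarrow> walk {} fs {} \<and> walk {} gs {} \<and> (\<exists>xs ys f f' h. h \<notin> f \<and> h \<notin> f' \<and>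
    (fs = xs @ [insert h f, insert h f'] @ ys \<and> gs = xs @ [f, f'] @ ys \<or>
     gs = xs @ [insert h f, insert h f'] @ ys \<and> fs = xs @ [f, f'] @ ys))"

lemma vflip_sym: "vflip fs gs \<Longrightarrow> vflip gs fs"
  unfolding vflip_def by blast

lemma vflips_sym: "vflip\<^sup>*\<^sup>* fs gs \<Longrightarrow> vflip\<^sup>*\<^sup>* gs fs"
proof (induction rule: rtranclp_induct)
  case (step y z)
  then show ?case by (metis converse_rtranclp_into_rtranclp vflip_sym)
qed simp

lemma matchings_insert:
  assumes "h \<notin> f"
  shows "insert h f \<in> matchings \<longleftrightarrow> f \<in> matchings \<and> is_dom h \<and> h \<subseteq> S \<and> h \<inter> \<Union>f = {}"
proof -
  have "(\<forall>y. y \<in> f \<and> y \<noteq> h \<longrightarrow> disjnt h y \<and> disjnt y h) \<longleftrightarrow> h \<inter> \<Union>f = {}"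
    using assms unfolding disjnt_def by blast
  then show ?thesis 
    by (simp only: matchings_def pairwise_insert mem_Collect_eq ball_simps conj_ac)
qed

text \<open>Each domino of \<open>f\<close> passes through the empty floor above it by a pair of flips: the vertical dominoes
  over its cells become horizontal, and the lower pair of the resulting three becomes vertical.\<close>

lemma vslide:
  assumes "walk {} (xs @ [f, {}, g] @ ys) {}"
  shows "vflip\<^sup>*\<^sup>* (xs @ [f, {}, g] @ ys) (xs @ [{}, {}, f \<union> g] @ ys) \<and> walk {} (xs @ [{}, {}, f \<union> g] @ ys) {}"
proof -
  have "finite f" using assms matching_finite by (simp add: walk_append)
  then show ?thesis using assms
  proof (induction f arbitrary: g)
    case empty
    then show ?case by simp
  next
    case (insert h f)
    define p where "p = plug {} xs"
    have pS: "p \<subseteq> S" unfolding p_def by (rule plug_subset) simp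
    have w: "walk {} xs p" "walk p [insert h f, {}, g] (plug p [insert h f, {}, g])"
      "walk (plug p [insert h f, {}, g]) ys {}"
      using insert.prems by (auto simp: walk_append p_def)
    have f: "f \<in> matchings" "is_dom h" "h \<subseteq> S" "h \<inter> \<Union>f = {}" "h \<inter> p = {}" "\<Union>f \<inter> p = {}"
      using w(2) insert.hyps by (auto simp: matchings_insert)
    have g: "g \<in> matchings" "\<Union>g \<inter> nxt (nxt p (insert h f)) {} = {}" using w(2) by auto
    have "nxt (nxt p (insert h f)) {} = p \<union> h \<union> \<Union>f"
      using pS f(3) matching_Union[OF f(1)] by (auto simp: nxt_def)
    then have hg: "h \<inter> \<Union>g = {}" "\<Union>g \<inter> p = {}" "\<Union>g \<inter> \<Union>f = {}" using g(2) by auto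
    have hng: "h \<notin> g" using hg is_dom_nonempty[OF f(2)] by auto
    have hg': "insert h g \<in> matchings" using matchings_insert hng g(1) f hg by auto
    have h1: "{h} \<in> matchings" using f by (intro singleton_matching)
    have n1: "nxt (nxt p (insert h f)) {h} = p \<union> \<Union>f" "nxt (nxt p f) {} = p \<union> \<Union>f"
      using pS f matching_Union[OF f(1)] by (auto simp: nxt_def)
    have n2: "nxt (nxt (nxt p (insert h f)) {}) g = nxt (p \<union> \<Union>f) (insert h g)"
      using pS f(3) matching_Union[OF f(1)] by (auto simp: nxt_def)
    define r where "r = plug p [insert h f, {}, g]"
    have 2: "walk p [insert h f, {h}, insert h g] r"
      using w(2) hg' h1 hg f(4,5) nxt_disj[of "insert h f" p] by (auto simp: n1 n2 r_def)
    have 3: "walk p [f, {}, insert h g] r"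
      using f hg' hg by (auto simp: n1 n2 r_def)
    have W: "walk {} (xs @ L @ ys) {}" if "walk p L r" for L
      using w that by (intro walk_appendI) (auto simp: r_def)
    have "vflip (xs @ [insert h f, {}, g] @ ys) (xs @ [insert h f, {h}, insert h g] @ ys)"
      unfolding vflip_def
      by (intro conjI insert.prems W[OF 2] exI[of _ "xs @ [insert h f]"] exI[of _ ys] exI[of _ "{}"] exI[of _ g] exI[of _ h])
        (use hng in auto)
    moreover have "vflip (xs @ [insert h f, {h}, insert h g] @ ys) (xs @ [f, {}, insert h g] @ ys)"
      unfolding vflip_def
      by (intro conjI W[OF 2] W[OF 3] exI[of _ xs] exI[of _ "insert h g # ys"] exI[of _ f] exI[of _ "{}"] exI[of _ h])
        (use insert.hyps in auto)
    moreover have "vflip\<^sup>*\<^sup>* (xs @ [f, {}, insert h g] @ ys) (xs @ [{}, {}, f \<union> insert h g] @ ys)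
        \<and> walk {} (xs @ [{}, {}, f \<union> insert h g] @ ys) {}"
      using insert.IH W[OF 3] by blast
    ultimately show ?case by (auto intro: converse_rtranclp_into_rtranclp)
  qed
qed

text \<open>The case \<open>g = {}\<close> of \<open>vslide\<close>, read backwards, lets two empty
  floors climb over one floor.\<close>

lemma pair_up:
  assumes "walk {} (xs @ [{}, {}] @ ys @ zs) {}"
  shows "vflip\<^sup>*\<^sup>* (xs @ [{}, {}] @ ys @ zs) (xs @ ys @ [{}, {}] @ zs) \<and> walk {} (xs @ ys @ [{}, {}] @ zs) {}"
  using assms
proof (induction ys arbitrary: xs)
  case (Cons f ys)
  have pS: "plug {} xs \<subseteq> S" by (rule plug_subset) simp
  have vv: "nxt (nxt p {}) {} = p" if "p \<subseteq> S" for p using that by (auto simp: nxt_def)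
  have w: "walk {} (xs @ [f, {}, {}] @ ys @ zs) {}"
    using Cons.prems vv[OF pS] vv[OF nxt_subset] by (simp add: walk_append)
  have "vflip\<^sup>*\<^sup>* (xs @ [f, {}, {}] @ ys @ zs) (xs @ [{}, {}, f] @ ys @ zs)"
    using vslide[OF w] by simp
  then have "vflip\<^sup>*\<^sup>* (xs @ [{}, {}, f] @ ys @ zs) (xs @ [f, {}, {}] @ ys @ zs)"
    by (rule vflips_sym)
  moreover have "vflip\<^sup>*\<^sup>* ((xs @ [f]) @ [{}, {}] @ ys @ zs) ((xs @ [f]) @ ys @ [{}, {}] @ zs)
      \<and> walk {} ((xs @ [f]) @ ys @ [{}, {}] @ zs) {}"
    using w by (intro Cons.IH) simp
  ultimately show ?case by auto
qed simp

definition nv :: "cell set set list \<Rightarrow> nat" where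
  "nv fs = length (filter (\<lambda>f. f = {}) fs)"

lemma nv_simps [simp]:
  "nv [] = 0" "nv (f # fs) = (if f = {} then Suc (nv fs) else nv fs)" "nv (xs @ ys) = nv xs + nv ys"
  by (auto simp: nv_def)

text \<open>Pushing the floor below the last vertical floor through it merges this floor with the
  one above and leaves two empty floors, which then climb to the top. The chosen vertical floor and
  possibly the one below it are used up, whence the loss of at most 2.\<close>

lemma collect_pair:
  assumes ne: "S \<noteq> {}" and fs: "walk {} fs {}" and zs: "walk {} zs {}" and v: "nv fs > 0"
  obtains gs where "walk {} gs {}" "vflip\<^sup>*\<^sup>* (fs @ zs) (gs @ [{}, {}] @ zs)" "nv fs \<le> nv gs + 2"
    "length fs = length gs + 2"
proof -
  note result = that
  have "{} \<in> set fs" using v unfolding nv_def by (metis (mono_tags, lifting) filter_empty_conv length_0_conv less_numeral_extra(3))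
  \<comment> \<open>Above the last vertical floor there is none that the merger could
    destroy.\<close>
  then obtain xs ys where split: "fs = xs @ {} # ys" "{} \<notin> set ys" by (metis split_list_last)
  have pS: "plug {} L \<subseteq> S" for L by (rule plug_subset) simp
  have nvys: "nv ys = 0" using split(2) by (induction ys) auto
  have last: thesis if fs': "fs = xs' @ [{}, {}]" for xs'
  proof (rule result)
    have "nxt (nxt (plug {} xs') {}) {} = plug {} xs'" using pS[of xs'] by (auto simp: nxt_def)
    then show "walk {} xs' {}" using fs unfolding fs' by (auto simp: walk_append)
  qed (auto simp: fs')
  \<comment> \<open>A vertical bottom floor fills the next floor completely, which would then be
    vertical as well.\<close>
  have "xs \<noteq> []"
  proof
    assume "xs = []"
    then have w: "walk S ys {}" using fs split by (simp add: nxt_def)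
    then have "ys \<noteq> []" using ne by auto
    then obtain g ys' where g: "ys = g # ys'" by (cases ys) auto
    then have "\<Union>g \<inter> S = {}" "\<Union>g \<subseteq> S" "g \<in> matchings" using w matching_Union by auto
    then have "g = {}" unfolding matchings_def using is_dom_nonempty by fastforce
    then show False using split(2) g by simp
  qed
  then obtain xs' f where xs: "xs = xs' @ [f]" by (metis rev_exhaust)
  define p where "p = plug {} xs'"
  have w: "walk {} xs' p" "f \<in> matchings" "\<Union>f \<inter> p = {}" "walk (nxt (nxt p f) {}) ys {}"
    using fs split xs by (auto simp: walk_append p_def)
  show thesis
  proof (cases ys)
    case Nil
    \<comment> \<open>At the very top, the plug entering a vertical floor is full, so the floor
      below it is vertical too.\<close>
    then have "nxt (nxt p f) {} = {}" using w by simp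
    then have "nxt p f = S" using nxt_subset by (auto simp: nxt_def)
    then have "\<Union>f = {}" using matching_Union[OF w(2)] by (auto simp: nxt_def)
    then have "f = {}" using w(2) unfolding matchings_def using is_dom_nonempty by fastforce
    then show thesis using last split xs Nil by simp
  next
    case (Cons g ys')
    have g: "g \<noteq> {}" using split(2) Cons by auto
    have w0: "walk {} (xs' @ [f, {}, g] @ ys' @ zs) {}"
      using walk_appendI[OF fs zs] by (simp add: split xs Cons)
    have 1: "vflip\<^sup>*\<^sup>* (xs' @ [f, {}, g] @ ys' @ zs) (xs' @ [{}, {}] @ ((f \<union> g) # ys') @ zs)"
      and w1: "walk {} (xs' @ [{}, {}] @ ((f \<union> g) # ys') @ zs) {}"
      using vslide[OF w0] by auto
    have w2: "walk {} (xs' @ [{}, {}] @ ((f \<union> g) # ys')) {}"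
      using vslide[of xs' f g ys'] fs split xs Cons by auto
    have 2: "vflip\<^sup>*\<^sup>* (xs' @ [{}, {}] @ ((f \<union> g) # ys') @ zs) (xs' @ ((f \<union> g) # ys') @ [{}, {}] @ zs)"
      using pair_up[OF w1] by auto
    show thesis
    proof (rule that[of "xs' @ ((f \<union> g) # ys')"])
      have "nxt (nxt p {}) {} = p" using pS[of xs'] by (auto simp: nxt_def p_def)
      then show "walk {} (xs' @ ((f \<union> g) # ys')) {}" using w2 by (auto simp: walk_append p_def)
      show "vflip\<^sup>*\<^sup>* (fs @ zs) ((xs' @ ((f \<union> g) # ys')) @ [{}, {}] @ zs)"
        using 1 2 by (auto simp: split xs Cons)
      show "nv fs \<le> nv (xs' @ ((f \<union> g) # ys')) + 2" using g by (auto simp: split xs Cons)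
      show "length fs = length (xs' @ ((f \<union> g) # ys')) + 2" by (simp add: split xs Cons)
    qed
  qed
qed

text \<open>The list \<open>zs\<close> carries the floors collected so far, so that the next pair
  comes to lie directly below them.\<close>

lemma collect_vertical:
  assumes ne: "S \<noteq> {}" and "walk {} fs {}" "walk {} zs {}" "2 * j \<le> nv fs"
  obtains gs where "walk {} gs {}" "vflip\<^sup>*\<^sup>* (fs @ zs) (gs @ replicate (2 * j) {} @ zs)"
    "length fs = length gs + 2 * j"
  using assms(2-4)
proof (induction j arbitrary: fs zs thesis)
  case 0
  show ?case using 0(1)[OF 0(2)] by simp
next
  case (Suc j)
  obtain gs where gs: "walk {} gs {}" "vflip\<^sup>*\<^sup>* (fs @ zs) (gs @ [{}, {}] @ zs)" "nv fs \<le> nv gs + 2"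
    "length fs = length gs + 2"
    by (rule collect_pair[OF ne Suc.prems(2,3)]) (use Suc.prems in auto)
  have "walk {} ([{}, {}] @ zs) {}" using Suc.prems by (auto simp: nxt_def)
  moreover have "2 * j \<le> nv gs" using gs Suc.prems by simp
  ultimately obtain hs where hs: "walk {} hs {}"
    "vflip\<^sup>*\<^sup>* (gs @ [{}, {}] @ zs) (hs @ replicate (2 * j) {} @ [{}, {}] @ zs)" "length gs = length hs + 2 * j"
    using Suc.IH[OF _ gs(1)] by blast
  have eq: "replicate (2 * j) {} @ [{}, {}] @ zs = replicate (2 * Suc j) ({} :: cell set set) @ zs"
    by (simp add: replicate_append_same[symmetric])
  then have "vflip\<^sup>*\<^sup>* (fs @ zs) (hs @ replicate (2 * Suc j) {} @ zs)"
    using rtranclp_trans[OF gs(2) hs(2)] by (simp only: eq)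
  then show ?case using Suc.prems(1)[OF hs(1)] gs hs by simp
qed

end


section \<open>Few vertical floors are exponentially rare\<close>

context region
begin

definition walks :: "nat \<Rightarrow> cell set \<Rightarrow> cell set \<Rightarrow> cell set set list set" where
  "walks n p q = {fs. length fs = n \<and> walk p fs q}"

lemma finite_walks: "finite (walks n p q)"
proof (rule finite_subset)
  show "walks n p q \<subseteq> {fs. set fs \<subseteq> matchings \<and> length fs = n}"
    unfolding walks_def using walk_matchings by auto
qed (rule finite_lists_length_eq[OF finite_matchings])

text \<open>Cutting after \<open>m\<close> floors determines the plug at the cut. For walks with few
  vertical floors only an inequality remains: both parts again have few, but not conversely.\<close>

lemma card_walks_add:
  assumes "p \<subseteq> S"
  shows "card (walks (m + n) p q) = (\<Sum>r\<in>Pow S. card (walks m p r) * card (walks n r q))"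
    and "card {fs \<in> walks (m + n) p q. nv fs < M}
      \<le> (\<Sum>r\<in>Pow S. card {fs \<in> walks m p r. nv fs < M} * card {fs \<in> walks n r q. nv fs < M})"
proof -
  have inj: "inj_on (\<lambda>(xs, ys). xs @ ys) (\<Union>r\<in>Pow S. walks m p r \<times> walks n r q)"
    by (auto simp: inj_on_def walks_def)
  have img: "walks (m + n) p q = (\<lambda>(xs, ys). xs @ ys) ` (\<Union>r\<in>Pow S. walks m p r \<times> walks n r q)"
  proof (intro equalityI subsetI)
    fix fs assume fs: "fs \<in> walks (m + n) p q"
    let ?r = "plug p (take m fs)"
    have w: "walk p (take m fs @ drop m fs) q" using fs by (simp add: walks_def)
    have "take m fs \<in> walks m p ?r" "drop m fs \<in> walks n ?r q"
      using w[unfolded walk_append] fs by (simp_all add: walks_def)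
    moreover have "?r \<in> Pow S" using plug_subset[OF assms] by auto
    ultimately have "(take m fs, drop m fs) \<in> (\<Union>r\<in>Pow S. walks m p r \<times> walks n r q)" by blast
    then show "fs \<in> (\<lambda>(xs, ys). xs @ ys) ` (\<Union>r\<in>Pow S. walks m p r \<times> walks n r q)"
      by (rule rev_image_eqI) simp
  qed (auto simp: walks_def intro: walk_appendI)
  have card_UN: "card (\<Union>r\<in>Pow S. A r \<times> B r) = (\<Sum>r\<in>Pow S. card (A r) * card (B r))"
    if A: "\<And>r. A r \<subseteq> walks m p r" and B: "\<And>r. B r \<subseteq> walks n r q"
    for A B :: "cell set \<Rightarrow> cell set set list set"
  proof -
    have fin: "\<forall>r\<in>Pow S. finite (A r \<times> B r)"
      using finite_subset[OF A finite_walks] finite_subset[OF B finite_walks] by simp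
    have "A r \<times> B r \<inter> A s \<times> B s = {}" if "r \<noteq> s" for r s
    proof -
      have "r = s" if "fs \<in> A r" "fs \<in> A s" for fs
      proof -
        have "fs \<in> walks m p r" "fs \<in> walks m p s" using A that by (meson subsetD)+
        then show ?thesis using walk_plug[of p fs r] walk_plug[of p fs s] by (simp add: walks_def)
      qed
      then show ?thesis using that by auto
    qed
    then show ?thesis using card_UN_disjoint[of "Pow S" "\<lambda>r. A r \<times> B r"] fin finite_S
      by (simp add: card_cartesian_product)
  qed
  show "card (walks (m + n) p q) = (\<Sum>r\<in>Pow S. card (walks m p r) * card (walks n r q))"
    unfolding img card_image[OF inj] by (rule card_UN) auto
  let ?A = "\<lambda>r. {fs \<in> walks m p r. nv fs < M}" and ?B = "\<lambda>r. {fs \<in> walks n r q. nv fs < M}"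
  have "{fs \<in> walks (m + n) p q. nv fs < M} \<subseteq> (\<lambda>(xs, ys). xs @ ys) ` (\<Union>r\<in>Pow S. ?A r \<times> ?B r)"
    unfolding img by force
  then have "card {fs \<in> walks (m + n) p q. nv fs < M} \<le> card ((\<lambda>(xs, ys). xs @ ys) ` (\<Union>r\<in>Pow S. ?A r \<times> ?B r))"
    using finite_S finite_walks by (intro card_mono finite_imageI finite_UN_I) auto
  also have "\<dots> \<le> card (\<Union>r\<in>Pow S. ?A r \<times> ?B r)"
    using finite_S finite_walks by (intro card_image_le finite_UN_I) auto
  also have "\<dots> = (\<Sum>r\<in>Pow S. card (?A r) * card (?B r))" by (rule card_UN) auto
  finally show "card {fs \<in> walks (m + n) p q. nv fs < M} \<le> (\<Sum>r\<in>Pow S. card (?A r) * card (?B r))" .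
qed

end

context connected_region
begin

lemma walk_of_each_parity:
  assumes "p \<subseteq> S" "sum chi p = 0" "q \<subseteq> S" "sum chi q = 0"
  shows "\<exists>fs. walk p fs q \<and> (even (length fs) \<longleftrightarrow> even (n :: nat))"
proof -
  obtain u where "reach p {} u" by (rule reach_balanced[of p "{}"]) (use assms in auto)
  moreover obtain v where "reach {} q v" by (rule reach_balanced[of "{}" q]) (use assms in auto)
  ultimately obtain xs ys where 1: "even (length xs)" "walk p xs {}" "even (length ys)" "walk {} ys q"
    by (auto simp: reach_def)
  obtain os where 2: "odd (length os)" "walk {} os {}" by (rule odd_closed_walk)
  have "walk p (xs @ ys) q" "walk p (xs @ os @ ys) q"
    by (rule walk_appendI[OF 1(2,4)], rule walk_appendI[OF 1(2) walk_appendI[OF 2(2) 1(4)]])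
  then show ?thesis using 1 2
    by (cases "even n") (auto intro: exI[of _ "xs @ ys"] exI[of _ "xs @ os @ ys"])
qed

text \<open>Finitely many pairs of plugs and two parities allow a common bound on the connecting
  walks; the remaining height is filled at the bottom by pairs of empty floors.\<close>

lemma block_with_vertical_floors:
  obtains K where "K > 0" "\<And>p q. p \<subseteq> S \<Longrightarrow> sum chi p = 0 \<Longrightarrow> q \<subseteq> S \<Longrightarrow> sum chi q = 0 \<Longrightarrow>
    \<exists>fs\<in>walks K p q. M \<le> nv fs"
proof -
  define P where "P = {p. p \<subseteq> S \<and> sum chi p = 0}"
  have fP: "finite P" unfolding P_def using finite_S by simp
  have "\<forall>x\<in>(P \<times> P) \<times> {0, 1::nat}. \<exists>fs. walk (fst (fst x)) fs (snd (fst x)) \<and> (even (length fs) \<longleftrightarrow> even (snd x))"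
  proof
    fix x assume "x \<in> (P \<times> P) \<times> {0, 1::nat}"
    then show "\<exists>fs. walk (fst (fst x)) fs (snd (fst x)) \<and> (even (length fs) \<longleftrightarrow> even (snd x))"
      using walk_of_each_parity[of "fst (fst x)" "snd (fst x)" "snd x"] by (auto simp: P_def)
  qed
  then obtain F where F: "\<And>x. x \<in> (P \<times> P) \<times> {0, 1::nat} \<Longrightarrow>
      walk (fst (fst x)) (F x) (snd (fst x)) \<and> (even (length (F x)) \<longleftrightarrow> even (snd x))" by metis
  define L where "L = (\<Sum>x\<in>(P \<times> P) \<times> {0, 1::nat}. length (F x))"
  have L: "length (F x) \<le> L" if "x \<in> (P \<times> P) \<times> {0, 1::nat}" for x
    unfolding L_def using that fP by (intro member_le_sum) auto
  \<comment> \<open>Next to a walk of length at most \<open>L\<close> and of the same parity as this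
    number, an even number of floors, at least \<open>M + 1\<close>, is left for empty ones.\<close>
  let ?K = "L + M + 1"
  have "\<exists>fs\<in>walks ?K p q. M \<le> nv fs" if "p \<subseteq> S" "sum chi p = 0" "q \<subseteq> S" "sum chi q = 0" for p q
  proof -
    let ?x = "((p, q), ?K mod 2)"
    have x: "?x \<in> (P \<times> P) \<times> {0, 1::nat}" using that by (auto simp: P_def)
    define fs where "fs = F ?x"
    have fs: "walk p fs q" "even (length fs) \<longleftrightarrow> even ?K" "length fs \<le> L"
      using F[OF x] L[OF x] unfolding fs_def fst_conv snd_conv even_mod_2_iff by - (elim conjE, assumption)+
    then have "even (?K - length fs)" by auto
    then obtain k where k: "?K - length fs = 2 * k" by (elim evenE)
    have vv: "walk p (replicate (2 * k) {}) p \<and> nv (replicate (2 * k) {}) = 2 * k"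
      by (induction k) (use that(1) in \<open>auto simp: nxt_def double_diff\<close>)
    have "walk p (replicate (2 * k) {} @ fs) q" using vv fs(1) by (intro walk_appendI) auto
    moreover have "length (replicate (2 * k) {} @ fs) = ?K" using k fs(3) by simp
    moreover have "M \<le> nv (replicate (2 * k) {} @ fs)" using vv k fs(3) by simp
    ultimately show ?thesis unfolding walks_def by blast
  qed
  then show thesis using that[of ?K] by simp
qed

text \<open>For each pair of balanced plugs, at least one walk across a block of \<open>K\<close>
  floors has \<open>M\<close> or more vertical floors. A fixed proportion of the walks is thus lost
  in every block.\<close>

lemma few_vertical_floors_decay:
  obtains K and r :: real where "K > 0" "0 < r" "r < 1"
    "\<And>n. real (card {fs \<in> walks n {} {}. nv fs < M}) \<le> r ^ (n div K) * real (card (walks n {} {}))"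
proof -
  obtain K where K: "K > 0" "\<And>p q. p \<subseteq> S \<Longrightarrow> sum chi p = 0 \<Longrightarrow> q \<subseteq> S \<Longrightarrow> sum chi q = 0 \<Longrightarrow>
    \<exists>fs\<in>walks K p q. M \<le> nv fs" using block_with_vertical_floors by metis
  \<comment> \<open>A bound for the number of walks in a block; the summand 2 keeps \<open>r\<close>
    positive.\<close>
  define A where "A = (\<Sum>p\<in>Pow S. \<Sum>q\<in>Pow S. card (walks K p q)) + 2"
  have A: "card (walks K p q) \<le> A" if "p \<subseteq> S" "q \<subseteq> S" for p q
  proof -
    have "card (walks K p q) \<le> (\<Sum>q\<in>Pow S. card (walks K p q))"
      using that finite_S by (intro member_le_sum) auto
    also have "\<dots> \<le> (\<Sum>p\<in>Pow S. \<Sum>q\<in>Pow S. card (walks K p q))"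
      using that finite_S by (intro member_le_sum[of p "Pow S" "\<lambda>p. \<Sum>q\<in>Pow S. card (walks K p q)"]) auto
    finally show ?thesis by (simp add: A_def)
  qed
  define r where "r = 1 - 1 / real A"
  have "A \<ge> 2" by (simp add: A_def)
  then have A2: "real A \<ge> 2" by linarith
  have r: "0 < r" "r < 1" using A2 by (auto simp: r_def field_simps)
  have block: "real (card {fs \<in> walks K p q. nv fs < M}) \<le> r * real (card (walks K p q))"
    if pq: "p \<subseteq> S" "sum chi p = 0" "q \<subseteq> S" for p q
  proof (cases "walks K p q = {}")
    case False
    then obtain gs where "walk p gs q" by (auto simp: walks_def)
    then have q: "sum chi q = 0" using walk_balanced[OF charge_S that(1,2)] by simp
    obtain fs where fs: "fs \<in> walks K p q" "M \<le> nv fs" using K(2)[OF pq q] by (elim bexE)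
    then have "card {fs \<in> walks K p q. nv fs < M} \<le> card (walks K p q - {fs})"
      using finite_walks by (intro card_mono) auto
    also have "\<dots> = card (walks K p q) - 1" using fs(1) finite_walks by simp
    finally have "card {fs \<in> walks K p q. nv fs < M} + 1 \<le> card (walks K p q)"
      using fs(1) finite_walks card_gt_0_iff[of "walks K p q"] by auto
    then have "real (card {fs \<in> walks K p q. nv fs < M}) + 1 \<le> real (card (walks K p q))" by linarith
    moreover have "real (card (walks K p q)) / real A \<le> 1" using A[OF that(1,3)] A2 by simp
    ultimately show ?thesis by (simp add: r_def algebra_simps)
  qed simp
  have main: "real (card {fs \<in> walks (m * K + j) p q. nv fs < M}) \<le> r ^ m * real (card (walks (m * K + j) p q))"
    if "p \<subseteq> S" "sum chi p = 0" for m j p q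
    using that
  proof (induction m arbitrary: p)
    case 0
    then show ?case using finite_walks by (auto intro: card_mono)
  next
    case (Suc m)
    let ?W = "\<lambda>n p q. {fs \<in> walks n p q. nv fs < M}"
    have e: "Suc m * K + j = K + (m * K + j)" by simp
    have "real (card (?W (K + (m * K + j)) p q)) \<le> real (\<Sum>s\<in>Pow S. card (?W K p s) * card (?W (m * K + j) s q))"
      using card_walks_add(2)[OF Suc.prems(1)] of_nat_le_iff by blast
    also have "\<dots> = (\<Sum>s\<in>Pow S. real (card (?W K p s)) * real (card (?W (m * K + j) s q)))" by simp
    also have "\<dots> \<le> (\<Sum>s\<in>Pow S. (r * real (card (walks K p s))) * (r ^ m * real (card (walks (m * K + j) s q))))"
    proof (rule sum_mono)
      fix s assume s: "s \<in> Pow S"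
      show "real (card (?W K p s)) * real (card (?W (m * K + j) s q))
        \<le> (r * real (card (walks K p s))) * (r ^ m * real (card (walks (m * K + j) s q)))"
      \<comment> \<open>A plug that is reached is balanced, as the induction hypothesis requires;
        the others contribute 0.\<close>
      proof (cases "walks K p s = {}")
        case False
        then obtain gs where "walk p gs s" by (auto simp: walks_def)
        then have "sum chi s = 0" using walk_balanced[OF charge_S Suc.prems] by simp
        then show ?thesis using block[OF Suc.prems] Suc.IH[of s] s r by (intro mult_mono) auto
      qed simp
    qed
    also have "\<dots> = r ^ Suc m * real (\<Sum>s\<in>Pow S. card (walks K p s) * card (walks (m * K + j) s q))"
      by (simp add: sum_distrib_left mult_ac)
    also have "\<dots> = r ^ Suc m * real (card (walks (K + (m * K + j)) p q))"
      using card_walks_add(1)[OF Suc.prems(1)] by simp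
    finally show ?case unfolding e .
  qed
  have "real (card {fs \<in> walks n {} {}. nv fs < M}) \<le> r ^ (n div K) * real (card (walks n {} {}))" for n
    using main[of "{}" "n div K" "n mod K" "{}"] by simp
  then show thesis using that K(1) r by blast
qed

end


section \<open>The cells of a quadriculated disk\<close>

lemma unit_cell_cbox: "unit_cell a = cbox (\<chi> i. of_int (a $ i)) (\<chi> i. of_int (a $ i) + 1)"
  by (auto simp: unit_cell_def mem_box_cart)

lemma center_in_unit_cell: "cell_center a \<in> unit_cell b \<longleftrightarrow> a = b"
proof
  assume h: "cell_center a \<in> unit_cell b"
  have "a $ i = b $ i" for i
  proof -
    have "real_of_int (b $ i) \<le> of_int (a $ i) + 1 / 2" "of_int (a $ i) + 1 / 2 \<le> real_of_int (b $ i) + 1"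
      using h by (auto simp: unit_cell_def cell_center_def)
    then show ?thesis by linarith
  qed
  then show "a = b" by (simp add: vec_eq_iff)
qed (auto simp: unit_cell_def cell_center_def)

text \<open>The centre of a cell lies in no other cell, so a union of cells determines its
  cells.\<close>

lemma unit_cell_subset_UN: "unit_cell a \<subseteq> (\<Union>b\<in>A. unit_cell b) \<longleftrightarrow> a \<in> A"
proof
  assume "unit_cell a \<subseteq> (\<Union>b\<in>A. unit_cell b)"
  then have "cell_center a \<in> (\<Union>b\<in>A. unit_cell b)"
    using center_in_unit_cell[of a a] by (simp add: subset_iff)
  then show "a \<in> A" by (simp add: center_in_unit_cell)
qed auto

text \<open>The Boolean selects which axis of the plane plays the role of the first coordinate.\<close>

definition square :: "bool \<Rightarrow> cell \<Rightarrow> int ^ 2" where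
  "square w c = (if w then vector [fst c, snd c] else vector [snd c, fst c])"

definition xc :: "bool \<Rightarrow> real ^ 2 \<Rightarrow> real" where "xc w p = (if w then p $ 1 else p $ 2)"
definition yc :: "bool \<Rightarrow> real ^ 2 \<Rightarrow> real" where "yc w p = (if w then p $ 2 else p $ 1)"

definition squares :: "bool \<Rightarrow> (real ^ 2) set \<Rightarrow> cell set" where
  "squares w D = {c. unit_cell (square w c) \<subseteq> D}"

lemma in_square:
  "p \<in> unit_cell (square w c) \<longleftrightarrow> of_int (fst c) \<le> xc w p \<and> xc w p \<le> of_int (fst c) + 1
    \<and> of_int (snd c) \<le> yc w p \<and> yc w p \<le> of_int (snd c) + 1"
  by (auto simp: unit_cell_def square_def xc_def yc_def forall_2)

lemma bij_square: "bij (square w)"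
proof (rule bijI')
  fix a show "\<exists>c. a = square w c"
    by (intro exI[of _ "(if w then (a $ 1, a $ 2) else (a $ 2, a $ 1))"])
      (auto simp: square_def vec_eq_iff forall_2)
qed (auto simp: square_def vec_eq_iff forall_2 prod_eq_iff)

lemma square_eq [simp]: "square w c = square w d \<longleftrightarrow> c = d"
  using bij_square by (metis bij_pointE)

lemma black_square: "black_cell (square w c) \<longleftrightarrow> chi c = 1"
  by (auto simp: black_cell_def square_def chi_def sum_2 add.commute)

lemma center_coords:
  "xc w (cell_center (square w c)) = of_int (fst c) + 1 / 2"
  "yc w (cell_center (square w c)) = of_int (snd c) + 1 / 2"
  by (auto simp: xc_def yc_def cell_center_def square_def)

context
  fixes D :: "(real ^ 2) set"
  assumes disk: "quadriculated_disk D"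
begin

lemma squares_finite_cover: "finite (squares w D) \<and> D = (\<Union>c\<in>squares w D. unit_cell (square w c))"
proof -
  obtain A where A: "finite A" "D = (\<Union>a\<in>A. unit_cell a)"
    using disk by (auto simp: quadriculated_disk_def)
  have "squares w D = square w -` A"
    unfolding squares_def A(2) unit_cell_subset_UN by auto
  moreover have "square w ` (square w -` A) = A" using bij_square by (metis bij_is_surj surj_image_vimage_eq)
  moreover have "finite (square w -` A)" using A(1) bij_square by (metis bij_is_inj finite_vimageI)
  ultimately show ?thesis using A(2) by (metis image_image)
qed

lemma squares_nonempty: "squares w D \<noteq> {}"
proof
  assume "squares w D = {}"
  then have "D = {}" using squares_finite_cover[of w] by auto
  then show False using disk by (simp add: quadriculated_disk_def homeomorphic_empty)
qed

lemma center_in_disk: "cell_center (square w c) \<in> D \<longleftrightarrow> c \<in> squares w D"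
proof -
  have "cell_center (square w c) \<in> D \<longleftrightarrow> cell_center (square w c) \<in> (\<Union>c\<in>squares w D. unit_cell (square w c))"
    using squares_finite_cover[of w] by simp
  also have "\<dots> \<longleftrightarrow> c \<in> squares w D" by (auto simp: center_in_unit_cell)
  finally show ?thesis .
qed

text \<open>A convex set that is not collinear stays connected after removing countably many points,
  and this passes to the disk through the homeomorphism. Removing the lattice points destroys those
  contacts of cells that are mere corners.\<close>

lemma connected_without_lattice:
  defines "C \<equiv> {p :: real ^ 2. p $ 1 \<in> \<int> \<and> p $ 2 \<in> \<int>}"
  shows "connected (D - C)"
proof -
  have "C \<subseteq> (\<lambda>(i, j). vector [of_int i, of_int j]) ` (UNIV :: (int \<times> int) set)"
  proof
    fix p assume "p \<in> C"
    then obtain i j where "p $ 1 = of_int i" "p $ 2 = of_int j" by (auto simp: C_def elim!: Ints_cases)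
    then have "p = (\<lambda>(i, j). vector [of_int i, of_int j]) (i, j)" by (simp add: vec_eq_iff forall_2)
    then show "p \<in> (\<lambda>(i, j). vector [of_int i, of_int j]) ` (UNIV :: (int \<times> int) set)" by blast
  qed
  then have C: "countable C" by (rule countable_subset) simp
  obtain f g where fg: "homeomorphism D (cball 0 1 :: (real ^ 2) set) f g"
    using disk by (auto simp: quadriculated_disk_def homeomorphic_def)
  have "\<not> collinear (cball 0 1 :: (real ^ 2) set)"
    by (simp add: collinear_aff_dim aff_dim_cball)
  then have "connected (cball 0 1 - f ` (D \<inter> C))"
    using C by (intro connected_convex_diff_countable) auto
  moreover have "continuous_on (cball 0 1 - f ` (D \<inter> C)) g"
    using fg by (meson Diff_subset continuous_on_subset homeomorphism_def)
  ultimately have "connected (g ` (cball 0 1 - f ` (D \<inter> C)))" by (intro connected_continuous_image)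
  also have "g ` (cball 0 1 - f ` (D \<inter> C)) = D - C"
  proof (intro equalityI subsetI)
    fix p assume "p \<in> g ` (cball 0 1 - f ` (D \<inter> C))"
    then obtain q where q: "q \<in> cball 0 1" "q \<notin> f ` (D \<inter> C)" "p = g q" by auto
    have "p \<in> D" "f p = q" using q fg by (auto simp: homeomorphism_def)
    moreover have "p \<notin> C" using calculation q(2) by (metis IntI image_eqI)
    ultimately show "p \<in> D - C" by simp
  next
    fix p assume p: "p \<in> D - C"
    then have "g (f p) = p" "f p \<in> cball 0 1" using fg by (auto simp: homeomorphism_def)
    moreover have "f p \<notin> f ` (D \<inter> C)" using p fg by (auto simp: homeomorphism_def)
    ultimately show "p \<in> g ` (cball 0 1 - f ` (D \<inter> C))" by (metis DiffI image_eqI)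
  qed
  finally show ?thesis .
qed

text \<open>Otherwise the cells reachable from \<open>a\<close> and the remaining ones form two
  closed sets covering \<open>D\<close>. These can meet only in lattice points and so separate the
  disk without the lattice.\<close>

lemma squares_connected:
  assumes ab: "a \<in> squares w D" "b \<in> squares w D"
  shows "(\<lambda>a b. a \<in> squares w D \<and> b \<in> squares w D \<and> nbr a b)\<^sup>*\<^sup>* a b"
proof (rule ccontr)
  let ?S = "squares w D" and ?cell = "\<lambda>c. unit_cell (square w c)"
  let ?R = "(\<lambda>a b. a \<in> ?S \<and> b \<in> ?S \<and> nbr a b)\<^sup>*\<^sup>* a"
  define B where "B = {c \<in> ?S. ?R c}"
  define C where "C = {p :: real ^ 2. p $ 1 \<in> \<int> \<and> p $ 2 \<in> \<int>}"
  assume no: "\<not> ?R b"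
  have closed: "closed (\<Union>c\<in>X. ?cell c)" if "X \<subseteq> ?S" for X
    using that squares_finite_cover[of w] by (intro closed_UN) (auto simp: unit_cell_cbox intro: finite_subset)
  have cover: "D = (\<Union>c\<in>?S. ?cell c)" using squares_finite_cover by blast
  have notC: "cell_center (square w c) \<notin> C" for c
  proof
    assume "cell_center (square w c) \<in> C"
    then have "xc w (cell_center (square w c)) \<in> \<int>" by (auto simp: C_def xc_def)
    then have "of_int (fst c) + 1 / 2 \<in> (\<int> :: real set)" by (simp only: center_coords)
    then obtain z where "of_int (fst c) + 1 / 2 = real_of_int z" by (elim Ints_cases)
    then have "real_of_int (2 * fst c + 1) = real_of_int (2 * z)" by simp
    then have "2 * fst c + 1 = 2 * z" by (simp only: of_int_eq_iff)
    then show False by presburger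
  qed
  have "(\<Union>c\<in>B. ?cell c) \<inter> (D - C) = {} \<or> (\<Union>c\<in>?S - B. ?cell c) \<inter> (D - C) = {}"
  proof (rule connected_closedD[OF connected_without_lattice[folded C_def]])
    show "(\<Union>c\<in>B. ?cell c) \<inter> (\<Union>c\<in>?S - B. ?cell c) \<inter> (D - C) = {}"
    proof -
      have False if p: "c \<in> B" "d \<in> ?S - B" "p \<in> ?cell c" "p \<in> ?cell d" "p \<notin> C" for p c d
      proof -
      have "\<not> nbr c d" using p(1,2) unfolding B_def by (auto intro: rtranclp.rtrancl_into_rtrancl)
      moreover have "c \<noteq> d" using p by auto
      moreover have "\<bar>fst c - fst d\<bar> \<le> 1" "\<bar>snd c - snd d\<bar> \<le> 1"
        using p(3,4) unfolding in_square by linarith+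
      \<comment> \<open>Two different cells that meet without being adjacent are diagonal
        neighbours, and their common point is a lattice point.\<close>
      ultimately have "\<bar>fst c - fst d\<bar> = 1 \<and> \<bar>snd c - snd d\<bar> = 1"
        by (cases c; cases d) (auto simp: nbr_def abs_if split: if_splits)
      then have "xc w p = of_int (max (fst c) (fst d)) \<and> yc w p = of_int (max (snd c) (snd d))"
        using p(3,4) unfolding in_square by (auto simp: abs_if split: if_splits)
      then have "xc w p \<in> \<int>" "yc w p \<in> \<int>" by auto
      then show False using p(5) by (auto simp: C_def xc_def yc_def split: if_splits)
      qed
      then show ?thesis by blast
    qed
    show "D - C \<subseteq> (\<Union>c\<in>B. ?cell c) \<union> (\<Union>c\<in>?S - B. ?cell c)" using cover by blast
  qed (use closed in \<open>auto simp: B_def\<close>)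
  moreover have "a \<in> B" "b \<in> ?S - B" using ab no by (auto simp: B_def)
  moreover have "cell_center (square w c) \<in> ?cell c" for c by (simp add: center_in_unit_cell)
  moreover have "cell_center (square w a) \<in> D" "cell_center (square w b) \<in> D"
    using ab center_in_disk by auto
  ultimately show False using notC by blast
qed

text \<open>The bound on the distance excludes every integer other than \<open>x\<close> itself, so
  the unit interval starting at the floor of a nearby point still contains \<open>x\<close>.\<close>

lemma floor_near:
  fixes x :: real
  shows "\<exists>e>0. \<forall>y. \<bar>y - x\<bar> < e \<longrightarrow> of_int \<lfloor>y\<rfloor> \<le> x \<and> x \<le> of_int \<lfloor>y\<rfloor> + 1"
proof (intro exI[of _ "min (x - (of_int \<lceil>x\<rceil> - 1)) (of_int \<lfloor>x\<rfloor> + 1 - x)"] conjI allI impI)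
  show "0 < min (x - (of_int \<lceil>x\<rceil> - 1)) (of_int \<lfloor>x\<rfloor> + 1 - x)" by linarith
  fix y assume "\<bar>y - x\<bar> < min (x - (of_int \<lceil>x\<rceil> - 1)) (of_int \<lfloor>x\<rfloor> + 1 - x)"
  then have y: "of_int (\<lceil>x\<rceil> - 1) \<le> y" "y < of_int (\<lfloor>x\<rfloor> + 1)" by auto
  have "\<lceil>x\<rceil> - 1 \<le> \<lfloor>y\<rfloor>" "\<lfloor>y\<rfloor> < \<lfloor>x\<rfloor> + 1" using y by (simp_all only: le_floor_iff floor_less_iff)
  then show "of_int \<lfloor>y\<rfloor> \<le> x" "x \<le> of_int \<lfloor>y\<rfloor> + 1" by linarith+
qed

text \<open>In the plane, the complement of a compact set homeomorphic to a convex one is connected.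
  On it, membership in \<open>Q\<close> of the cell around a point is locally constant, because all
  cells sharing a point outside \<open>D\<close> are outside and are joined by adjacencies.\<close>

lemma squares_co_connected: "co_connected (squares w D)"
  unfolding co_connected_def
proof (intro allI impI)
  let ?S = "squares w D" and ?cell = "\<lambda>c. unit_cell (square w c)"
  fix Q a b
  assume Q: "\<forall>a b. a \<notin> ?S \<longrightarrow> b \<notin> ?S \<longrightarrow> nbr a b \<longrightarrow> (a \<in> Q \<longleftrightarrow> b \<in> Q)" and ab: "a \<notin> ?S" "b \<notin> ?S"
  define fl where "fl = (\<lambda>p. (\<lfloor>xc w p\<rfloor>, \<lfloor>yc w p\<rfloor>))"
  have fl: "c \<in> Q \<longleftrightarrow> fl p \<in> Q" if p: "p \<notin> D" "p \<in> ?cell c" for p c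
  proof -
    obtain i j where c: "c = (i, j)" by (cases c)
    have out: "d \<notin> ?S" if "p \<in> ?cell d" for d using p(1) that by (auto simp: squares_def)
    have h: "i = \<lfloor>xc w p\<rfloor> \<or> i + 1 = \<lfloor>xc w p\<rfloor>" "j = \<lfloor>yc w p\<rfloor> \<or> j + 1 = \<lfloor>yc w p\<rfloor>"
      using p(2) unfolding in_square c by (simp_all, linarith+)
    have o: "(i, j) \<notin> ?S" "(\<lfloor>xc w p\<rfloor>, j) \<notin> ?S" "fl p \<notin> ?S"
      using p(2) by (auto intro!: out simp: in_square c fl_def)
    \<comment> \<open>A diagonal cell is reached through the cell of mixed coordinates, which
      contains \<open>p\<close> too.\<close>
    have "(i, j) \<in> Q \<longleftrightarrow> (\<lfloor>xc w p\<rfloor>, j) \<in> Q"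
    proof (cases "i = \<lfloor>xc w p\<rfloor>")
      case False
      then have "nbr (i, j) (\<lfloor>xc w p\<rfloor>, j)" using h(1) by (auto simp: nbr_def)
      then show ?thesis using Q o by blast
    qed simp
    also have "\<dots> \<longleftrightarrow> fl p \<in> Q"
    proof (cases "j = \<lfloor>yc w p\<rfloor>")
      case False
      then have "nbr (\<lfloor>xc w p\<rfloor>, j) (fl p)" using h(2) by (auto simp: nbr_def fl_def)
      then show ?thesis using Q o by blast
    qed (simp add: fl_def)
    finally show ?thesis by (simp add: c)
  qed
  have loc: "\<forall>p\<in>-D. eventually (\<lambda>q. (fl p \<in> Q) = (fl q \<in> Q)) (at p within -D)"
  proof
    fix p assume p: "p \<in> - D"
    obtain e1 where e1: "e1 > 0" "\<And>y. \<bar>y - xc w p\<bar> < e1 \<Longrightarrow> of_int \<lfloor>y\<rfloor> \<le> xc w p \<and> xc w p \<le> of_int \<lfloor>y\<rfloor> + 1"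
      using floor_near by metis
    obtain e2 where e2: "e2 > 0" "\<And>y. \<bar>y - yc w p\<bar> < e2 \<Longrightarrow> of_int \<lfloor>y\<rfloor> \<le> yc w p \<and> yc w p \<le> of_int \<lfloor>y\<rfloor> + 1"
      using floor_near by metis
    show "eventually (\<lambda>q. (fl p \<in> Q) = (fl q \<in> Q)) (at p within -D)"
      unfolding eventually_at
    proof (intro exI[of _ "min e1 e2"] conjI ballI impI)
      fix q assume q: "q \<in> - D" "q \<noteq> p \<and> dist q p < min e1 e2"
      have "\<bar>xc w q - xc w p\<bar> \<le> dist q p" "\<bar>yc w q - yc w p\<bar> \<le> dist q p"
        using component_le_norm_cart[of "q - p"] by (auto simp: xc_def yc_def dist_norm)
      then have "p \<in> ?cell (fl q)"
        unfolding in_square fl_def using q e1(2)[of "xc w q"] e2(2)[of "yc w q"] by simp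
      then show "(fl p \<in> Q) = (fl q \<in> Q)" using fl[of p "fl q"] p by simp
    qed (use e1 e2 in auto)
  qed
  have "connected (- D)"
    using disk by (intro connected_complement_homeomorphic_convex_compact[of D "cball 0 1 :: (real ^ 2) set"])
      (auto simp: quadriculated_disk_def)
  moreover have "cell_center (square w a) \<in> - D" "cell_center (square w b) \<in> - D"
    using ab center_in_disk by auto
  ultimately have "(fl (cell_center (square w a)) \<in> Q) = (fl (cell_center (square w b)) \<in> Q)"
    using loc by (rule connected_local_const)
  moreover have "fl (cell_center (square w c)) = c" for c
  proof -
    have "\<lfloor>of_int z + 1 / 2 :: real\<rfloor> = z" for z by linarith
    then show ?thesis by (simp add: fl_def center_coords)
  qed
  ultimately show "a \<in> Q \<longleftrightarrow> b \<in> Q" by simp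
qed

lemma squares_balanced:
  assumes "balanced D"
  shows "sum chi (squares w D) = 0"
proof -
  let ?S = "squares w D"
  have fin: "finite ?S" using squares_finite_cover by blast
  have bij: "card {a. unit_cell a \<subseteq> D \<and> P (black_cell a)} = card {c \<in> ?S. P (chi c = 1)}" for P
  proof -
    have "{a. unit_cell a \<subseteq> D \<and> P (black_cell a)} = square w ` {c \<in> ?S. P (chi c = 1)}"
    proof (intro equalityI subsetI)
      fix a assume a: "a \<in> {a. unit_cell a \<subseteq> D \<and> P (black_cell a)}"
      obtain c where "a = square w c" using bij_square by (metis bij_pointE)
      then show "a \<in> square w ` {c \<in> ?S. P (chi c = 1)}" using a by (auto simp: squares_def black_square)
    qed (auto simp: squares_def black_square)
    moreover have "inj_on (square w) {c \<in> ?S. P (chi c = 1)}" by (simp add: inj_on_def)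
    ultimately show ?thesis by (simp add: card_image)
  qed
  have "card {c \<in> ?S. chi c = 1} = card {c \<in> ?S. chi c \<noteq> 1}"
    using assms bij[of "\<lambda>b. b"] bij[of Not] by (simp add: balanced_def)
  moreover have "sum chi ?S = (\<Sum>c\<in>{c \<in> ?S. chi c = 1}. 1) + (\<Sum>c\<in>{c \<in> ?S. chi c \<noteq> 1}. - 1)"
  proof -
    have "sum chi ?S = (\<Sum>c\<in>?S. if chi c = 1 then 1 else - 1)"
      using chi_cases by (intro sum.cong) auto
    also have "\<dots> = (\<Sum>c\<in>?S \<inter> {c. chi c = 1}. 1) + (\<Sum>c\<in>?S \<inter> - {c. chi c = 1}. - 1)"
      using fin by (rule sum.If_cases)
    finally show ?thesis by (simp add: Int_def Collect_neg_eq[symmetric])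
  qed
  ultimately show ?thesis by simp
qed

lemma squares_connected_region:
  assumes "balanced D"
  shows "connected_region (squares w D)"
proof -
  have fin: "finite (squares w D)" using squares_finite_cover by blast
  interpret region "squares w D" by unfold_locales (rule fin)
  have "adj = (\<lambda>a b. a \<in> squares w D \<and> b \<in> squares w D \<and> nbr a b)"
    by (intro ext adj_def)
  then show ?thesis
    by unfold_locales (simp_all add: squares_connected squares_balanced[OF assms])
qed

end


section \<open>Dominoes as sets of cubes\<close>

definition ax :: "bool \<Rightarrow> 3" where "ax w = (if w then 1 else 2)"
definition ay :: "bool \<Rightarrow> 3" where "ay w = (if w then 2 else 1)"

definition cube :: "bool \<Rightarrow> cell \<times> nat \<Rightarrow> int ^ 3" where
  "cube w c = (\<chi> i. if i = ax w then fst (fst c) else if i = ay w then snd (fst c) else int (snd c))"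

lemma ax_neq [simp]: "ax w \<noteq> ay w" "ay w \<noteq> ax w" "ax w \<noteq> 3" "3 \<noteq> ax w" "ay w \<noteq> 3" "3 \<noteq> ay w"
  by (auto simp: ax_def ay_def)

lemma all_axes: "(\<forall>i. P i) \<longleftrightarrow> P (ax w) \<and> P (ay w) \<and> P (3 :: 3)"
  by (auto simp: forall_3 ax_def ay_def)

lemma axis_cases: obtains "i = ax w" | "i = ay w" | "i = (3 :: 3)"
  using exhaust_3[of i] by (cases w) (auto simp: ax_def ay_def)

lemma cube_nth [simp]:
  "cube w c $ ax w = fst (fst c)" "cube w c $ ay w = snd (fst c)" "cube w c $ 3 = int (snd c)"
  by (simp_all add: cube_def)

lemma cube_eq [simp]: "cube w c = cube w d \<longleftrightarrow> c = d"
  by (auto simp: vec_eq_iff all_axes[of _ w] prod_eq_iff)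

lemma cube_surj: "0 \<le> a $ 3 \<Longrightarrow> \<exists>c. a = cube w c"
  by (intro exI[of _ "((a $ ax w, a $ ay w), nat (a $ 3))"]) (auto simp: vec_eq_iff all_axes[of _ w])

lemma cube_axis:
  "cube w ((x, y), k) + axis (ax w) 1 = cube w ((x + 1, y), k)"
  "cube w ((x, y), k) + axis (ay w) 1 = cube w ((x, y + 1), k)"
  "cube w (s, k) + axis 3 1 = cube w (s, Suc k)"
  by (auto simp: vec_eq_iff all_axes[of _ w] axis_def)

lemma black_cube: "black_cell (cube w (s, k)) \<longleftrightarrow> chi s * (- 1) ^ k = 1"
proof -
  have "(\<Sum>i\<in>UNIV. cube w (s, k) $ i) = fst s + snd s + int k"
    by (cases w) (auto simp: sum_3 cube_def ax_def ay_def)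
  then show ?thesis
    by (auto simp: black_cell_def chi_def uminus_power_if)
qed

lemma in_unit_cube:
  "p \<in> unit_cell (cube w (s, k)) \<longleftrightarrow> of_int (fst s) \<le> p $ ax w \<and> p $ ax w \<le> of_int (fst s) + 1
    \<and> of_int (snd s) \<le> p $ ay w \<and> p $ ay w \<le> of_int (snd s) + 1 \<and> real k \<le> p $ 3 \<and> p $ 3 \<le> real k + 1"
  by (auto simp: unit_cell_def all_axes[of _ w])

definition cubes :: "bool \<Rightarrow> (cell \<times> nat) set \<Rightarrow> (real ^ 3) set" where
  "cubes w X = (\<Union>c\<in>X. unit_cell (cube w c))"

lemma cubes_subset: "cubes w X \<subseteq> cubes w Y \<longleftrightarrow> X \<subseteq> Y"
proof
  assume s: "cubes w X \<subseteq> cubes w Y"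
  show "X \<subseteq> Y"
  proof
    fix c assume "c \<in> X"
    then have "unit_cell (cube w c) \<subseteq> cubes w Y" using s by (auto simp: cubes_def)
    then have "unit_cell (cube w c) \<subseteq> (\<Union>b\<in>cube w ` Y. unit_cell b)" by (simp add: cubes_def)
    then have "cube w c \<in> cube w ` Y" unfolding unit_cell_subset_UN .
    then show "c \<in> Y" by auto
  qed
qed (auto simp: cubes_def)

lemma cubes_eq: "cubes w X = cubes w Y \<longleftrightarrow> X = Y"
  using cubes_subset by (metis subset_antisym order_refl)

lemma cubes_UN: "cubes w (\<Union>A) = \<Union> (cubes w ` A)"
  by (auto simp: cubes_def)

text \<open>Moving a point slightly along the diagonal puts it into the interior of a single cell.\<close>

lemma single_cell_nearby:
  fixes p :: "real ^ 'n"
  assumes "0 < e"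
  shows "\<exists>q. dist q p < e \<and> (\<forall>a b. q \<in> unit_cell a \<longrightarrow> q \<in> unit_cell b \<longrightarrow> a = b)"
proof -
  define m where "m = Min ((\<lambda>i. of_int \<lfloor>p $ i\<rfloor> + 1 - p $ i) ` UNIV)"
  have m: "0 < m" "\<And>i. m \<le> of_int \<lfloor>p $ i\<rfloor> + 1 - p $ i"
  proof -
    show "m \<le> of_int \<lfloor>p $ i\<rfloor> + 1 - p $ i" for i unfolding m_def by (rule Min_le) auto
    have "0 < of_int \<lfloor>p $ i\<rfloor> + 1 - p $ i" for i by linarith
    then show "0 < m" unfolding m_def by (subst Min_gr_iff) auto
  qed
  define n where "n = norm ((\<chi> i. 1) :: real ^ 'n)"
  have n: "0 < n" unfolding n_def by (simp add: vec_eq_iff)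
  define d where "d = min (m / 2) (e / (2 * n))"
  have d: "0 < d" "d < m" "d * n < e" using m n assms by (auto simp: d_def min_def field_simps)
  define q where "q = p + d *\<^sub>R (\<chi> i. 1)"
  have "dist q p = d * n" using d by (simp add: q_def dist_norm n_def)
  moreover have "a = (\<chi> i. \<lfloor>p $ i\<rfloor>)" if "q \<in> unit_cell a" for a
  proof -
    have "a $ i = \<lfloor>p $ i\<rfloor>" for i
    proof -
      have "real_of_int (a $ i) \<le> p $ i + d" "p $ i + d \<le> real_of_int (a $ i) + 1"
        using that by (auto simp: unit_cell_def q_def)
      moreover have "p $ i + d < of_int \<lfloor>p $ i\<rfloor> + 1" using m(2)[of i] d by linarith
      moreover have "of_int \<lfloor>p $ i\<rfloor> < p $ i + d" using d by linarith
      ultimately show ?thesis by linarith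
    qed
    then show ?thesis by (simp add: vec_eq_iff)
  qed
  ultimately show ?thesis using d by (intro exI[of _ q]) auto
qed

text \<open>A common cube brings its whole interior along. Conversely, near a common interior point
  there is a point in a single cell, which must belong to both families.\<close>

lemma interior_cubes_disjoint: "interior (cubes w X) \<inter> interior (cubes w Y) = {} \<longleftrightarrow> X \<inter> Y = {}"
proof
  assume int: "interior (cubes w X) \<inter> interior (cubes w Y) = {}"
  show "X \<inter> Y = {}"
  proof (rule ccontr)
    assume "X \<inter> Y \<noteq> {}"
    then obtain c where c: "c \<in> X" "c \<in> Y" by blast
    then have "interior (unit_cell (cube w c)) \<subseteq> interior (cubes w X) \<inter> interior (cubes w Y)"
      unfolding cubes_def by (intro Int_greatest interior_mono) auto
    then have "interior (unit_cell (cube w c)) = {}" using int by blast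
    moreover have "cell_center (cube w c) \<in> interior (unit_cell (cube w c))"
      unfolding unit_cell_cbox interior_cbox by (auto simp: mem_box_cart cell_center_def)
    ultimately show False by simp
  qed
next
  assume XY: "X \<inter> Y = {}"
  show "interior (cubes w X) \<inter> interior (cubes w Y) = {}"
  proof (rule ccontr)
    assume "interior (cubes w X) \<inter> interior (cubes w Y) \<noteq> {}"
    then obtain p where p: "p \<in> interior (cubes w X) \<inter> interior (cubes w Y)" by blast
    moreover have "open (interior (cubes w X) \<inter> interior (cubes w Y))" by auto
    ultimately obtain e where e: "e > 0" "\<And>q. dist q p < e \<Longrightarrow> q \<in> interior (cubes w X) \<inter> interior (cubes w Y)"
      unfolding open_dist by blast
    obtain q where q: "dist q p < e" "\<And>a b. q \<in> unit_cell a \<Longrightarrow> q \<in> unit_cell b \<Longrightarrow> a = b"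
      using single_cell_nearby[OF e(1), of p] by auto
    have "q \<in> cubes w X" "q \<in> cubes w Y" using e(2)[OF q(1)] interior_subset by blast+
    then obtain c d where "c \<in> X" "q \<in> unit_cell (cube w c)" "d \<in> Y" "q \<in> unit_cell (cube w d)"
      unfolding cubes_def by (elim UN_E)
    moreover from this have "c = d" using q(2)[of "cube w c" "cube w d"] by simp
    ultimately show False using XY by blast
  qed
qed

section \<open>Combinatorial dominoes and their bodies\<close>

datatype dom = H "cell set" nat | V cell nat

fun cells :: "dom \<Rightarrow> (cell \<times> nat) set" where
  "cells (H h k) = h \<times> {k}"
| "cells (V s k) = {(s, k), (s, Suc k)}"

definition body :: "bool \<Rightarrow> dom \<Rightarrow> (real ^ 3) set" where
  "body w d = cubes w (cells d)"

fun good :: "dom \<Rightarrow> bool" where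
  "good (H h k) \<longleftrightarrow> is_dom h"
| "good (V s k) \<longleftrightarrow> True"

lemma cells_eq: "good d \<Longrightarrow> good e \<Longrightarrow> cells d = cells e \<Longrightarrow> d = e"
proof (cases d; cases e)
  fix h k h' k' assume "good d" "good e" "cells d = cells e" "d = H h k" "e = H h' k'"
  then show "d = e" using is_dom_nonempty by (auto simp: times_eq_iff)
next
  fix h k s j assume a: "good d" "good e" "cells d = cells e" "d = H h k" "e = V s j"
  then have "(s, j) \<in> h \<times> {k}" "(s, Suc j) \<in> h \<times> {k}" by auto
  then show "d = e" by simp
next
  fix h k s j assume a: "good d" "good e" "cells d = cells e" "e = H h k" "d = V s j"
  then have "(s, j) \<in> h \<times> {k}" "(s, Suc j) \<in> h \<times> {k}" by auto
  then show "d = e" by simp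
next
  fix s j s' j' assume "good d" "good e" "cells d = cells e" "d = V s j" "e = V s' j'"
  then show "d = e" by (auto simp: doubleton_eq_iff)
qed

lemma body_eq: "good d \<Longrightarrow> good e \<Longrightarrow> body w d = body w e \<longleftrightarrow> d = e"
  using cells_eq by (auto simp: body_def cubes_eq)

lemma inj_body: "inj_on (body w) {d. good d}"
  by (auto simp: inj_on_def body_eq)

lemma body_H: "body w (H {c, d} k) = unit_cell (cube w (c, k)) \<union> unit_cell (cube w (d, k))"
  by (auto simp: body_def cubes_def)

lemma body_V: "body w (V s k) = unit_cell (cube w (s, k)) \<union> unit_cell (cube w (s, Suc k))"
  by (auto simp: body_def cubes_def)

lemma body_V_axis: "body w (V s k) = unit_cell (cube w (s, k)) \<union> unit_cell (cube w (s, k) + axis 3 1)"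
  by (simp add: body_V cube_axis)

lemma domino_body: "good d \<Longrightarrow> domino (body w d)"
proof (cases d)
  case (H h k)
  assume "good d"
  then have "is_dom h" using H by simp
  then show ?thesis
  proof (cases rule: is_dom_cases)
    case (hor x y)
    have "body w d = unit_cell (cube w ((x, y), k)) \<union> unit_cell (cube w ((x, y), k) + axis (ax w) 1)"
      unfolding H hor body_H cube_axis ..
    then show ?thesis unfolding domino_def by blast
  next
    case (ver x y)
    have "body w d = unit_cell (cube w ((x, y), k)) \<union> unit_cell (cube w ((x, y), k) + axis (ay w) 1)"
      unfolding H ver body_H cube_axis ..
    then show ?thesis unfolding domino_def by blast
  qed
next
  case (V s k)
  then show ?thesis unfolding domino_def by (metis body_V_axis)
qed

lemma domino_is_body:
  assumes "0 \<le> a $ 3"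
  shows "\<exists>d. good d \<and> unit_cell a \<union> unit_cell (a + axis i 1) = body w d"
proof -
  obtain s k where a: "a = cube w (s, k)" using cube_surj[OF assms] by (metis surj_pair)
  obtain x y where s: "s = (x, y)" by (cases s)
  show ?thesis
  proof (cases rule: axis_cases[of i w])
    case 1
    have "unit_cell a \<union> unit_cell (a + axis i 1) = body w (H {(x, y), (x + 1, y)} k)"
      unfolding a s 1 cube_axis body_H ..
    then show ?thesis using is_dom_hor by (intro exI[of _ "H {(x, y), (x + 1, y)} k"]) simp
  next
    case 2
    have "unit_cell a \<union> unit_cell (a + axis i 1) = body w (H {(x, y), (x, y + 1)} k)"
      unfolding a s 2 cube_axis body_H ..
    then show ?thesis using is_dom_ver by (intro exI[of _ "H {(x, y), (x, y + 1)} k"]) simp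
  next
    case 3
    then show ?thesis unfolding a by (metis body_V_axis good.simps(2))
  qed
qed

lemma body_vertical: "good d \<Longrightarrow> vertical_domino (body w d) \<longleftrightarrow> (\<exists>s k. d = V s k)"
proof
  assume g: "good d" and "vertical_domino (body w d)"
  then obtain a where a: "body w d = unit_cell a \<union> unit_cell (a + axis 3 1)"
    by (auto simp: vertical_domino_def)
  have "unit_cell a \<subseteq> (\<Union>b\<in>cube w ` cells d. unit_cell b)"
    using a by (auto simp: body_def cubes_def)
  then have "a \<in> cube w ` cells d" by (simp only: unit_cell_subset_UN)
  then obtain c where "a = cube w c" by auto
  then obtain s k where "a = cube w (s, k)" by (metis surj_pair)
  then have "body w d = body w (V s k)" using a by (simp add: body_V_axis)
  then show "\<exists>s k. d = V s k" using body_eq[of d "V s k"] g by auto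
next
  assume "\<exists>s k. d = V s k"
  then show "vertical_domino (body w d)" unfolding vertical_domino_def by (metis body_V_axis)
qed

lemma unit_cell_slab:
  assumes "quadriculated_disk D"
  shows "unit_cell a \<subseteq> slab D 0 (real N) \<longleftrightarrow> (\<exists>c\<in>squares w D \<times> {..<N}. a = cube w c)"
proof
  assume sub: "unit_cell a \<subseteq> slab D 0 (real N)"
  have "cell_center a \<in> slab D 0 (real N)" using sub center_in_unit_cell[of a a] by auto
  then have z: "0 \<le> real_of_int (a $ 3) + 1 / 2" "real_of_int (a $ 3) + 1 / 2 \<le> real N"
    and D: "(vector [cell_center a $ 1, cell_center a $ 2] :: real ^ 2) \<in> D"
    by (auto simp: slab_def cell_center_def)
  have "0 \<le> a $ 3" "a $ 3 < int N" using z by linarith+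
  obtain s k where a: "a = cube w (s, k)" using cube_surj[OF \<open>0 \<le> a $ 3\<close>] by (metis surj_pair)
  have "(vector [cell_center a $ 1, cell_center a $ 2] :: real ^ 2) = cell_center (square w s)"
    unfolding a by (cases w) (auto simp: vec_eq_iff forall_2 cell_center_def square_def cube_def ax_def ay_def)
  then have "s \<in> squares w D" using D center_in_disk[OF assms] by simp
  then show "\<exists>c\<in>squares w D \<times> {..<N}. a = cube w c" using a \<open>a $ 3 < int N\<close> by auto
next
  assume "\<exists>c\<in>squares w D \<times> {..<N}. a = cube w c"
  then obtain s k where a: "a = cube w (s, k)" "s \<in> squares w D" "k < N" by auto
  show "unit_cell a \<subseteq> slab D 0 (real N)"
  proof
    fix p assume p: "p \<in> unit_cell a"
    then have "(vector [p $ 1, p $ 2] :: real ^ 2) \<in> unit_cell (square w s)"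
      unfolding a in_unit_cube in_square by (cases w) (auto simp: xc_def yc_def ax_def ay_def)
    then have "(vector [p $ 1, p $ 2] :: real ^ 2) \<in> D" using a(2) by (auto simp: squares_def)
    then show "p \<in> slab D 0 (real N)" using p a unfolding a in_unit_cube slab_def by auto
  qed
qed

lemma cylinder_cubes:
  assumes "quadriculated_disk D"
  shows "cylinder D N = cubes w (squares w D \<times> {..<N})"
  unfolding cylinder_def cubes_def unit_cell_slab[OF assms, of _ N w] by auto

fun lift :: "nat \<Rightarrow> dom \<Rightarrow> dom" where
  "lift n (H h k) = H h (k + n)"
| "lift n (V s k) = V s (k + n)"

lemma lift_image:
  "H h k \<in> lift n ` T \<longleftrightarrow> n \<le> k \<and> H h (k - n) \<in> T"
  "V s k \<in> lift n ` T \<longleftrightarrow> n \<le> k \<and> V s (k - n) \<in> T"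
proof -
  have inv: "n \<le> k \<and> H h (k - n) = d" if "lift n d = H h k" for d
    using that by (cases d) auto
  have "H h k \<in> lift n ` T" if "n \<le> k" "H h (k - n) \<in> T"
    using that by (intro image_eqI[of _ _ "H h (k - n)"]) auto
  then show "H h k \<in> lift n ` T \<longleftrightarrow> n \<le> k \<and> H h (k - n) \<in> T"
    using inv by (metis imageE)
  have inv: "n \<le> k \<and> V s (k - n) = d" if "lift n d = V s k" for d
    using that by (cases d) auto
  have "V s k \<in> lift n ` T" if "n \<le> k" "V s (k - n) \<in> T"
    using that by (intro image_eqI[of _ _ "V s (k - n)"]) auto
  then show "V s k \<in> lift n ` T \<longleftrightarrow> n \<le> k \<and> V s (k - n) \<in> T"
    using inv by (metis imageE)
qed

lemma body_lift: "body w (lift n d) = (+) (axis 3 (real n)) ` body w d"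
proof -
  have shift: "(+) (axis 3 (real n)) ` unit_cell (cube w (s, k)) = unit_cell (cube w (s, k + n))" for s k
  proof (intro equalityI subsetI)
    fix p assume "p \<in> (+) (axis 3 (real n)) ` unit_cell (cube w (s, k))"
    then show "p \<in> unit_cell (cube w (s, k + n))" by (auto simp: in_unit_cube axis_def)
  next
    fix p assume "p \<in> unit_cell (cube w (s, k + n))"
    then have "p - axis 3 (real n) \<in> unit_cell (cube w (s, k))" by (auto simp: in_unit_cube axis_def)
    then show "p \<in> (+) (axis 3 (real n)) ` unit_cell (cube w (s, k))" by (rule rev_image_eqI) simp
  qed
  have UN: "(+) (axis 3 (real n)) ` body w d = (\<Union>c\<in>cells d. unit_cell (cube w (fst c, snd c + n)))"
    unfolding body_def cubes_def image_UN by (rule SUP_cong) (simp_all add: shift[symmetric])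
  show ?thesis unfolding UN by (cases d) (auto simp: body_def cubes_def)
qed


section \<open>Tilings as sequences of floors\<close>

context region
begin

text \<open>\<open>H h k\<close> lies in the floor at height \<open>k\<close>, counted from 0, and \<open>V s k\<close> occupies the cell \<open>s\<close> at the
  heights \<open>k\<close> and \<open>k + 1\<close>.\<close>

definition layout :: "cell set set list \<Rightarrow> dom set" where
  "layout fs = {H h k | h k. k < length fs \<and> h \<in> fs ! k}
    \<union> {V s k | s k. k < length fs \<and> s \<in> plug {} (take (Suc k) fs)}"

lemma H_layout [simp]: "H h k \<in> layout fs \<longleftrightarrow> k < length fs \<and> h \<in> fs ! k"
  and V_layout [simp]: "V s k \<in> layout fs \<longleftrightarrow> k < length fs \<and> s \<in> plug {} (take (Suc k) fs)"
  by (auto simp: layout_def simp del: split_paired_Ex)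

lemma plug_take_Suc: "k < length fs \<Longrightarrow> plug p (take (Suc k) fs) = nxt (plug p (take k fs)) (fs ! k)"
  by (simp add: take_Suc_conv_app_nth)

lemma walk_nth_iff:
  "walk p fs q \<longleftrightarrow> (\<forall>k<length fs. fs ! k \<in> matchings \<and> \<Union>(fs ! k) \<inter> plug p (take k fs) = {}) \<and> plug p fs = q"
proof (induction fs arbitrary: p)
  case (Cons f fs)
  have "(\<forall>k<length (f # fs). (f # fs) ! k \<in> matchings \<and> \<Union>((f # fs) ! k) \<inter> plug p (take k (f # fs)) = {})
    \<longleftrightarrow> (f \<in> matchings \<and> \<Union>f \<inter> p = {}) \<and>
      (\<forall>k<length fs. fs ! k \<in> matchings \<and> \<Union>(fs ! k) \<inter> plug (nxt p f) (take k fs) = {})"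
    unfolding length_Cons All_less_Suc2 by simp
  then show ?case using Cons.IH[of "nxt p f"] by auto
qed simp

text \<open>A floor is split into the cells covered from below, the dominoes of the floor, and the
  cells covered from above.\<close>

lemma walk_layout:
  assumes w: "walk {} fs {}"
  shows "\<And>d. d \<in> layout fs \<Longrightarrow> good d"
    and "pairwise (\<lambda>d e. cells d \<inter> cells e = {}) (layout fs)"
    and "(\<Union>d\<in>layout fs. cells d) = S \<times> {..<length fs}"
proof -
  let ?P = "\<lambda>k. plug {} (take k fs)" and ?n = "length fs"
  have f: "fs ! k \<in> matchings" "\<Union>(fs ! k) \<inter> ?P k = {}" if "k < ?n" for k
    using w that by (auto simp: walk_nth_iff)
  have step: "?P (Suc k) = S - ?P k - \<Union>(fs ! k)" if "k < ?n" for k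
    using plug_take_Suc[OF that] by (simp add: nxt_def)
  have top: "?P ?n = {}" using walk_plug[OF w] by simp
  have sub: "?P k \<subseteq> S" for k by (rule plug_subset) simp
  show "good d" if "d \<in> layout fs" for d
    using that f(1) by (cases d) (auto simp: matchings_def)
  show "pairwise (\<lambda>d e. cells d \<inter> cells e = {}) (layout fs)"
  proof (rule pairwiseI)
    have HV: "cells (H h k) \<inter> cells (V s j) = {}" if "H h k \<in> layout fs" "V s j \<in> layout fs" for h k s j
    proof -
      have k: "k < ?n" "h \<in> fs ! k" and j: "j < ?n" "s \<in> ?P (Suc j)" using that by auto
      have "s \<notin> h" if "k = j" using step[OF k(1)] j(2) k(2) that by auto
      moreover have "s \<notin> h" if "k = Suc j" using f(2)[OF k(1)] j(2) k(2) that by auto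
      ultimately show ?thesis by auto
    qed
    fix d e assume d: "d \<in> layout fs" and e: "e \<in> layout fs" and ne: "d \<noteq> e"
    show "cells d \<inter> cells e = {}"
    proof (cases d; cases e)
      fix h k h' k' assume de: "d = H h k" "e = H h' k'"
      have "h \<inter> h' = {}" if "k = k'"
        using d e ne f(1)[of k] that unfolding de matchings_def pairwise_def disjnt_def by auto
      then show ?thesis unfolding de by auto
    next
      fix h k s j assume "d = H h k" "e = V s j"
      then show ?thesis using HV d e by blast
    next
      fix h k s j assume "d = V s j" "e = H h k"
      then show ?thesis using HV d e by blast
    next
      fix s j s' j' assume de: "d = V s j" "e = V s' j'"
      have no: "s \<notin> ?P (Suc (Suc j))" if "s \<in> ?P (Suc j)" "Suc j < ?n" for s j using step[OF that(2)] that(1) by auto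
      show ?thesis using d e ne no[of s j] no[of s' j'] unfolding de by auto
    qed
  qed
  show "(\<Union>d\<in>layout fs. cells d) = S \<times> {..<?n}"
  proof (intro equalityI subsetI)
    fix c assume "c \<in> (\<Union>d\<in>layout fs. cells d)"
    then obtain d where d: "d \<in> layout fs" "c \<in> cells d" by blast
    show "c \<in> S \<times> {..<?n}"
    proof (cases d)
      case (H h k)
      then show ?thesis using d f(1)[of k] by (auto simp: matchings_def)
    next
      case (V s k)
      then have k: "k < ?n" "s \<in> ?P (Suc k)" using d by auto
      then have "Suc k \<noteq> ?n" using top by auto
      then show ?thesis using k d sub[of "Suc k"] unfolding V by auto
    qed
  next
    fix c assume "c \<in> S \<times> {..<?n}"
    then obtain s k where c: "c = (s, k)" "s \<in> S" "k < ?n" by auto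
    consider "s \<in> ?P k" | "s \<in> \<Union>(fs ! k)" | "s \<in> ?P (Suc k)" using step[OF c(3)] c(2) by blast
    then show "c \<in> (\<Union>d\<in>layout fs. cells d)"
    proof cases
      case 1
      then obtain j where "k = Suc j" by (cases k) auto
      then have "V s j \<in> layout fs" "c \<in> cells (V s j)" using 1 c by auto
      then show ?thesis by blast
    next
      case 2
      then obtain h where "h \<in> fs ! k" "s \<in> h" by blast
      then have "H h k \<in> layout fs" "c \<in> cells (H h k)" using c by auto
      then show ?thesis by blast
    next
      case 3
      then have "V s k \<in> layout fs" "c \<in> cells (V s k)" using c by auto
      then show ?thesis by blast
    qed
  qed
qed

text \<open>Floors and plugs are read off from \<open>T\<close>. The point is that iterating
  \<open>nxt\<close> reproduces these plugs, because each cell of a floor is covered exactly once: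
  from below, in the floor, or from above.\<close>

lemma layout_exists:
  assumes good: "\<And>d. d \<in> T \<Longrightarrow> good d"
    and disj: "pairwise (\<lambda>d e. cells d \<inter> cells e = {}) T"
    and cover: "(\<Union>d\<in>T. cells d) = S \<times> {..<n}"
  obtains fs where "walk {} fs {}" "length fs = n" "T = layout fs"
proof -
  define F where "F k = {h. H h k \<in> T}" for k
  define Q where "Q k = {s. V s k \<in> T}" for k
  define fs where "fs = map F [0..<n]"
  have cell: "c \<in> S \<times> {..<n}" if "d \<in> T" "c \<in> cells d" for d c using cover that by blast
  have uniq: "d = e" if "d \<in> T" "e \<in> T" "c \<in> cells d" "c \<in> cells e" for d e c
    using disj that unfolding pairwise_def by blast
  have F: "F k \<in> matchings" for k
    unfolding matchings_def mem_Collect_eq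
  proof (intro conjI ballI pairwiseI)
    fix h assume "h \<in> F k"
    then have h: "H h k \<in> T" by (simp add: F_def)
    then show "is_dom h" using good by fastforce
    show "h \<subseteq> S" using cell[OF h] by auto
  next
    fix h h' assume "h \<in> F k" "h' \<in> F k" "h \<noteq> h'"
    then have "H h k \<in> T" "H h' k \<in> T" "H h k \<noteq> H h' k" by (auto simp: F_def)
    then have "cells (H h k) \<inter> cells (H h' k) = {}" using disj unfolding pairwise_def by blast
    then show "disjnt h h'" by (auto simp: disjnt_def)
  qed
  have FQ: "\<Union>(F k) \<inter> Q k = {}" for k
    using uniq[of "H _ k" "V _ k"] unfolding F_def Q_def by fastforce
  have FQ': "\<Union>(F (Suc k)) \<inter> Q k = {}" for k
    using uniq[of "H _ (Suc k)" "V _ k"] unfolding F_def Q_def by fastforce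
  have QQ: "Q k \<inter> Q (Suc k) = {}" for k
  proof -
    have False if "V s k \<in> T" "V s (Suc k) \<in> T" for s
      using uniq[OF that, of "(s, Suc k)"] by simp
    then show ?thesis by (auto simp: Q_def)
  qed
  have QS: "Q k \<subseteq> S" "F k \<in> matchings" for k
  proof -
    show "Q k \<subseteq> S" using cell[of "V _ k" "(_, k)"] by (force simp: Q_def)
  qed (rule F)
  have covered: "s \<in> \<Union>(F k) \<or> s \<in> Q k \<or> (k \<noteq> 0 \<and> s \<in> Q (k - 1))" if "s \<in> S" "k < n" for s k
  proof -
    have "(s, k) \<in> (\<Union>d\<in>T. cells d)" using cover that by simp
    then obtain d where "d \<in> T" "(s, k) \<in> cells d" by blast
    then show ?thesis by (cases d) (auto simp: F_def Q_def)
  qed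
  have P: "plug {} (take (Suc k) fs) = Q k" if "k < n" for k
    using that
  proof (induction k)
    case 0
    then have e: "plug {} (take (Suc 0) fs) = S - \<Union>(F 0)"
      using plug_take_Suc[of 0 fs "{}"] by (simp add: fs_def nxt_def)
    have "S \<subseteq> \<Union>(F 0) \<union> Q 0" using covered[OF _ 0] by blast
    then show ?case unfolding e using FQ[of 0] QS(1)[of 0] by blast
  next
    case (Suc k)
    then have IH: "plug {} (take (Suc k) fs) = Q k" by simp
    have e: "plug {} (take (Suc (Suc k)) fs) = S - Q k - \<Union>(F (Suc k))"
      using plug_take_Suc[of "Suc k" fs "{}"] Suc.prems IH by (simp add: fs_def nxt_def)
    have "S \<subseteq> \<Union>(F (Suc k)) \<union> Q (Suc k) \<union> Q k" using covered[OF _ Suc.prems] by auto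
    then show ?case unfolding e using FQ[of "Suc k"] QS(1)[of "Suc k"] QQ[of k] by blast
  qed
  have "walk {} fs {}"
    unfolding walk_nth_iff
  proof (intro conjI allI impI)
    fix k assume k: "k < length fs"
    then show "fs ! k \<in> matchings" using F by (simp add: fs_def)
    show "\<Union>(fs ! k) \<inter> plug {} (take k fs) = {}"
    proof (cases k)
      case (Suc j)
      then have "plug {} (take k fs) = Q j" using P[of j] k by (simp add: fs_def)
      then show ?thesis using FQ'[of j] k Suc by (simp add: fs_def)
    qed simp
  next
    show "plug {} fs = {}"
    proof (cases n)
      case 0
      then show ?thesis by (simp add: fs_def)
    next
      case (Suc m)
      \<comment> \<open>A vertical domino starting in the top floor would leave the region.\<close>
      have "Q m = {}"
      proof (rule ccontr)
        assume "Q m \<noteq> {}"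
        then obtain s where "V s m \<in> T" by (auto simp: Q_def)
        from cell[OF this, of "(s, Suc m)"] show False using Suc by simp
      qed
      then show ?thesis using P[of m] Suc by (simp add: fs_def)
    qed
  qed
  moreover have "T = layout fs"
  proof (intro set_eqI)
    fix d
    show "d \<in> T \<longleftrightarrow> d \<in> layout fs"
    proof (cases d)
      case (H h k)
      have "k < n" if "H h k \<in> T"
        using cell[OF that] is_dom_nonempty good[OF that] by force
      then show ?thesis by (auto simp: H fs_def F_def)
    next
      case (V s k)
      have "k < n" if "V s k \<in> T" using cell[OF that, of "(s, k)"] by simp
      then show ?thesis using P[of k] by (auto simp: V fs_def Q_def)
    qed
  qed
  ultimately show thesis using that[of fs] by (simp add: fs_def)
qed

lemma layout_inj:
  assumes "layout fs = layout gs" "length fs = length gs"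
  shows "fs = gs"
proof (rule nth_equalityI[OF assms(2)])
  fix k assume k: "k < length fs"
  have "h \<in> fs ! k \<longleftrightarrow> h \<in> gs ! k" for h
    using assms k H_layout[of h k fs] H_layout[of h k gs] by simp
  then show "fs ! k = gs ! k" by blast
qed

text \<open>The walk \<open>xs\<close> ends with the empty plug, so the plugs above it are those of
  \<open>ys\<close> alone.\<close>

lemma layout_append:
  assumes "walk {} xs {}"
  shows "layout (xs @ ys) = layout xs \<union> lift (length xs) ` layout ys"
proof (rule set_eqI)
  fix d
  have p: "plug {} xs = {}" using walk_plug[OF assms] .
  show "d \<in> layout (xs @ ys) \<longleftrightarrow> d \<in> layout xs \<union> lift (length xs) ` layout ys"
  proof (cases d)
    case (H h k)
    show ?thesis unfolding H Un_iff lift_image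
      by (auto simp: nth_append)
  next
    case (V s k)
    have "plug {} (take (Suc k) (xs @ ys)) = (if k < length xs then plug {} (take (Suc k) xs) else plug {} (take (Suc (k - length xs)) ys))"
      using p by (auto simp: Suc_diff_le)
    then show ?thesis unfolding V Un_iff lift_image by auto
  qed
qed

lemma layout_empty_floors:
  "layout (replicate n {}) = {V s k | s k. k < n \<and> even k \<and> s \<in> S}"
proof -
  have "plug {} (replicate m {}) = (if even m then {} else S)" for m
  proof (induction m)
    case (Suc m)
    have "replicate (Suc m) ({} :: cell set set) = replicate m {} @ [{}]" by (simp add: replicate_append_same)
    then show ?case using Suc by (auto simp: nxt_def simp del: replicate_Suc)
  qed simp
  then have p: "plug {} (take (Suc k) (replicate n {})) = (if odd k then {} else S)" if "k < n" for k
    using that by (simp add: min_absorb1 del: replicate_Suc)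
  show ?thesis
  proof (rule set_eqI)
    fix d show "d \<in> layout (replicate n {}) \<longleftrightarrow> d \<in> {V s k | s k. k < n \<and> even k \<and> s \<in> S}"
      by (cases d) (use p in \<open>auto split: if_splits\<close>)
  qed
qed

text \<open>The two lists have the same plugs except for the one between the floors \<open>k\<close>
  and \<open>Suc k\<close>, which differs by \<open>h\<close>; this accounts for the vertical
  dominoes.\<close>

lemma layout_vertical_flip:
  fixes h f f' xs ys
  defines "A \<equiv> xs @ [insert h f, insert h f'] @ ys" and "B \<equiv> xs @ [f, f'] @ ys" and "k \<equiv> length xs"
  assumes h: "h \<notin> f" "h \<notin> f'" and w: "walk {} A {}"
  shows "walk {} B {}" "Gs {} A = Gs {} B"
    "layout B = layout A - {H h k, H h (Suc k)} \<union> (\<lambda>s. V s k) ` h"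
    "layout A = layout B - (\<lambda>s. V s k) ` h \<union> {H h k, H h (Suc k)}"
proof -
  define p where "p = plug {} xs"
  have pS: "p \<subseteq> S" unfolding p_def by (rule plug_subset) simp
  have wA: "walk {} xs p" "insert h f \<in> matchings" "\<Union>(insert h f) \<inter> p = {}" "insert h f' \<in> matchings"
    "\<Union>(insert h f') \<inter> nxt p (insert h f) = {}" "walk (nxt (nxt p (insert h f)) (insert h f')) ys {}"
    using w unfolding A_def by (auto simp: walk_append p_def)
  note G = G_vertical_flip[OF wA(2) h(1) wA(4) h(2) pS wA(3) refl wA(5)]
  have f: "f \<in> matchings" "f' \<in> matchings" "h \<inter> \<Union>f = {}" "h \<inter> \<Union>f' = {}"
    using wA(2,4) h by (auto simp: matchings_insert)
  have "\<Union>f' \<inter> nxt p f = {}" unfolding G(2) using wA(5) f by auto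
  then show wB: "walk {} B {}"
    unfolding B_def using wA f G(3) by (auto simp: walk_append p_def)
  show "Gs {} A = Gs {} B"
    unfolding A_def B_def Gs_append p_def[symmetric] using G by (simp add: Gs_append)
  have len: "length A = length B" by (simp add: A_def B_def)
  have nth: "A ! j = (if j = k then insert h f else if j = Suc k then insert h f' else B ! j)" for j
    by (auto simp: A_def B_def k_def nth_append nth_Cons split: nat.splits)
  have Bk: "B ! k = f" "B ! Suc k = f'" by (simp_all add: B_def k_def nth_append)
  have plugs: "plug {} (take (Suc j) A) = (if j = k then nxt p (insert h f) else plug {} (take (Suc j) B))" for j
  proof -
    consider "Suc j \<le> k" | "j = k" | m where "j = Suc k + m" by (metis Suc_leI add_Suc less_imp_Suc_add linorder_neqE_nat)
    then show ?thesis
    proof cases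
      case 3
      then have "take (Suc j) A = xs @ [insert h f, insert h f'] @ take m ys"
        "take (Suc j) B = xs @ [f, f'] @ take m ys" by (auto simp: A_def B_def k_def)
      then show ?thesis using 3 G(3) by (simp add: p_def[symmetric])
    qed (auto simp: A_def B_def k_def p_def)
  qed
  have plugBk: "plug {} (take (Suc k) B) = nxt p (insert h f) \<union> h"
    using G(2) by (simp add: B_def k_def p_def)
  have hn: "h \<inter> nxt p (insert h f) = {}" by (auto simp: nxt_def)
  have kl: "k < length B" "Suc k < length B" by (auto simp: B_def k_def)
  have Hs: "H g j \<in> layout A \<longleftrightarrow> H g j \<in> layout B \<or> g = h \<and> (j = k \<or> j = Suc k)" for g j
    using kl Bk len nth[of j] by auto
  have Hn: "H h k \<notin> layout B" "H h (Suc k) \<notin> layout B" using h Bk by auto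
  have Vs: "V s j \<in> layout B \<longleftrightarrow> V s j \<in> layout A \<or> j = k \<and> s \<in> h" for s j
    using kl len plugs[of j] plugBk by auto
  have Vn: "V s k \<notin> layout A" if "s \<in> h" for s using hn that plugs[of k] by auto
  show "layout B = layout A - {H h k, H h (Suc k)} \<union> (\<lambda>s. V s k) ` h"
  proof (rule set_eqI)
    fix d show "d \<in> layout B \<longleftrightarrow> d \<in> layout A - {H h k, H h (Suc k)} \<union> (\<lambda>s. V s k) ` h"
      using Hs Hn Vs by (cases d) (auto simp del: H_layout V_layout)
  qed
  show "layout A = layout B - (\<lambda>s. V s k) ` h \<union> {H h k, H h (Suc k)}"
  proof (rule set_eqI)
    fix d show "d \<in> layout A \<longleftrightarrow> d \<in> layout B - (\<lambda>s. V s k) ` h \<union> {H h k, H h (Suc k)}"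
      using Hs Vs Vn by (cases d) (auto simp del: H_layout V_layout)
  qed
qed

text \<open>Cells covered by vertical dominoes between the two floors are free of horizontal ones in
  both, so \<open>h\<close> can be laid there twice.\<close>

lemma walk_vertical_flip:
  fixes h f f' xs ys
  assumes w: "walk {} (xs @ [f, f'] @ ys) {}" and h: "is_dom h" "h \<subseteq> plug {} (xs @ [f])"
  shows "walk {} (xs @ [insert h f, insert h f'] @ ys) {}" "h \<notin> f" "h \<notin> f'"
proof -
  define p where "p = plug {} xs"
  have pS: "p \<subseteq> S" unfolding p_def by (rule plug_subset) simp
  have wB: "walk {} xs p" "f \<in> matchings" "\<Union>f \<inter> p = {}" "f' \<in> matchings"
    "\<Union>f' \<inter> nxt p f = {}" "walk (nxt (nxt p f) f') ys {}"
    using w by (auto simp: walk_append p_def)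
  have hp: "h \<subseteq> nxt p f" using h(2) by (simp add: p_def)
  then have d: "h \<subseteq> S" "h \<inter> p = {}" "h \<inter> \<Union>f = {}" "h \<inter> \<Union>f' = {}"
    using wB(5) unfolding nxt_def by blast+
  show hn: "h \<notin> f" "h \<notin> f'" using d is_dom_nonempty[OF h(1)] by auto
  have m: "insert h f \<in> matchings" "insert h f' \<in> matchings"
    using matchings_insert[OF hn(1)] matchings_insert[OF hn(2)] wB h(1) d by auto
  have "nxt p (insert h f) \<subseteq> nxt p f" "h \<inter> nxt p (insert h f) = {}" by (auto simp: nxt_def)
  then have q: "\<Union>(insert h f') \<inter> nxt p (insert h f) = {}" using wB(5) by auto
  have "nxt (nxt p (insert h f)) (insert h f') = nxt (nxt p f) f'"
  proof -
    have "\<Union>(insert h f) \<inter> p = {}" using d wB(3) by auto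
    from G_vertical_flip(3)[OF m(1) hn(1) m(2) hn(2) pS this refl q] show ?thesis ..
  qed
  then show "walk {} (xs @ [insert h f, insert h f'] @ ys) {}"
    using wB m q d by (auto simp: walk_append p_def)
qed

lemma layout_horizontal_flip:
  fixes f xs ys h1 h2 k1 k2
  defines "A \<equiv> xs @ [insert h1 (insert h2 f)] @ ys" and "B \<equiv> xs @ [insert k1 (insert k2 f)] @ ys"
    and "k \<equiv> length xs"
  assumes n: "h1 \<notin> f" "h2 \<notin> f" "k1 \<notin> f" "k2 \<notin> f" "h1 \<notin> {k1, k2}" "h2 \<notin> {k1, k2}"
    and U: "h1 \<union> h2 = k1 \<union> k2"
  shows "layout B = layout A - {H h1 k, H h2 k} \<union> {H k1 k, H k2 k}"
proof (rule set_eqI)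
  have len: "length A = length B" by (simp add: A_def B_def)
  have nth: "A ! j = (if j = k then insert h1 (insert h2 f) else B ! j)" for j
    by (auto simp: A_def B_def k_def nth_append nth_Cons split: nat.splits)
  have Bk: "B ! k = insert k1 (insert k2 f)" by (simp add: B_def k_def nth_append)
  have "nxt p (insert h1 (insert h2 f)) = nxt p (insert k1 (insert k2 f))" for p
    using U by (auto simp: nxt_def)
  then have plugs: "plug {} (take j A) = plug {} (take j B)" for j
    by (cases "j - length xs") (auto simp: A_def B_def)
  have kl: "k < length B" by (auto simp: B_def k_def)
  fix d show "d \<in> layout B \<longleftrightarrow> d \<in> layout A - {H h1 k, H h2 k} \<union> {H k1 k, H k2 k}"
    using len nth Bk plugs kl n by (cases d) auto
qed

end

section \<open>The effect of each kind of flip on a list of floors\<close>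

context region
begin

lemma split_two: "Suc k < length fs \<Longrightarrow> fs = take k fs @ [fs ! k, fs ! Suc k] @ drop (Suc (Suc k)) fs"
  by (metis Cons_nth_drop_Suc Suc_lessD append_Cons append_Nil append_take_drop_id)

lemma flip_up:
  assumes w: "walk {} fs {}" and V: "\<And>s. s \<in> h \<Longrightarrow> V s k \<in> layout fs" and h: "is_dom h"
  shows "\<exists>gs. walk {} gs {} \<and> length gs = length fs \<and> Gs {} gs = Gs {} fs \<and>
    layout gs = layout fs - (\<lambda>s. V s k) ` h \<union> {H h k, H h (Suc k)}"
proof -
  obtain s where s: "s \<in> h" using is_dom_nonempty[OF h] by auto
  have k: "k < length fs" using V[OF s] by simp
  have "Suc k \<noteq> length fs"
  proof
    assume "Suc k = length fs"
    then have "plug {} (take (Suc k) fs) = {}" using walk_plug[OF w] by simp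
    then show False using V[OF s] by simp
  qed
  then have k: "Suc k < length fs" using k by simp
  let ?xs = "take k fs" and ?ys = "drop (Suc (Suc k)) fs"
  note fs = split_two[OF k]
  have w': "walk {} (?xs @ [fs ! k, fs ! Suc k] @ ?ys) {}" using w fs by simp
  have "take (Suc k) fs = ?xs @ [fs ! k]" using k by (simp add: take_Suc_conv_app_nth)
  then have hp: "h \<subseteq> plug {} (?xs @ [fs ! k])" using V by auto
  note n = walk_vertical_flip[OF w' h hp]
  have len: "length ?xs = k" using k by simp
  show ?thesis
    using layout_vertical_flip[OF n(2,3,1)] n(1) fs k unfolding len
    by (intro exI[of _ "?xs @ [insert h (fs ! k), insert h (fs ! Suc k)] @ ?ys"]) simp
qed

lemma flip_down:
  assumes w: "walk {} fs {}" and H: "H h k \<in> layout fs" "H h (Suc k) \<in> layout fs"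
  shows "\<exists>gs. walk {} gs {} \<and> length gs = length fs \<and> Gs {} gs = Gs {} fs \<and>
    layout gs = layout fs - {H h k, H h (Suc k)} \<union> (\<lambda>s. V s k) ` h"
proof -
  have k: "Suc k < length fs" "h \<in> fs ! k" "h \<in> fs ! Suc k" using H by auto
  let ?xs = "take k fs" and ?ys = "drop (Suc (Suc k)) fs"
  let ?f = "fs ! k - {h}" and ?f' = "fs ! Suc k - {h}"
  have fs: "fs = ?xs @ [insert h ?f, insert h ?f'] @ ?ys"
    using split_two[OF k(1)] k(2,3) by (simp add: insert_absorb)
  have w': "walk {} (?xs @ [insert h ?f, insert h ?f'] @ ?ys) {}" using w fs by simp
  have len: "length ?xs = k" using k by simp
  have "layout (?xs @ [?f, ?f'] @ ?ys) = layout fs - {H h k, H h (Suc k)} \<union> (\<lambda>s. V s k) ` h"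
    "walk {} (?xs @ [?f, ?f'] @ ?ys) {}" "Gs {} (?xs @ [?f, ?f'] @ ?ys) = Gs {} fs"
    using layout_vertical_flip[OF _ _ w'] fs len by simp_all
  moreover have "length (?xs @ [?f, ?f'] @ ?ys) = length fs" using k(1) by simp
  ultimately show ?thesis by blast
qed

lemma matchings_swap:
  assumes a: "insert a1 (insert a2 f) \<in> matchings" "a1 \<notin> f" "a2 \<notin> f" "a1 \<noteq> a2"
    and b: "is_dom b1" "is_dom b2" "b1 \<inter> b2 = {}" "b1 \<union> b2 = a1 \<union> a2"
  shows "insert b1 (insert b2 f) \<in> matchings" "b1 \<notin> f" "b2 \<notin> f"
proof -
  have "insert a2 f \<in> matchings" "a1 \<subseteq> S" "a1 \<inter> \<Union>(insert a2 f) = {}"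
    using matchings_insert[of a1 "insert a2 f"] a by auto
  moreover from this have "f \<in> matchings" "a2 \<subseteq> S" "a2 \<inter> \<Union>f = {}"
    using matchings_insert[OF a(3)] by auto
  ultimately have f: "f \<in> matchings" "b1 \<union> b2 \<subseteq> S" "(b1 \<union> b2) \<inter> \<Union>f = {}"
    unfolding b(4) by auto
  show bf: "b1 \<notin> f" "b2 \<notin> f"
    using f(3) is_dom_nonempty[OF b(1)] is_dom_nonempty[OF b(2)] by blast+
  have "insert b2 f \<in> matchings" using matchings_insert[OF bf(2)] f b by auto
  moreover have "b1 \<notin> insert b2 f" using bf b(1,3) is_dom_nonempty by auto
  ultimately show "insert b1 (insert b2 f) \<in> matchings" using matchings_insert f b by auto
qed

text \<open>Invariance of the contribution is an assumption here, so that one argument serves both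
  directions of a flip inside a floor.\<close>

lemma flip_level:
  assumes w: "walk {} fs {}" and a: "H a1 k \<in> layout fs" "H a2 k \<in> layout fs" "a1 \<noteq> a2"
    and b: "is_dom b1" "is_dom b2" "b1 \<inter> b2 = {}" "b1 \<union> b2 = a1 \<union> a2"
    and ab: "a1 \<notin> {b1, b2}" "a2 \<notin> {b1, b2}"
    and G: "\<And>p f. insert a1 (insert a2 f) \<in> matchings \<Longrightarrow> a1 \<notin> f \<Longrightarrow> a2 \<notin> f \<Longrightarrow>
      insert b1 (insert b2 f) \<in> matchings \<Longrightarrow> b1 \<notin> f \<Longrightarrow> b2 \<notin> f \<Longrightarrow> p \<subseteq> S \<Longrightarrow>
      \<Union>(insert a1 (insert a2 f)) \<inter> p = {} \<Longrightarrow> G p (insert b1 (insert b2 f)) = G p (insert a1 (insert a2 f))"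
  shows "\<exists>gs. walk {} gs {} \<and> length gs = length fs \<and> Gs {} gs = Gs {} fs \<and>
    layout gs = layout fs - {H a1 k, H a2 k} \<union> {H b1 k, H b2 k}"
proof -
  have k: "k < length fs" "a1 \<in> fs ! k" "a2 \<in> fs ! k" using a by auto
  let ?xs = "take k fs" and ?ys = "drop (Suc k) fs" and ?f = "fs ! k - {a1, a2}"
  define p where "p = plug {} ?xs"
  have pS: "p \<subseteq> S" unfolding p_def by (rule plug_subset) simp
  have "fs ! k = insert a1 (insert a2 ?f)" using k(2,3) by auto
  then have fs: "fs = ?xs @ [insert a1 (insert a2 ?f)] @ ?ys"
    using id_take_nth_drop[OF k(1)] by simp
  let ?gs = "?xs @ [insert b1 (insert b2 ?f)] @ ?ys"
  have w': "walk {} ?xs p" "insert a1 (insert a2 ?f) \<in> matchings" "\<Union>(insert a1 (insert a2 ?f)) \<inter> p = {}"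
    "walk (nxt p (insert a1 (insert a2 ?f))) ?ys {}"
    using w by (subst (asm) fs; auto simp: walk_append p_def)+
  note m = matchings_swap[OF w'(2) _ _ a(3) b]
  have m: "insert b1 (insert b2 ?f) \<in> matchings" "b1 \<notin> ?f" "b2 \<notin> ?f" using m by auto
  have U: "\<Union>(insert b1 (insert b2 ?f)) = \<Union>(insert a1 (insert a2 ?f))"
    using b(4) by auto
  then have n: "nxt p (insert b1 (insert b2 ?f)) = nxt p (insert a1 (insert a2 ?f))"
    unfolding nxt_def by simp
  have "G p (insert b1 (insert b2 ?f)) = G p (insert a1 (insert a2 ?f))"
    by (rule G) (use w' m pS in auto)
  then have "Gs {} ?gs = Gs {} fs"
    by (subst (2) fs) (simp add: Gs_append p_def[symmetric] n)
  moreover have "walk {} ?gs {}"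
    using w' m(1) U n by (simp add: walk_append p_def[symmetric])
  moreover have len: "length ?xs = k" using k(1) by simp
  moreover have "layout ?gs = layout fs - {H a1 k, H a2 k} \<union> {H b1 k, H b2 k}"
    using layout_horizontal_flip[of a1 ?f a2 b1 b2 ?xs ?ys] ab b(4) m fs len by simp
  moreover have "length ?gs = length fs" using k(1) by simp
  ultimately show ?thesis by blast
qed

lemma flip_level_square:
  fixes x y :: int
  defines "h1 \<equiv> {(x, y), (x + 1, y)}" and "h2 \<equiv> {(x, y + 1), (x + 1, y + 1)}"
    and "k1 \<equiv> {(x, y), (x, y + 1)}" and "k2 \<equiv> {(x + 1, y), (x + 1, y + 1)}"
  assumes w: "walk {} fs {}"
  shows "H h1 k \<in> layout fs \<Longrightarrow> H h2 k \<in> layout fs \<Longrightarrow> \<exists>gs. walk {} gs {} \<and> length gs = length fs \<and>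
      Gs {} gs = Gs {} fs \<and> layout gs = layout fs - {H h1 k, H h2 k} \<union> {H k1 k, H k2 k}"
    and "H k1 k \<in> layout fs \<Longrightarrow> H k2 k \<in> layout fs \<Longrightarrow> \<exists>gs. walk {} gs {} \<and> length gs = length fs \<and>
      Gs {} gs = Gs {} fs \<and> layout gs = layout fs - {H k1 k, H k2 k} \<union> {H h1 k, H h2 k}"
proof -
  have d: "is_dom h1" "is_dom h2" "is_dom k1" "is_dom k2"
    unfolding h1_def h2_def k1_def k2_def by (rule is_dom_hor is_dom_ver)+
  have i: "h1 \<inter> h2 = {}" "k1 \<inter> k2 = {}" "k1 \<union> k2 = h1 \<union> h2"
    by (auto simp: h1_def h2_def k1_def k2_def)
  have n: "h1 \<noteq> h2" "k1 \<noteq> k2" "h1 \<noteq> k1" "h1 \<noteq> k2" "h2 \<noteq> k1" "h2 \<noteq> k2"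
    by (auto simp: h1_def h2_def k1_def k2_def doubleton_eq_iff)
  have G: "G p (insert k1 (insert k2 f)) = G p (insert h1 (insert h2 f))"
    if "insert h1 (insert h2 f) \<in> matchings" "h1 \<notin> f" "h2 \<notin> f" "p \<subseteq> S" "\<Union>(insert h1 (insert h2 f)) \<inter> p = {}" for p f
    using G_horizontal_flip(1)[OF that(1-3) h1_def[THEN meta_eq_to_obj_eq] h2_def[THEN meta_eq_to_obj_eq]
      k1_def[THEN meta_eq_to_obj_eq] k2_def[THEN meta_eq_to_obj_eq] that(4,5)] .
  show "\<exists>gs. walk {} gs {} \<and> length gs = length fs \<and>
      Gs {} gs = Gs {} fs \<and> layout gs = layout fs - {H h1 k, H h2 k} \<union> {H k1 k, H k2 k}"
    if "H h1 k \<in> layout fs" "H h2 k \<in> layout fs"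
    by (rule flip_level[OF w that n(1) d(3,4) i(2,3)]) (use n G in auto)
  show "\<exists>gs. walk {} gs {} \<and> length gs = length fs \<and>
      Gs {} gs = Gs {} fs \<and> layout gs = layout fs - {H k1 k, H k2 k} \<union> {H h1 k, H h2 k}"
    if "H k1 k \<in> layout fs" "H k2 k \<in> layout fs"
  proof (rule flip_level[OF w that n(2) d(1,2) i(1) i(3)[symmetric]])
    fix p f assume "insert h1 (insert h2 f) \<in> matchings" "h1 \<notin> f" "h2 \<notin> f" "p \<subseteq> S"
      "\<Union>(insert k1 (insert k2 f)) \<inter> p = {}"
    moreover have "\<Union>(insert k1 (insert k2 f)) = \<Union>(insert h1 (insert h2 f))" using i(3) by auto
    ultimately show "G p (insert h1 (insert h2 f)) = G p (insert k1 (insert k2 f))" using G by metis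
  qed (use n in auto)
qed

end


section \<open>The twist of a pair of dominoes\<close>

lemma domino_vector_union:
  assumes "black_cell a" "\<not> black_cell b"
  shows "domino_vector (unit_cell a \<union> unit_cell b) = cell_center a - cell_center b"
    "domino_vector (unit_cell b \<union> unit_cell a) = cell_center a - cell_center b"
proof -
  have eq: "c = a \<and> d = b" if "unit_cell a \<union> unit_cell b = unit_cell c \<union> unit_cell d"
    "black_cell c" "\<not> black_cell d" for c d
  proof -
    have "a \<in> {c, d}" "b \<in> {c, d}"
      using that(1) unit_cell_subset_UN[of a "{c, d}"] unit_cell_subset_UN[of b "{c, d}"] by auto
    then show ?thesis using assms that(2,3) by auto
  qed
  show "domino_vector (unit_cell a \<union> unit_cell b) = cell_center a - cell_center b"
    unfolding domino_vector_def
  proof (rule the_equality)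
    show "\<exists>c d. unit_cell a \<union> unit_cell b = unit_cell c \<union> unit_cell d \<and> black_cell c \<and> \<not> black_cell d
        \<and> cell_center a - cell_center b = cell_center c - cell_center d"
      using assms by blast
  next
    fix v assume "\<exists>c d. unit_cell a \<union> unit_cell b = unit_cell c \<union> unit_cell d \<and> black_cell c \<and> \<not> black_cell d
        \<and> v = cell_center c - cell_center d"
    then show "v = cell_center a - cell_center b" using eq by blast
  qed
  then show "domino_vector (unit_cell b \<union> unit_cell a) = cell_center a - cell_center b"
    by (simp add: Un_commute)
qed

lemma cell_center_add_axis: "cell_center (a + axis i 1) = cell_center a + axis i 1"
  by (simp add: vec_eq_iff cell_center_def axis_def)

lemma domino_vector_axis:
  "domino_vector (unit_cell a \<union> unit_cell (a + axis i 1)) = (if black_cell a then - axis i 1 else axis i 1)"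
proof -
  have "(\<Sum>j\<in>UNIV. (a + axis i 1) $ j) = (\<Sum>j\<in>UNIV. a $ j) + 1"
    by (simp add: sum.distrib axis_def)
  then have "black_cell (a + axis i 1) \<longleftrightarrow> \<not> black_cell a" by (simp add: black_cell_def)
  then show ?thesis
    using domino_vector_union[of a "a + axis i 1"] domino_vector_union[of "a + axis i 1" a]
    by (auto simp: cell_center_add_axis)
qed

definition sgn_at :: "cell \<Rightarrow> nat \<Rightarrow> real" where
  "sgn_at s k = of_int (chi s) * (- 1) ^ k"

lemma black_sgn: "(if black_cell (cube w (s, k)) then - v else v) = - sgn_at s k *\<^sub>R (v :: real ^ 3)"
proof -
  have "chi s * (- 1) ^ k = 1 \<or> chi s * (- 1) ^ k = - 1"
    by (cases "even k") (use chi_cases[of s] in auto)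
  then have "chi s * (- 1) ^ k = 1 \<and> sgn_at s k = 1 \<or> chi s * (- 1) ^ k = - 1 \<and> sgn_at s k = - 1"
    unfolding sgn_at_def by (cases "even k") auto
  then show ?thesis unfolding black_cube by (elim disjE) simp_all
qed

lemma domino_vector_body:
  "domino_vector (body w (V s k)) = - sgn_at s k *\<^sub>R axis 3 1"
  "domino_vector (body w (H {(x, y), (x + 1, y)} k)) = - sgn_at (x, y) k *\<^sub>R axis (ax w) 1"
  "domino_vector (body w (H {(x, y), (x, y + 1)} k)) = - sgn_at (x, y) k *\<^sub>R axis (ay w) 1"
  unfolding body_V_axis body_H cube_axis(1,2)[symmetric] domino_vector_axis black_sgn by (rule refl)+

lemma translate_image: "(+) v ` X = {p. p - v \<in> X}" for v :: "real ^ 'n"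
  by (auto intro: rev_image_eqI)

section \<open>Shades of boxes\<close>

lemma swept_box:
  fixes a b :: "real ^ 'n"
  assumes "\<And>i. a $ i < b $ i" "\<omega> = 1 \<or> \<omega> = - 1"
  shows "(\<Union>s\<in>{0..}. (+) (s *\<^sub>R (\<omega> *\<^sub>R axis m 1)) ` cbox a b) - cbox a b
    = {p. (if \<omega> = 1 then b $ m < p $ m else p $ m < a $ m) \<and> (\<forall>i. i \<noteq> m \<longrightarrow> a $ i \<le> p $ i \<and> p $ i \<le> b $ i)}"
proof (intro equalityI subsetI)
  fix p assume p: "p \<in> (\<Union>s\<in>{0..}. (+) (s *\<^sub>R (\<omega> *\<^sub>R axis m 1)) ` cbox a b) - cbox a b"
  then obtain s where s: "s \<ge> 0" "p - s *\<^sub>R (\<omega> *\<^sub>R axis m 1) \<in> cbox a b" by (auto simp: translate_image)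
  have o: "a $ i \<le> p $ i \<and> p $ i \<le> b $ i" if "i \<noteq> m" for i
    using s(2) that by (auto simp: mem_box_cart axis_def dest!: spec[of _ i])
  have m: "a $ m \<le> p $ m - s * \<omega>" "p $ m - s * \<omega> \<le> b $ m" using s(2) by (auto simp: mem_box_cart dest: spec[of _ m])
  have "\<not> (a $ m \<le> p $ m \<and> p $ m \<le> b $ m)" using p o unfolding mem_box_cart by (metis Diff_iff mem_box_cart(2))
  then show "p \<in> {p. (if \<omega> = 1 then b $ m < p $ m else p $ m < a $ m) \<and> (\<forall>i. i \<noteq> m \<longrightarrow> a $ i \<le> p $ i \<and> p $ i \<le> b $ i)}"
    using o m s(1) assms(2) by auto
next
  fix p assume p: "p \<in> {p. (if \<omega> = 1 then b $ m < p $ m else p $ m < a $ m) \<and> (\<forall>i. i \<noteq> m \<longrightarrow> a $ i \<le> p $ i \<and> p $ i \<le> b $ i)}"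
  define s where "s = (if \<omega> = 1 then p $ m - b $ m else a $ m - p $ m)"
  have "s \<ge> 0" using p by (auto simp: s_def)
  moreover have "p - s *\<^sub>R (\<omega> *\<^sub>R axis m 1) \<in> cbox a b"
    unfolding mem_box_cart
  proof
    fix i show "a $ i \<le> (p - s *\<^sub>R (\<omega> *\<^sub>R axis m 1)) $ i \<and> (p - s *\<^sub>R (\<omega> *\<^sub>R axis m 1)) $ i \<le> b $ i"
      using p assms by (cases "i = m") (auto simp: s_def axis_def intro: less_imp_le)
  qed
  moreover have "p \<notin> cbox a b" using p by (auto simp: mem_box_cart not_le split: if_splits intro!: exI[of _ m])
  ultimately show "p \<in> (\<Union>s\<in>{0..}. (+) (s *\<^sub>R (\<omega> *\<^sub>R axis m 1)) ` cbox a b) - cbox a b"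
    by (auto simp: translate_image)
qed

lemma shade_box:
  fixes a b :: "real ^ 3"
  assumes "\<And>i. a $ i < b $ i" "\<omega> = 1 \<or> \<omega> = - 1"
  shows "shade (\<omega> *\<^sub>R axis m 1) (cbox a b)
    = {p. (if \<omega> = 1 then b $ m < p $ m else p $ m < a $ m) \<and> (\<forall>i. i \<noteq> m \<longrightarrow> a $ i < p $ i \<and> p $ i < b $ i)}"
    (is "_ = ?R")
proof -
  define E where "E = {p. (if \<omega> = 1 then b $ m < p $ m else p $ m < a $ m) \<and> (\<forall>i. i \<noteq> m \<longrightarrow> a $ i \<le> p $ i \<and> p $ i \<le> b $ i)}"
  have "interior E = ?R"
  proof (intro equalityI subsetI)
    fix p assume p: "p \<in> interior E"
    have "a $ i < p $ i \<and> p $ i < b $ i" if "i \<noteq> m" for i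
    proof -
      have "interior E \<subseteq> interior {p. a $ i \<le> p $ i}" "interior E \<subseteq> interior {p. p $ i \<le> b $ i}"
        using that unfolding E_def by (intro interior_mono; auto)+
      then show ?thesis using p by auto
    qed
    then show "p \<in> ?R" using p interior_subset[of E] by (auto simp: E_def)
  next
    fix p assume p: "p \<in> ?R"
    have "?R = (if \<omega> = 1 then {p. b $ m < p $ m} else {p. p $ m < a $ m})
        \<inter> (\<Inter>i\<in>- {m}. {p. a $ i < p $ i} \<inter> {p. p $ i < b $ i})" by auto
    moreover have "open \<dots>"
      by (intro open_Int open_INT) (auto intro: open_halfspace_component_lt_cart open_halfspace_component_gt_cart)
    ultimately have "open ?R" by simp
    moreover have "?R \<subseteq> E" by (auto simp: E_def less_imp_le)
    ultimately show "p \<in> interior E" using p by (meson interior_maximal subsetD)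
  qed
  then show ?thesis unfolding shade_def swept_box[OF assms] E_def .
qed

lemma box_meets_shade:
  fixes a b a' b' :: "real ^ 3"
  assumes ab: "\<And>i. a $ i < b $ i" "\<And>i. a' $ i < b' $ i" and \<omega>: "\<omega> = 1 \<or> \<omega> = - 1"
  shows "cbox a' b' \<inter> shade (\<omega> *\<^sub>R axis m 1) (cbox a b) \<noteq> {} \<longleftrightarrow>
    (if \<omega> = 1 then b $ m < b' $ m else a' $ m < a $ m) \<and> (\<forall>i. i \<noteq> m \<longrightarrow> a' $ i < b $ i \<and> a $ i < b' $ i)"
proof
  assume "cbox a' b' \<inter> shade (\<omega> *\<^sub>R axis m 1) (cbox a b) \<noteq> {}"
  then obtain p where p: "p \<in> cbox a' b'" "p \<in> shade (\<omega> *\<^sub>R axis m 1) (cbox a b)" by blast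
  have "a' $ i \<le> p $ i" "p $ i \<le> b' $ i" for i using p(1) by (auto simp: mem_box_cart)
  then show "(if \<omega> = 1 then b $ m < b' $ m else a' $ m < a $ m) \<and> (\<forall>i. i \<noteq> m \<longrightarrow> a' $ i < b $ i \<and> a $ i < b' $ i)"
    using p(2) unfolding shade_box[OF ab(1) \<omega>] by (auto split: if_splits intro: less_le_trans le_less_trans)
next
  assume h: "(if \<omega> = 1 then b $ m < b' $ m else a' $ m < a $ m) \<and> (\<forall>i. i \<noteq> m \<longrightarrow> a' $ i < b $ i \<and> a $ i < b' $ i)"
  \<comment> \<open>Extremal in the direction of the shade, and the midpoint of the overlap in the
    other two directions.\<close>
  define p :: "real ^ 3" where "p = (\<chi> i. if i = m then (if \<omega> = 1 then b' $ m else a' $ m)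
      else (max (a $ i) (a' $ i) + min (b $ i) (b' $ i)) / 2)"
  have "p \<in> cbox a' b'"
    unfolding mem_box_cart
  proof
    fix i show "a' $ i \<le> p $ i \<and> p $ i \<le> b' $ i"
      using h ab(1)[of i] ab(2)[of i] by (auto simp: p_def max_def min_def intro: less_imp_le split: if_splits)
  qed
  moreover have "p \<in> shade (\<omega> *\<^sub>R axis m 1) (cbox a b)"
    unfolding shade_box[OF ab(1) \<omega>] using h ab by (auto simp: p_def max_def min_def split: if_splits)
  ultimately show "cbox a' b' \<inter> shade (\<omega> *\<^sub>R axis m 1) (cbox a b) \<noteq> {}" by blast
qed

definition boxed :: "bool \<Rightarrow> real \<Rightarrow> real \<Rightarrow> real \<Rightarrow> real \<Rightarrow> real \<Rightarrow> real \<Rightarrow> (real ^ 3) set" where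
  "boxed w x x' y y' z z' = cbox (\<chi> i. if i = ax w then x else if i = ay w then y else z)
    (\<chi> i. if i = ax w then x' else if i = ay w then y' else z')"

lemma in_boxed: "p \<in> boxed w x x' y y' z z' \<longleftrightarrow> x \<le> p $ ax w \<and> p $ ax w \<le> x' \<and> y \<le> p $ ay w \<and> p $ ay w \<le> y'
    \<and> z \<le> p $ 3 \<and> p $ 3 \<le> z'"
  by (auto simp: boxed_def mem_box_cart all_axes[of _ w])

lemma body_boxed:
  "body w (V (x, y) k) = boxed w (of_int x) (of_int x + 1) (of_int y) (of_int y + 1) (real k) (real k + 2)"
  "body w (H {(x, y), (x, y + 1)} k) = boxed w (of_int x) (of_int x + 1) (of_int y) (of_int y + 2) (real k) (real k + 1)"
  by (auto simp: body_V body_H in_unit_cube in_boxed)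

lemma boxed_meets_shade:
  assumes "x < x'" "y < y'" "z < z'" "a < a'" "b < b'" "c < c'" and \<omega>: "\<omega> = 1 \<or> \<omega> = - 1"
  shows "boxed w a a' b b' c c' \<inter> shade (\<omega> *\<^sub>R axis (ax w) 1) (boxed w x x' y y' z z') \<noteq> {} \<longleftrightarrow>
    (if \<omega> = 1 then x' < a' else a < x) \<and> b < y' \<and> y < b' \<and> c < z' \<and> z < c'"
  unfolding boxed_def using assms
  by (subst box_meets_shade) (auto simp: all_axes[of _ w])

lemma det_axes:
  "det (vector [p *\<^sub>R axis 3 1, q *\<^sub>R axis (ay w) 1, r *\<^sub>R axis (ax w) 1] :: real ^ 3 ^ 3) = (if w then - 1 else 1) * p * q * r"
  "det (vector [q *\<^sub>R axis (ay w) 1, p *\<^sub>R axis 3 1, r *\<^sub>R axis (ax w) 1] :: real ^ 3 ^ 3) = (if w then 1 else - 1) * p * q * r"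
  by (cases w; simp add: det_3 ax_def ay_def axis_def)+

lemma det_parallel:
  fixes v v' :: "real ^ 3"
  shows "det (vector [p *\<^sub>R v, q *\<^sub>R v, v'] :: real ^ 3 ^ 3) = 0"
    "det (vector [p *\<^sub>R v, v', q *\<^sub>R v] :: real ^ 3 ^ 3) = 0"
    "det (vector [v', p *\<^sub>R v, q *\<^sub>R v] :: real ^ 3 ^ 3) = 0"
  by (simp_all add: det_3 algebra_simps)

context
  fixes w :: bool and \<omega> :: real and u :: "real ^ 3"
  assumes \<omega>: "\<omega> = 1 \<or> \<omega> = - 1" and u: "u = \<omega> *\<^sub>R axis (ax w) 1"
begin

text \<open>All three vectors of the determinant are parallel to one of the two horizontal axes, so
  two of them are parallel to each other.\<close>

lemma pair_twist_HH:
  assumes "is_dom h" "is_dom h'"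
  shows "pair_twist u (body w (H h k)) (body w (H h' j)) = 0"
proof -
  have "\<exists>p i. domino_vector (body w (H h k)) = p *\<^sub>R axis i 1 \<and> (i = ax w \<or> i = ay w)" if "is_dom h" for h k
    using that
  proof (cases rule: is_dom_cases)
    case (hor x y)
    show ?thesis unfolding hor domino_vector_body by blast
  next
    case (ver x y)
    show ?thesis unfolding ver domino_vector_body by blast
  qed
  then obtain p q i i' where "domino_vector (body w (H h k)) = p *\<^sub>R axis i 1" "i = ax w \<or> i = ay w"
    "domino_vector (body w (H h' j)) = q *\<^sub>R axis i' 1" "i' = ax w \<or> i' = ay w" using assms by metis
  then show ?thesis unfolding pair_twist_def u by (auto simp: det_parallel)
qed

lemma pair_twist_VV: "pair_twist u (body w (V s k)) (body w (V s' j)) = 0"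
  unfolding pair_twist_def domino_vector_body det_parallel by simp

text \<open>At most one of the two dominoes meets the shade of the other. Reversing \<open>u\<close>
  exchanges their roles, and the determinant changes sign under the exchange as well as under the
  reversal, so only the side on which \<open>s\<close> lies matters.\<close>

lemma pair_twist_HV:
  assumes "is_dom h"
  shows "pair_twist u (body w (H h k)) (body w (V s j)) + pair_twist u (body w (V s j)) (body w (H h k))
    = (if w then 1 else - 1) / 4 * of_int (phi h s) * (of_bool (Suc j = k) - of_bool (j = k))"
  using assms
proof (cases rule: is_dom_cases)
  case (hor x y)
  then show ?thesis
    unfolding hor pair_twist_def domino_vector_body u det_parallel phi_horizontal by simp
next
  case (ver x y)
  obtain a b where s: "s = (a, b)" by (cases s)
  let ?Y = "(b = y \<or> b = y + 1) \<and> (j = k \<or> Suc j = k)"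
  have 1: "body w (V s j) \<inter> shade u (body w (H h k)) \<noteq> {} \<longleftrightarrow> (if \<omega> = 1 then x < a else a < x) \<and> ?Y"
    unfolding ver s u body_boxed by (subst boxed_meets_shade) (use \<omega> in auto)
  have 2: "body w (H h k) \<inter> shade u (body w (V s j)) \<noteq> {} \<longleftrightarrow> (if \<omega> = 1 then a < x else x < a) \<and> ?Y"
    unfolding ver s u body_boxed by (subst boxed_meets_shade) (use \<omega> in auto)
  let ?d = "(if w then - 1 else 1) * sgn_at s j * sgn_at (x, y) k * \<omega>"
  have d: "det (vector [domino_vector (body w (V s j)), domino_vector (body w (H h k)), u] :: real ^ 3 ^ 3) = ?d"
    "det (vector [domino_vector (body w (H h k)), domino_vector (body w (V s j)), u] :: real ^ 3 ^ 3) = - ?d"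
    unfolding ver domino_vector_body u det_axes by auto
  have E: "pair_twist u (body w (H h k)) (body w (V s j)) + pair_twist u (body w (V s j)) (body w (H h k))
    = (if w then - 1 else 1) / 4 * sgn_at s j * sgn_at (x, y) k * of_int (sgn (a - x)) * of_bool ?Y"
    unfolding pair_twist_def 1 2 d using \<omega> by (auto simp: sgn_if)
  have e: "sgn_at s j * sgn_at (x, y) k = of_int (chi s * chi (x, y)) * (- 1) ^ (j + k)"
    by (simp add: sgn_at_def power_add)
  have P: "pair_twist u (body w (H h k)) (body w (V s j)) + pair_twist u (body w (V s j)) (body w (H h k))
    = (if w then - 1 else 1) / 4 * (of_int (chi s * chi (x, y)) * (- 1) ^ (j + k)) * of_int (sgn (a - x)) * of_bool ?Y"
    using E unfolding e[symmetric] by (simp add: mult.assoc)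
  have "phi h s = chi (x, y) * chi s * sgn (a - x) * of_bool (b = y \<or> b = y + 1)"
    unfolding ver s phi_vertical by (auto simp: rk_def)
  \<comment> \<open>The two floors of a vertical domino have opposite parity, which produces the
    difference in \<open>G\<close>.\<close>
  moreover have "(- 1 :: real) ^ (j + k) * of_bool (j = k \<or> Suc j = k) = of_bool (j = k) - of_bool (Suc j = k)"
    by (auto simp: power_add simp flip: power_mult_distrib)
  ultimately show ?thesis unfolding P
    by (cases "b = y \<or> b = y + 1"; cases "j = k"; cases "Suc j = k") (auto simp: mult_ac)
qed

end


section \<open>Tilings of the cylinder\<close>

definition dm :: "int ^ 3 \<Rightarrow> 3 \<Rightarrow> (real ^ 3) set" where
  "dm a i = unit_cell a \<union> unit_cell (a + axis i 1)"

lemma flip_dm: "flip t t' \<longleftrightarrow> (\<exists>a i j. i \<noteq> j \<and> dm a i \<in> t \<and> dm (a + axis j 1) i \<in> t \<and>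
    t' = (t - {dm a i, dm (a + axis j 1) i}) \<union> {dm a j, dm (a + axis i 1) j})"
  unfolding flip_def dm_def Let_def by (simp add: add.commute add.left_commute)

lemma dm_body:
  "dm (cube w ((x, y), k)) (ax w) = body w (H {(x, y), (x + 1, y)} k)"
  "dm (cube w ((x, y), k)) (ay w) = body w (H {(x, y), (x, y + 1)} k)"
  "dm (cube w (s, k)) 3 = body w (V s k)"
  by (simp_all add: dm_def body_H body_V cube_axis)

lemma body_image_swap:
  assumes "\<And>d. d \<in> L \<Longrightarrow> good d" "\<And>d. d \<in> X \<Longrightarrow> good d"
  shows "body w ` (L - X \<union> Y) = (body w ` L - body w ` X) \<union> body w ` Y"
proof -
  have "inj_on (body w) (L \<union> X)" by (rule inj_on_subset[OF inj_body]) (use assms in auto)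
  then have "body w ` (L - X) = body w ` L - body w ` X" by (intro inj_on_image_set_diff[of _ "L \<union> X"]) auto
  then show ?thesis by (simp add: image_Un)
qed

lemma body_mem:
  assumes "\<And>d. d \<in> L \<Longrightarrow> good d" "good d"
  shows "body w d \<in> body w ` L \<longleftrightarrow> d \<in> L"
  using assms body_eq by (metis image_iff)

lemma flip_rtranclp_sym:
  assumes "flip\<^sup>*\<^sup>* t t'" "t \<in> X" and step: "\<And>s s'. s \<in> X \<Longrightarrow> flip s s' \<Longrightarrow> s' \<in> X \<and> flip s' s"
  shows "flip\<^sup>*\<^sup>* t' t \<and> t' \<in> X"
  using assms(1,2)
proof (induction rule: rtranclp_induct)
  case (step s s')
  then show ?case using assms(3) by (meson converse_rtranclp_into_rtranclp)
qed simp

locale balanced_disk =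
  fixes D :: "(real ^ 2) set" and w :: bool
  assumes disk: "quadriculated_disk D" and bal: "balanced D"
begin

sublocale connected_region "squares w D"
  by (rule squares_connected_region[OF disk bal])

definition tiling :: "cell set set list \<Rightarrow> (real ^ 3) set set" where
  "tiling fs = body w ` layout fs"

lemma cylinder_eq: "cylinder D N = cubes w (squares w D \<times> {..<N})"
  by (rule cylinder_cubes[OF disk])

lemma tiling_in_tilings:
  assumes "walk {} fs {}"
  shows "tiling fs \<in> tilings D (length fs)"
  unfolding tilings_def mem_Collect_eq
proof (intro conjI ballI pairwiseI)
  note L = walk_layout[OF assms]
  show "domino d" if "d \<in> tiling fs" for d
    using that L(1) domino_body by (auto simp: tiling_def)
  show "interior d \<inter> interior e = {}" if "d \<in> tiling fs" "e \<in> tiling fs" "d \<noteq> e" for d e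
  proof -
    obtain a b where ab: "a \<in> layout fs" "b \<in> layout fs" "d = body w a" "e = body w b"
      using \<open>d \<in> tiling fs\<close> \<open>e \<in> tiling fs\<close> by (auto simp: tiling_def)
    then have "a \<noteq> b" using \<open>d \<noteq> e\<close> by auto
    then have "cells a \<inter> cells b = {}" using pairwiseD[OF L(2) ab(1,2)] by blast
    then show ?thesis unfolding ab body_def interior_cubes_disjoint .
  qed
  have "\<Union> (tiling fs) = cubes w (\<Union> (cells ` layout fs))"
    by (simp add: cubes_UN tiling_def body_def image_image)
  then show "\<Union> (tiling fs) = cylinder D (length fs)" using L(3) by (simp add: cylinder_eq)
qed

lemma tiling_obtain:
  assumes "t \<in> tilings D N"
  obtains fs where "walk {} fs {}" "length fs = N" "t = tiling fs"
proof -
  have t: "\<And>d. d \<in> t \<Longrightarrow> domino d" "\<And>d e. d \<in> t \<Longrightarrow> e \<in> t \<Longrightarrow> d \<noteq> e \<Longrightarrow> interior d \<inter> interior e = {}"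
    "\<Union> t = cubes w (squares w D \<times> {..<N})"
    using assms by (auto simp: tilings_def pairwise_def cylinder_eq)
  define T where "T = {d. good d \<and> body w d \<in> t}"
  have tT: "t = body w ` T"
  proof (intro equalityI subsetI)
    fix d assume d: "d \<in> t"
    obtain a i where a: "d = unit_cell a \<union> unit_cell (a + axis i 1)"
      using t(1)[OF d] by (auto simp: domino_def)
    have "unit_cell a \<subseteq> (\<Union>b\<in>cube w ` (squares w D \<times> {..<N}). unit_cell b)"
      using d a t(3) by (auto simp: cubes_def)
    then have "a \<in> cube w ` (squares w D \<times> {..<N})" by (simp only: unit_cell_subset_UN)
    then have "0 \<le> a $ 3" by auto
    then obtain e where "good e" "d = body w e" using domino_is_body a by metis
    then show "d \<in> body w ` T" using d by (auto simp: T_def)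
  qed (auto simp: T_def)
  have "\<Union> t = cubes w (\<Union> (cells ` T))"
    unfolding tT by (simp add: cubes_UN body_def image_image)
  then have "cubes w (\<Union> (cells ` T)) = cubes w (squares w D \<times> {..<N})" using t(3) by simp
  then have cover: "\<Union> (cells ` T) = squares w D \<times> {..<N}" unfolding cubes_eq .
  have "cells d \<inter> cells e = {}" if "d \<in> T" "e \<in> T" "d \<noteq> e" for d e
  proof -
    have "body w d \<noteq> body w e" using that body_eq by (auto simp: T_def)
    then have "interior (body w d) \<inter> interior (body w e) = {}" using t(2) that by (auto simp: T_def)
    then show ?thesis by (simp only: body_def interior_cubes_disjoint)
  qed
  then have disj: "pairwise (\<lambda>d e. cells d \<inter> cells e = {}) T" by (auto simp: pairwise_def)
  obtain fs where "walk {} fs {}" "length fs = N" "T = layout fs"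
    by (rule layout_exists[OF _ disj cover]) (auto simp: T_def)
  then show thesis using that tT by (simp add: tiling_def)
qed

lemma tiling_eq:
  assumes "walk {} fs {}" "walk {} gs {}" "length fs = length gs" "tiling fs = tiling gs"
  shows "fs = gs"
proof -
  have "layout fs = layout gs"
    using assms(4) walk_layout(1)[OF assms(1)] walk_layout(1)[OF assms(2)]
    by (intro inj_on_image_eq_iff[OF inj_body, THEN iffD1]) (auto simp: tiling_def)
  then show ?thesis using layout_inj assms(3) by blast
qed

lemma tilings_eq: "tilings D N = tiling ` walks N {} {}"
  using tiling_in_tilings by (auto simp: walks_def elim: tiling_obtain)

lemma inj_tiling: "inj_on tiling (walks N {} {})"
  using tiling_eq by (auto simp: inj_on_def walks_def)

lemma card_tilings: "card (tilings D N) = card (walks N {} {})"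
  unfolding tilings_eq by (rule card_image[OF inj_tiling])

lemma tiling_append:
  assumes "walk {} xs {}"
  shows "stack (length xs) (tiling xs) (tiling ys) = tiling (xs @ ys)"
  unfolding stack_def tiling_def layout_append[OF assms] by (simp add: image_Un image_image body_lift)

lemma vert_tiling_eq:
  assumes "even N"
  shows "vert_tiling D N = tiling (replicate N {})"
proof (intro equalityI subsetI)
  fix d assume "d \<in> vert_tiling D N"
  then obtain a where a: "d = unit_cell a \<union> unit_cell (a + axis 3 1)" "even (a $ 3)" "d \<subseteq> cylinder D N"
    by (auto simp: vert_tiling_def)
  have "unit_cell a \<subseteq> (\<Union>b\<in>cube w ` (squares w D \<times> {..<N}). unit_cell b)"
    using a by (auto simp: cubes_def cylinder_eq)
  then have "a \<in> cube w ` (squares w D \<times> {..<N})" by (simp only: unit_cell_subset_UN)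
  then obtain s k where sk: "a = cube w (s, k)" "s \<in> squares w D" "k < N" by auto
  then have "even k" using a(2) by simp
  then have "V s k \<in> layout (replicate N {})" using sk unfolding layout_empty_floors by blast
  then have "body w (V s k) \<in> tiling (replicate N {})" unfolding tiling_def by (rule imageI)
  then show "d \<in> tiling (replicate N {})" using a(1) sk(1) by (simp only: body_V_axis)
next
  fix d assume "d \<in> tiling (replicate N {})"
  then obtain s k where sk: "d = body w (V s k)" "k < N" "even k" "s \<in> squares w D"
    by (auto simp: tiling_def layout_empty_floors)
  then have "Suc k < N" using assms by (metis Suc_lessI even_Suc)
  then have "d \<subseteq> cylinder D N" using sk unfolding sk(1) body_def cylinder_eq cubes_subset by auto
  moreover have "d = unit_cell (cube w (s, k)) \<union> unit_cell (cube w (s, k) + axis 3 1)" by (simp add: sk(1) body_V_axis)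
  moreover have "even (cube w (s, k) $ 3)" using sk(3) by simp
  ultimately show "d \<in> vert_tiling D N" unfolding vert_tiling_def by blast
qed

text \<open>Floors are counted from 1 in the geometric definition and from 0 in the list.\<close>

lemma vertical_floor_tiling:
  assumes w: "walk {} fs {}" and k: "k < length fs"
  shows "vertical_floor D (tiling fs) (Suc k) \<longleftrightarrow> fs ! k = {}"
proof
  note L = walk_layout[OF w]
  assume v: "vertical_floor D (tiling fs) (Suc k)"
  show "fs ! k = {}"
  proof (rule ccontr)
    assume "fs ! k \<noteq> {}"
    then obtain h where h: "H h k \<in> layout fs" using k by auto
    obtain c where c: "c \<in> h" using L(1)[OF h] is_dom_nonempty by fastforce
    have "(c, k) \<in> (\<Union>d\<in>layout fs. cells d)" using c by (intro UN_I[OF h]) simp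
    then have cS: "c \<in> squares w D" unfolding L(3) by simp
    have "unit_cell (cube w (c, k)) \<subseteq> slab D (real (Suc k) - 1) (real (Suc k))"
    proof
      fix p assume p: "p \<in> unit_cell (cube w (c, k))"
      then have "p \<in> slab D 0 (real (Suc k))"
        using unit_cell_slab[OF disk, of "cube w (c, k)" "Suc k" w] cS by auto
      then show "p \<in> slab D (real (Suc k) - 1) (real (Suc k))" using p by (simp add: slab_def in_unit_cube)
    qed
    then have "interior (unit_cell (cube w (c, k))) \<subseteq> interior (slab D (real (Suc k) - 1) (real (Suc k)))"
      by (rule interior_mono)
    moreover have "cell_center (cube w (c, k)) \<in> interior (unit_cell (cube w (c, k)))"
      unfolding unit_cell_cbox interior_cbox by (auto simp: mem_box_cart cell_center_def)
    moreover have "cell_center (cube w (c, k)) \<in> body w (H h k)"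
      using c center_in_unit_cell[of "cube w (c, k)" "cube w (c, k)"]
      unfolding body_def cubes_def by (intro UN_I[of "(c, k)"]) auto
    ultimately have "vertical_domino (body w (H h k))"
      using v h unfolding vertical_floor_def tiling_def by blast
    then show False using body_vertical[OF L(1)[OF h]] by simp
  qed
next
  note L = walk_layout[OF w]
  assume e: "fs ! k = {}"
  show "vertical_floor D (tiling fs) (Suc k)"
    unfolding vertical_floor_def
  proof (intro ballI impI)
    fix d assume d: "d \<in> tiling fs" and ne: "d \<inter> interior (slab D (real (Suc k) - 1) (real (Suc k))) \<noteq> {}"
    obtain a where a: "a \<in> layout fs" "d = body w a" using d by (auto simp: tiling_def)
    obtain p where p: "p \<in> d" "p \<in> interior (slab D (real (Suc k) - 1) (real (Suc k)))" using ne by blast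
    \<comment> \<open>An interior point has height strictly between the two levels, which excludes
      dominoes that only touch the floor.\<close>
    have "interior (slab D (real (Suc k) - 1) (real (Suc k))) \<subseteq> interior {p. real k \<le> p $ 3}"
      "interior (slab D (real (Suc k) - 1) (real (Suc k))) \<subseteq> interior {p. p $ 3 \<le> real k + 1}"
      by (intro interior_mono; auto simp: slab_def)+
    then have z: "real k < p $ 3" "p $ 3 < real k + 1" using p(2) by auto
    have "\<exists>s j. a = V s j"
    proof (cases a)
      case (H h j)
      then obtain c where "p \<in> unit_cell (cube w (c, j))" using p(1) a(2) by (auto simp: body_def cubes_def)
      then have "real j \<le> p $ 3" "p $ 3 \<le> real j + 1" unfolding in_unit_cube by auto
      then have "j = k" using z by linarith
      then show ?thesis using a(1) H e by simp
    qed auto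
    then show "vertical_domino d" using body_vertical[OF L(1)[OF a(1)]] a(2) by blast
  qed
qed

lemma card_vertical_floors:
  assumes "walk {} fs {}"
  shows "card {k \<in> {1..length fs}. vertical_floor D (tiling fs) k} = nv fs"
proof -
  have "{k \<in> {1..length fs}. vertical_floor D (tiling fs) k} = Suc ` {k. k < length fs \<and> fs ! k = {}}"
  proof (intro equalityI subsetI)
    fix k assume k: "k \<in> {k \<in> {1..length fs}. vertical_floor D (tiling fs) k}"
    then obtain j where "k = Suc j" "j < length fs" by (cases k) auto
    then show "k \<in> Suc ` {k. k < length fs \<and> fs ! k = {}}"
      using k vertical_floor_tiling[OF assms] by auto
  qed (auto simp: vertical_floor_tiling[OF assms])
  then show ?thesis by (simp add: card_image nv_def length_filter_conv_card)
qed

subsection \<open>Flips\<close>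

text \<open>Up to order, the axes of a flip are the two horizontal ones, giving a flip inside a
  floor, or a horizontal and the vertical one, giving a flip across two floors.\<close>

lemma flip_tiling:
  assumes w: "walk {} fs {}" and fl: "flip (tiling fs) t'"
  shows "\<exists>gs. walk {} gs {} \<and> length gs = length fs \<and> Gs {} gs = Gs {} fs \<and> t' = tiling gs"
proof -
  note L = walk_layout[OF w]
  obtain a i j where aij: "i \<noteq> j" "dm a i \<in> tiling fs" "dm (a + axis j 1) i \<in> tiling fs"
    "t' = (tiling fs - {dm a i, dm (a + axis j 1) i}) \<union> {dm a j, dm (a + axis i 1) j}"
    using fl unfolding flip_dm by blast
  obtain d where d: "good d" "dm a i = body w d"
    using aij(2) L(1) by (auto simp: tiling_def)
  have "unit_cell a \<subseteq> (\<Union>b\<in>cube w ` cells d. unit_cell b)"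
    using d(2) by (auto simp: body_def cubes_def dm_def)
  then have "a \<in> cube w ` cells d" by (simp only: unit_cell_subset_UN)
  then obtain x y k where a: "a = cube w ((x, y), k)" by force
  have concl: ?thesis
    if gs: "\<exists>gs. walk {} gs {} \<and> length gs = length fs \<and> Gs {} gs = Gs {} fs \<and> layout gs = layout fs - X \<union> Y"
      and X: "\<And>d. d \<in> X \<Longrightarrow> good d" and XY: "body w ` X = {dm a i, dm (a + axis j 1) i}"
        "body w ` Y = {dm a j, dm (a + axis i 1) j}" for X Y
  proof -
    obtain gs where g: "walk {} gs {}" "length gs = length fs" "Gs {} gs = Gs {} fs" "layout gs = layout fs - X \<union> Y"
      using gs by blast
    have "t' = tiling gs"
      unfolding aij(4) tiling_def g(4) by (subst body_image_swap[OF L(1) X]) (auto simp: XY)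
    then show ?thesis using g by blast
  qed
  have mem: "d \<in> layout fs" if "body w d \<in> tiling fs" "good d" for d
    using body_mem[of "layout fs" d w] L(1) that by (simp add: tiling_def)
  let ?hx = "{(x, y), (x + 1, y)}" and ?hy = "{(x, y), (x, y + 1)}"
    and ?hx' = "{(x, y + 1), (x + 1, y + 1)}" and ?hy' = "{(x + 1, y), (x + 1, y + 1)}"
  have g: "is_dom ?hx" "is_dom ?hy" "is_dom ?hx'" "is_dom ?hy'" by (rule is_dom_hor is_dom_ver)+
  consider "i = ax w" "j = ay w" | "i = ay w" "j = ax w" | "i = ax w" "j = 3" | "i = ay w" "j = 3"
    | "i = 3" "j = ax w" | "i = 3" "j = ay w"
    using aij(1) by (cases rule: axis_cases[of i w]; cases rule: axis_cases[of j w]) auto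
  then show ?thesis
  proof cases
    case 1
    have "H ?hx k \<in> layout fs" "H ?hx' k \<in> layout fs"
      using aij(2,3) unfolding a 1 cube_axis dm_body by - (rule mem, assumption, simp only: good.simps g)+
    from flip_level_square(1)[OF w this] show ?thesis
      by (rule concl) (use g in \<open>auto simp: a 1 cube_axis dm_body\<close>)
  next
    case 2
    have "H ?hy k \<in> layout fs" "H ?hy' k \<in> layout fs"
      using aij(2,3) unfolding a 2 cube_axis dm_body by - (rule mem, assumption, simp only: good.simps g)+
    from flip_level_square(2)[OF w this] show ?thesis
      by (rule concl) (use g in \<open>auto simp: a 2 cube_axis dm_body\<close>)
  next
    case 3
    have "H ?hx k \<in> layout fs" "H ?hx (Suc k) \<in> layout fs"
      using aij(2,3) unfolding a 3 cube_axis dm_body by - (rule mem, assumption, simp only: good.simps g)+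
    from flip_down[OF w this] show ?thesis
      by (rule concl) (use g in \<open>auto simp: a 3 cube_axis dm_body\<close>)
  next
    case 4
    have "H ?hy k \<in> layout fs" "H ?hy (Suc k) \<in> layout fs"
      using aij(2,3) unfolding a 4 cube_axis dm_body by - (rule mem, assumption, simp only: good.simps g)+
    from flip_down[OF w this] show ?thesis
      by (rule concl) (use g in \<open>auto simp: a 4 cube_axis dm_body\<close>)
  next
    case 5
    have "V (x, y) k \<in> layout fs" "V (x + 1, y) k \<in> layout fs"
      using aij(2,3) unfolding a 5 cube_axis dm_body by - (rule mem, assumption, simp only: good.simps)+
    then have "V s k \<in> layout fs" if "s \<in> ?hx" for s using that by (auto simp del: V_layout)
    from flip_up[OF w this g(1)] show ?thesis
      by (rule concl) (auto simp: a 5 cube_axis dm_body)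
  next
    case 6
    have "V (x, y) k \<in> layout fs" "V (x, y + 1) k \<in> layout fs"
      using aij(2,3) unfolding a 6 cube_axis dm_body by - (rule mem, assumption, simp only: good.simps)+
    then have "V s k \<in> layout fs" if "s \<in> ?hy" for s using that by (auto simp del: V_layout)
    from flip_up[OF w this g(2)] show ?thesis
      by (rule concl) (auto simp: a 6 cube_axis dm_body)
  qed
qed

lemma flip_down_real:
  assumes w: "walk {} fs {}" and h: "H h k \<in> layout fs" "H h (Suc k) \<in> layout fs"
    and gs: "layout gs = layout fs - {H h k, H h (Suc k)} \<union> (\<lambda>s. V s k) ` h"
  shows "flip (tiling fs) (tiling gs)"
proof -
  note L = walk_layout[OF w]
  have d: "is_dom h" using L(1)[OF h(1)] by simp
  have X: "good d" if "d \<in> {H h k, H h (Suc k)}" for d using d that by auto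
  have t: "tiling gs = (tiling fs - {body w (H h k), body w (H h (Suc k))}) \<union> (\<lambda>s. body w (V s k)) ` h"
    unfolding tiling_def gs by (subst body_image_swap[OF L(1) X]) (auto simp: image_image)
  have m: "body w (H h k) \<in> tiling fs" "body w (H h (Suc k)) \<in> tiling fs" using h by (auto simp: tiling_def)
  from d show ?thesis
  proof (cases rule: is_dom_cases)
    case (hor x y)
    show ?thesis unfolding flip_dm t using m unfolding hor
      by (intro exI[of _ "cube w ((x, y), k)"] exI[of _ "ax w"] exI[of _ 3]) (auto simp: cube_axis dm_body)
  next
    case (ver x y)
    show ?thesis unfolding flip_dm t using m unfolding ver
      by (intro exI[of _ "cube w ((x, y), k)"] exI[of _ "ay w"] exI[of _ 3]) (auto simp: cube_axis dm_body)
  qed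
qed

text \<open>The new dominoes were not in \<open>t\<close>, since each shares a cube with a removed
  one without being equal to it. Undoing the flip therefore restores exactly
  \<open>t\<close>.\<close>

lemma flip_sym:
  assumes t: "t \<in> tilings D N" and fl: "flip t t'"
  shows "t' \<in> tilings D N \<and> flip t' t"
proof
  obtain fs where fs: "walk {} fs {}" "length fs = N" "t = tiling fs" using t by (rule tiling_obtain)
  show "t' \<in> tilings D N"
    using flip_tiling[OF fs(1) fl[unfolded fs(3)]] tiling_in_tilings fs(2) by force
  obtain a i j where aij: "i \<noteq> j" "dm a i \<in> t" "dm (a + axis j 1) i \<in> t"
    "t' = (t - {dm a i, dm (a + axis j 1) i}) \<union> {dm a j, dm (a + axis i 1) j}"
    using fl unfolding flip_dm by blast
  have disj: "interior d \<inter> interior e = {}" if "d \<in> t" "e \<in> t" "d \<noteq> e" for d e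
    using t that by (auto simp: tilings_def pairwise_def)
  have no: "d = e" if "d \<in> t" "e \<in> t" "unit_cell b \<subseteq> d" "unit_cell b \<subseteq> e" for d e b
  proof (rule ccontr)
    assume "d \<noteq> e"
    have "interior (unit_cell b) \<subseteq> interior d \<inter> interior e" using that by (simp add: interior_mono)
    moreover have "cell_center b \<in> interior (unit_cell b)"
      unfolding unit_cell_cbox interior_cbox by (auto simp: mem_box_cart cell_center_def)
    ultimately show False using disj[OF that(1,2) \<open>d \<noteq> e\<close>] by blast
  qed
  have dm_ne: "dm b i \<noteq> dm b j" for b
  proof
    assume "dm b i = dm b j"
    then have "unit_cell (b + axis i 1) \<subseteq> (\<Union>c\<in>{b, b + axis j 1}. unit_cell c)" by (auto simp: dm_def)
    then have "b + axis i 1 \<in> {b, b + axis j 1}" by (simp only: unit_cell_subset_UN)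
    then show False using aij(1) by (auto simp: axis_eq_axis axis_eq_0_iff)
  qed
  have 1: "dm a j \<notin> t" using no[OF aij(2), of "dm a j" a] dm_ne[of a] by (auto simp: dm_def)
  have 2: "dm (a + axis i 1) j \<notin> t"
  proof
    assume "dm (a + axis i 1) j \<in> t"
    moreover have "unit_cell (a + axis i 1) \<subseteq> dm a i" "unit_cell (a + axis i 1) \<subseteq> dm (a + axis i 1) j"
      by (auto simp: dm_def)
    ultimately have e: "dm (a + axis i 1) j = dm a i" using no[OF aij(2)] by blast
    have "unit_cell (a + axis i 1 + axis j 1) \<subseteq> (\<Union>c\<in>{a, a + axis i 1}. unit_cell c)"
      using e by (auto simp: dm_def)
    then have "a + axis i 1 + axis j 1 \<in> {a, a + axis i 1}" by (simp only: unit_cell_subset_UN)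
    then have "axis i 1 + axis j 1 = (0 :: int ^ 3) \<or> axis j 1 = (0 :: int ^ 3)" by (auto simp: add.assoc)
    moreover have "(axis i 1 + axis j 1 :: int ^ 3) $ i = 1" "(axis j 1 :: int ^ 3) $ j = 1" using aij(1) by (auto simp: axis_def)
    ultimately show False by (metis zero_index zero_neq_one)
  qed
  have 3: "dm a i \<notin> {dm a j, dm (a + axis i 1) j}" "dm (a + axis j 1) i \<notin> {dm a j, dm (a + axis i 1) j}"
    using 1 2 aij(2,3) by auto
  show "flip t' t"
    unfolding flip_dm
  proof (intro exI conjI)
    show "j \<noteq> i" using aij(1) by simp
    show "dm a j \<in> t'" "dm (a + axis i 1) j \<in> t'" using aij(4) by auto
    show "t = (t' - {dm a j, dm (a + axis i 1) j}) \<union> {dm a i, dm (a + axis j 1) i}"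
      unfolding aij(4) using aij(2,3) 1 2 3 by auto
  qed
qed

lemma flip_equiv_sym:
  assumes "flip_equiv t t'" "t \<in> tilings D N"
  shows "flip_equiv t' t \<and> t' \<in> tilings D N"
  by (rule flip_rtranclp_sym[OF assms]) (rule flip_sym)

lemma vflip_flip:
  assumes "vflip fs gs"
  shows "flip (tiling fs) (tiling gs)"
proof -
  have down: "flip (tiling (xs @ [insert h f, insert h f'] @ ys)) (tiling (xs @ [f, f'] @ ys))"
    if "walk {} (xs @ [insert h f, insert h f'] @ ys) {}" "h \<notin> f" "h \<notin> f'" for xs ys f f' h
    using layout_vertical_flip(3)[OF that(2,3,1)]
    by (intro flip_down_real[OF that(1)]) (auto simp: nth_append)
  from assms obtain xs ys f f' h where "walk {} fs {}" "walk {} gs {}" "h \<notin> f" "h \<notin> f'"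
    "fs = xs @ [insert h f, insert h f'] @ ys \<and> gs = xs @ [f, f'] @ ys \<or>
     gs = xs @ [insert h f, insert h f'] @ ys \<and> fs = xs @ [f, f'] @ ys"
    unfolding vflip_def by blast
  then show ?thesis using down flip_sym tiling_in_tilings by blast
qed

lemma vflips_flip_equiv: "vflip\<^sup>*\<^sup>* fs gs \<Longrightarrow> flip_equiv (tiling fs) (tiling gs)"
  by (induction rule: rtranclp_induct) (auto intro: rtranclp.rtrancl_into_rtrancl vflip_flip)

lemma Gs_nth: "Gs p fs = (\<Sum>k<length fs. G (plug p (take k fs)) (fs ! k))"
proof (induction fs arbitrary: p)
  case (Cons f fs)
  then show ?case by (simp add: sum.lessThan_Suc_shift del: sum.lessThan_Suc)
qed simp

text \<open>Pairs of horizontal and pairs of vertical dominoes have no twist, and a vertical domino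
  interacts only with the two floors that it occupies.\<close>

lemma twist_tiling:
  assumes w: "walk {} fs {}" and \<omega>: "\<omega> = 1 \<or> \<omega> = - 1" and u: "u = \<omega> *\<^sub>R axis (ax w) 1"
  shows "twist u (tiling fs) = (if w then 1 else - 1) / 4 * of_int (Gs {} fs)"
proof -
  note L = walk_layout[OF w]
  let ?n = "length fs" and ?P = "\<lambda>k. plug {} (take k fs)" and ?c = "(if w then 1 else - 1) / 4 :: real"
  let ?\<tau> = "\<lambda>d e. pair_twist u (body w d) (body w e)"
  define IH IV where "IH = (SIGMA k:{..<?n}. fs ! k)" and "IV = (SIGMA k:{..<?n}. ?P (Suc k))"
  define LH LV where "LH = (\<lambda>(k, h). H h k) ` IH" and "LV = (\<lambda>(k, s). V s k) ` IV"
  have "finite (fs ! k)" if "k < ?n" for k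
    using w that matching_finite by (auto simp: walk_nth_iff)
  note finf = this
  have finP: "finite (?P k)" for k using plug_subset[of "{}"] finite_S by (meson empty_subsetI finite_subset)
  have finI: "finite IH" "finite IV" using finf finP unfolding IH_def IV_def by (auto intro: finite_SigmaI)
  let ?T = "\<lambda>k h j s. ?c * of_int (phi h s) * (of_bool (Suc j = k) - of_bool (j = k))"
  have sumH: "(\<Sum>x\<in>IH. F (fst x) (snd x)) = (\<Sum>k<?n. \<Sum>h\<in>fs ! k. F k h)" for F :: "nat \<Rightarrow> cell set \<Rightarrow> real"
    unfolding IH_def by (subst sum.Sigma) (use finf in \<open>auto simp: case_prod_unfold\<close>)
  have sumV: "(\<Sum>x\<in>IV. F (fst x) (snd x)) = (\<Sum>k<?n. \<Sum>s\<in>?P (Suc k). F k s)" for F :: "nat \<Rightarrow> cell \<Rightarrow> real"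
    unfolding IV_def by (subst sum.Sigma) (use finP in \<open>auto simp: case_prod_unfold\<close>)
  have fin: "finite LH" "finite LV" using finI by (auto simp: LH_def LV_def)
  have split: "layout fs = LH \<union> LV" by (auto simp: layout_def LH_def LV_def IH_def IV_def image_iff)
  have disj: "LH \<inter> LV = {}" by (auto simp: LH_def LV_def)
  have dom: "is_dom h" if "(k, h) \<in> IH" for k h
    using L(1)[of "H h k"] that by (auto simp: IH_def)
  have "inj_on (body w) (layout fs)" by (rule inj_on_subset[OF inj_body]) (use L(1) in blast)
  then have "twist u (tiling fs) = (\<Sum>d\<in>layout fs. \<Sum>e\<in>layout fs. ?\<tau> d e)"
    unfolding twist_def tiling_def by (simp add: sum.reindex)
  also have "\<dots> = (\<Sum>d\<in>LH. \<Sum>e\<in>LH. ?\<tau> d e) + (\<Sum>d\<in>LH. \<Sum>e\<in>LV. ?\<tau> d e)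
      + ((\<Sum>d\<in>LV. \<Sum>e\<in>LH. ?\<tau> d e) + (\<Sum>d\<in>LV. \<Sum>e\<in>LV. ?\<tau> d e))"
    unfolding split using fin disj by (simp add: sum.union_disjoint sum.distrib)
  also have "(\<Sum>d\<in>LH. \<Sum>e\<in>LH. ?\<tau> d e) = 0"
    by (intro sum.neutral ballI) (auto simp: LH_def dom intro!: pair_twist_HH[OF \<omega> u])
  also have "(\<Sum>d\<in>LV. \<Sum>e\<in>LV. ?\<tau> d e) = 0"
    by (intro sum.neutral ballI) (auto simp: LV_def intro!: pair_twist_VV[OF \<omega> u])
  also have "(\<Sum>d\<in>LV. \<Sum>e\<in>LH. ?\<tau> d e) = (\<Sum>e\<in>LH. \<Sum>d\<in>LV. ?\<tau> d e)" by (rule sum.swap)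
  also have "0 + (\<Sum>d\<in>LH. \<Sum>e\<in>LV. ?\<tau> d e) + ((\<Sum>e\<in>LH. \<Sum>d\<in>LV. ?\<tau> d e) + 0)
      = (\<Sum>d\<in>LH. \<Sum>e\<in>LV. ?\<tau> d e + ?\<tau> e d)" by (simp add: sum.distrib)
  also have "\<dots> = (\<Sum>x\<in>IH. \<Sum>z\<in>IV. ?\<tau> (H (snd x) (fst x)) (V (snd z) (fst z)) + ?\<tau> (V (snd z) (fst z)) (H (snd x) (fst x)))"
    unfolding LH_def LV_def by (subst sum.reindex, force simp: inj_on_def)+ (simp add: case_prod_unfold)
  also have "\<dots> = (\<Sum>x\<in>IH. \<Sum>z\<in>IV. ?c * of_int (phi (snd x) (snd z)) * (of_bool (Suc (fst z) = fst x) - of_bool (fst z = fst x)))"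
    by (intro sum.cong refl pair_twist_HV[OF \<omega> u]) (use dom in auto)
  also have "\<dots> = (\<Sum>k<?n. \<Sum>h\<in>fs ! k. \<Sum>z\<in>IV. ?T k h (fst z) (snd z))"
    by (rule sumH[of "\<lambda>k h. \<Sum>z\<in>IV. ?T k h (fst z) (snd z)"])
  also have "\<dots> = (\<Sum>k<?n. \<Sum>h\<in>fs ! k. \<Sum>j<?n. \<Sum>s\<in>?P (Suc j). ?T k h j s)"
    by (intro sum.cong refl sumV[of "\<lambda>j s. ?T k h j s" for k h])
  also have "\<dots> = (\<Sum>k<?n. ?c * of_int (G (?P k) (fs ! k)))"
  proof (rule sum.cong[OF refl])
    fix k assume "k \<in> {..<?n}"
    then have k: "k < ?n" by simp
    have inner: "(\<Sum>j<?n. \<Sum>s\<in>?P (Suc j). ?c * of_int (phi h s) * (of_bool (Suc j = k) - of_bool (j = k)))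
        = ?c * of_int (sum (phi h) (?P k) - sum (phi h) (?P (Suc k)))" for h
    proof -
      have "(\<Sum>j<?n. \<Sum>s\<in>?P (Suc j). ?c * of_int (phi h s) * (of_bool (Suc j = k) - of_bool (j = k)))
        = (\<Sum>j<?n. ?c * of_int (sum (phi h) (?P (Suc j))) * (of_bool (Suc j = k) - of_bool (j = k)))"
        by (simp add: sum_distrib_left sum_distrib_right)
      also have "\<dots> = (\<Sum>j<?n. if Suc j = k then ?c * of_int (sum (phi h) (?P (Suc j))) else 0)
          - (\<Sum>j<?n. if j = k then ?c * of_int (sum (phi h) (?P (Suc j))) else 0)"
        unfolding sum_subtractf[symmetric] by (rule sum.cong) auto
      also have "(\<Sum>j<?n. if j = k then ?c * of_int (sum (phi h) (?P (Suc j))) else 0) = ?c * of_int (sum (phi h) (?P (Suc k)))"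
        using k by simp
      \<comment> \<open>For \<open>k = 0\<close> no \<open>j\<close> remains, and the plug below the
        bottom floor is empty.\<close>
      also have "(\<Sum>j<?n. if Suc j = k then ?c * of_int (sum (phi h) (?P (Suc j))) else 0) = ?c * of_int (sum (phi h) (?P k))"
        using k by (cases k) simp_all
      finally show ?thesis by (simp add: right_diff_distrib)
    qed
    show "(\<Sum>h\<in>fs ! k. \<Sum>j<?n. \<Sum>s\<in>?P (Suc j). ?c * of_int (phi h s) * (of_bool (Suc j = k) - of_bool (j = k)))
        = ?c * of_int (G (?P k) (fs ! k))"
      unfolding inner G_def plug_take_Suc[OF k] by (simp only: sum_distrib_left of_int_sum)
  qed
  also have "\<dots> = ?c * of_int (Gs {} fs)"
    unfolding Gs_nth by (simp only: sum_distrib_left of_int_sum)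
  finally show ?thesis .
qed

end


section \<open>Flip components\<close>

context balanced_disk
begin

lemma flip_equiv_tiling:
  assumes "flip_equiv (tiling fs) t'" "walk {} fs {}"
  shows "\<exists>gs. walk {} gs {} \<and> length gs = length fs \<and> Gs {} gs = Gs {} fs \<and> t' = tiling gs"
  using assms(1)
proof (induction rule: rtranclp_induct)
  case base
  then show ?case using assms(2) by blast
next
  case (step s t')
  then obtain gs where "walk {} gs {}" "length gs = length fs" "Gs {} gs = Gs {} fs" "s = tiling gs" by blast
  then show ?case using flip_tiling[of gs t'] step.hyps(2) by metis
qed

lemma component_of:
  assumes "C \<in> flip_components D N" "t \<in> C"
  shows "t \<in> tilings D N" "C = {t' \<in> tilings D N. flip_equiv t t'}"
proof -
  obtain t0 where t0: "t0 \<in> tilings D N" "C = {t' \<in> tilings D N. flip_equiv t0 t'}"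
    using assms(1) by (auto simp: flip_components_def)
  then show "t \<in> tilings D N" using assms(2) by simp
  have "flip_equiv t0 t" "flip_equiv t t0" using assms(2) t0 flip_equiv_sym by auto
  then have "flip_equiv t0 t' \<longleftrightarrow> flip_equiv t t'" for t' by (meson rtranclp_trans)
  then show "C = {t' \<in> tilings D N. flip_equiv t t'}" using t0(2) by simp
qed

lemma component_in: "t \<in> tilings D N \<Longrightarrow> {t' \<in> tilings D N. flip_equiv t t'} \<in> flip_components D N"
  by (auto simp: flip_components_def)

lemma walk_vertical: "even n \<Longrightarrow> walk {} (replicate n {}) {}"
proof (elim evenE)
  fix k assume n: "n = 2 * k"
  show "walk {} (replicate n {}) {}"
    unfolding n by (induction k) (auto simp: nxt_def)
qed

lemma Gs_vertical: "Gs p (replicate n {}) = 0"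
  by (induction n arbitrary: p) auto

lemma nv_vertical: "nv (replicate n {}) = n"
  by (induction n) auto

text \<open>Flips preserve \<open>Gs\<close> and vertical floors contribute nothing, so the part
  left below keeps the full value. Uniqueness of the list of floors identifies the result of the
  flips.\<close>

lemma collected:
  assumes ev: "even M" and w: "walk {} fs {}" "M \<le> nv fs"
  shows "\<exists>gs. walk {} gs {} \<and> length fs = length gs + M \<and> Gs {} gs = Gs {} fs \<and>
    flip_equiv (tiling fs) (tiling (gs @ replicate M {}))"
proof -
  obtain j where j: "M = 2 * j" using ev by (elim evenE)
  obtain gs where gs: "walk {} gs {}" "vflip\<^sup>*\<^sup>* (fs @ []) (gs @ replicate (2 * j) {} @ [])"
    "length fs = length gs + 2 * j"
    by (rule collect_vertical[OF squares_nonempty[OF disk] w(1), of "[]" j]) (use w(2) j in auto)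
  have fl: "flip_equiv (tiling fs) (tiling (gs @ replicate M {}))"
    using vflips_flip_equiv[OF gs(2)] j by simp
  obtain hs where hs: "walk {} hs {}" "length hs = length fs" "Gs {} hs = Gs {} fs"
    "tiling (gs @ replicate M {}) = tiling hs"
    using flip_equiv_tiling[OF fl w(1)] by blast
  have "walk {} (gs @ replicate M {}) {}" using gs(1) walk_vertical[OF ev] by (rule walk_appendI)
  then have "gs @ replicate M {} = hs" using tiling_eq hs gs(3) j by simp
  then have "Gs {} gs = Gs {} fs" using hs(3) by (auto simp: Gs_append Gs_vertical)
  then show ?thesis using gs fl j by blast
qed

text \<open>Exchanging the two horizontal axes reverses the orientation, hence the sign of the
  determinant.\<close>

definition kap :: int where "kap = (if w then 1 else - 1)"

lemma kap_square: "kap * (kap * x) = x"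
  by (simp add: kap_def)

context
  fixes u :: "real ^ 3" and \<omega> :: real
  assumes \<omega>: "\<omega> = 1 \<or> \<omega> = - 1" and u: "u = \<omega> *\<^sub>R axis (ax w) 1"
begin

lemma twist_tiling_kap: "walk {} fs {} \<Longrightarrow> twist u (tiling fs) = of_int (kap * Gs {} fs) / 4"
  using twist_tiling[OF _ \<omega> u] by (simp add: kap_def)

lemma component_twist_tiling:
  assumes C: "C \<in> flip_components D N" and fs: "walk {} fs {}" "tiling fs \<in> C"
  shows "component_twist u C = of_int (kap * Gs {} fs) / 4"
proof -
  have "twist u t = of_int (kap * Gs {} fs) / 4" if "t \<in> C" for t
  proof -
    have "flip_equiv (tiling fs) t" using component_of(2)[OF C fs(2)] that by auto
    from flip_equiv_tiling[OF this fs(1)] obtain gs where "walk {} gs {}" "Gs {} gs = Gs {} fs" "t = tiling gs"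
      by blast
    then show ?thesis using twist_tiling_kap by simp
  qed
  then have "twist u ` C = (\<lambda>t. of_int (kap * Gs {} fs) / 4) ` C" by (rule image_cong[OF refl])
  also have "\<dots> = {of_int (kap * Gs {} fs) / 4}" using fs(2) by auto
  finally have "twist u ` C = {of_int (kap * Gs {} fs) / 4}" .
  then show ?thesis by (simp add: component_twist_def)
qed

lemma fat_iff:
  "C \<in> fat_components D M N \<longleftrightarrow> C \<in> flip_components D N \<and>
    (\<exists>fs. walk {} fs {} \<and> length fs = N \<and> tiling fs \<in> C \<and> M \<le> nv fs)"
proof
  assume C: "C \<in> fat_components D M N"
  then obtain t where t: "t \<in> C" "M \<le> card {k \<in> {1..N}. vertical_floor D t k}" "C \<in> flip_components D N"
    by (auto simp: fat_components_def)
  obtain fs where fs: "walk {} fs {}" "length fs = N" "t = tiling fs"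
    using component_of(1)[OF t(3,1)] by (rule tiling_obtain)
  then show "C \<in> flip_components D N \<and> (\<exists>fs. walk {} fs {} \<and> length fs = N \<and> tiling fs \<in> C \<and> M \<le> nv fs)"
    using t card_vertical_floors[OF fs(1)] by auto
next
  assume "C \<in> flip_components D N \<and> (\<exists>fs. walk {} fs {} \<and> length fs = N \<and> tiling fs \<in> C \<and> M \<le> nv fs)"
  then obtain fs where fs: "C \<in> flip_components D N" "walk {} fs {}" "length fs = N" "tiling fs \<in> C" "M \<le> nv fs"
    by blast
  have "M \<le> card {k \<in> {1..N}. vertical_floor D (tiling fs) k}"
    using card_vertical_floors[OF fs(2)] fs(3,5) by simp
  then show "C \<in> fat_components D M N" using fs(1,4) unfolding fat_components_def by blast
qed

text \<open>Once \<open>M\<close> vertical floors are collected on top of both tilings, the lower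
  parts have height \<open>N - M\<close> and equal twist, and the assumed property is applied at
  this smaller height.\<close>

lemma fat_unique:
  assumes ev: "even M"
    and hyp: "\<And>N t0 t1. t0 \<in> tilings D N \<Longrightarrow> t1 \<in> tilings D N \<Longrightarrow> twist u t0 = twist u t1 \<Longrightarrow>
           flip_equiv (stack N t0 (vert_tiling D M)) (stack N t1 (vert_tiling D M))"
    and C: "C \<in> fat_components D M N" "C' \<in> fat_components D M N" "component_twist u C = component_twist u C'"
  shows "C = C'"
proof -
  obtain fs where fs: "C \<in> flip_components D N" "walk {} fs {}" "length fs = N" "tiling fs \<in> C" "M \<le> nv fs"
    using C(1) unfolding fat_iff by blast
  obtain gs where gs: "C' \<in> flip_components D N" "walk {} gs {}" "length gs = N" "tiling gs \<in> C'" "M \<le> nv gs"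
    using C(2) unfolding fat_iff by blast
  obtain fs' where fs': "walk {} fs' {}" "length fs = length fs' + M" "Gs {} fs' = Gs {} fs"
    "flip_equiv (tiling fs) (tiling (fs' @ replicate M {}))" using collected[OF ev fs(2,5)] by blast
  obtain gs' where gs': "walk {} gs' {}" "length gs = length gs' + M" "Gs {} gs' = Gs {} gs"
    "flip_equiv (tiling gs) (tiling (gs' @ replicate M {}))" using collected[OF ev gs(2,5)] by blast
  have len: "length gs' = length fs'" using fs' gs' fs gs by simp
  have "twist u (tiling fs') = twist u (tiling gs')"
    using C(3) unfolding component_twist_tiling[OF fs(1,2,4)] component_twist_tiling[OF gs(1,2,4)]
      twist_tiling_kap[OF fs'(1)] twist_tiling_kap[OF gs'(1)] fs'(3) gs'(3) .
  then have "flip_equiv (stack (length fs') (tiling fs') (vert_tiling D M))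
      (stack (length fs') (tiling gs') (vert_tiling D M))"
    using tiling_in_tilings[OF fs'(1)] tiling_in_tilings[OF gs'(1)] len by (intro hyp) auto
  then have mid: "flip_equiv (tiling (fs' @ replicate M {})) (tiling (gs' @ replicate M {}))"
    using tiling_append[OF fs'(1)] tiling_append[OF gs'(1)] len by (simp add: vert_tiling_eq[OF ev])
  have gt: "tiling gs \<in> tilings D N" using component_of(1)[OF gs(1,4)] .
  have "flip_equiv (tiling fs) (tiling gs)"
    using fs'(4) mid flip_equiv_sym[OF gs'(4) gt] by (meson rtranclp_trans)
  then have "tiling gs \<in> C" using component_of(2)[OF fs(1,4)] gt by simp
  then show ?thesis using component_of(2)[OF fs(1)] component_of(2)[OF gs(1,4)] by metis
qed

lemma fat_exists:
  assumes ev: "even M" and "M \<le> N" and a: "achieves (N - M) (4 * (kap * t))"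
  shows "\<exists>C. C \<in> fat_components D M N \<and> component_twist u C = of_int t"
proof -
  obtain fs where fs: "length fs = N - M" "walk {} fs {}" "Gs {} fs = 4 * (kap * t)"
    using a by (auto simp: achieves_def)
  let ?gs = "fs @ replicate M {}"
  have g: "walk {} ?gs {}" using fs(2) walk_vertical[OF ev] by (rule walk_appendI)
  have len: "length ?gs = N" using fs(1) \<open>M \<le> N\<close> by simp
  have t: "tiling ?gs \<in> tilings D N" using tiling_in_tilings[OF g] len by simp
  let ?C = "{t' \<in> tilings D N. flip_equiv (tiling ?gs) t'}"
  have C: "?C \<in> flip_components D N" "tiling ?gs \<in> ?C" using component_in[OF t] t by auto
  have "?C \<in> fat_components D M N"
    unfolding fat_iff using C g len by (intro conjI exI[of _ ?gs]) (auto simp: nv_vertical)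
  moreover have "component_twist u ?C = of_int t"
  proof -
    have "kap * Gs {} ?gs = 4 * t"
      using fs(3) kap_square[of t] by (simp add: Gs_append Gs_vertical mult.left_commute)
    then show ?thesis using component_twist_tiling[OF C(1) g C(2)] by simp
  qed
  ultimately show ?thesis by blast
qed

text \<open>A tiling of positive height is a loop at the empty plug, and so is its reversal, which
  bounds the twist from below.\<close>

lemma twist_bounds:
  assumes loop: "(q, cs) \<in> loops"
    and max: "\<And>p fs. (p, fs) \<in> loops \<Longrightarrow> Gs p fs * int (length cs) \<le> Gs q cs * int (length fs)"
    and t: "t \<in> tilings D N"
  shows "twist u t \<in> \<int> \<and> \<bar>twist u t\<bar> \<le> of_int (Gs q cs) / (4 * real (length cs)) * real N"
proof -
  obtain fs where fs: "walk {} fs {}" "length fs = N" "t = tiling fs" using t by (rule tiling_obtain)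
  have "achieves N (Gs {} fs)" using fs by (auto simp: achieves_def)
  from mod4[OF this] obtain k where k: "Gs {} fs = 4 * k" by (elim dvdE)
  have tw: "twist u t = of_int (kap * k)" using twist_tiling_kap[OF fs(1)] k fs(3) by simp
  have "length cs > 0" using loop by (auto simp: loops_def)
  have "\<bar>Gs {} fs\<bar> * int (length cs) \<le> Gs q cs * int N"
  proof (cases "fs = []")
    case True
    then show ?thesis using fs(2) by simp
  next
    case False
    have "({}, fs) \<in> loops" "({}, rev fs) \<in> loops"
      using False fs(1) walk_rev[of "{}" fs "{}"] by (auto simp: loops_def)
    then show ?thesis using max[of "{}" fs] max[of "{}" "rev fs"] walk_rev[OF _ fs(1)] fs(2) by (auto simp: abs_if)
  qed
  then have "real_of_int (\<bar>Gs {} fs\<bar> * int (length cs)) \<le> real_of_int (Gs q cs * int N)" by (simp only: of_int_le_iff)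
  then have "\<bar>real_of_int (Gs {} fs)\<bar> * real (length cs) \<le> of_int (Gs q cs) * real N" by simp
  moreover have "\<bar>twist u t\<bar> = \<bar>real_of_int (Gs {} fs)\<bar> / 4"
    unfolding tw k by (simp add: kap_def abs_mult)
  ultimately have "\<bar>twist u t\<bar> \<le> of_int (Gs q cs) / (4 * real (length cs)) * real N"
    using \<open>length cs > 0\<close> by (simp add: field_simps)
  then show ?thesis using tw by simp
qed

lemma thin_count:
  "card (\<Union> (thin_components D M N)) \<le> card {fs \<in> walks N {} {}. nv fs < M}"
    "\<Union> (thin_components D M N) \<subseteq> tilings D N"
proof -
  have "t \<in> tiling ` {fs \<in> walks N {} {}. nv fs < M}" if t: "t \<in> \<Union> (thin_components D M N)" for t
  proof -
    obtain C where C: "t \<in> C" "C \<in> flip_components D N" "C \<notin> fat_components D M N"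
      using t by (auto simp: thin_components_def)
    obtain fs where fs: "walk {} fs {}" "length fs = N" "t = tiling fs"
      using component_of(1)[OF C(2,1)] by (rule tiling_obtain)
    then have "nv fs < M" using C unfolding fat_iff by force
    then show ?thesis using fs by (auto simp: walks_def)
  qed
  then have sub: "\<Union> (thin_components D M N) \<subseteq> tiling ` {fs \<in> walks N {} {}. nv fs < M}" by blast
  then show "\<Union> (thin_components D M N) \<subseteq> tilings D N" unfolding tilings_eq by auto
  have fin: "finite {fs \<in> walks N {} {}. nv fs < M}" using finite_walks by simp
  show "card (\<Union> (thin_components D M N)) \<le> card {fs \<in> walks N {} {}. nv fs < M}"
    using card_mono[OF finite_imageI[OF fin] sub] card_image_le[OF fin, of tiling] by linarith
qed

text \<open>Blocks of \<open>K\<close> floors lose a factor \<open>r\<close>, which is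
  \<open>\<rho>\<close> per floor. Taking the square root of this rate leaves a second factor
  \<open>c' ^ N\<close> tending to 0, as the little-o requires.\<close>

lemma thin_decay:
  obtains c' :: real where "0 < c'" "c' < 1" "\<exists>e \<in> o(\<lambda>N::nat. c' ^ N). \<forall>N.
    real (card (\<Union> (thin_components D M N))) = real (card (tilings D N)) * e N"
proof -
  obtain K and r :: real where K: "K > 0" and r: "0 < r" "r < 1" and
    dec: "\<And>n. real (card {fs \<in> walks n {} {}. nv fs < M}) \<le> r ^ (n div K) * real (card (walks n {} {}))"
    by (rule few_vertical_floors_decay[of M]) blast
  define \<rho> where "\<rho> = root K r"
  define c' where "c' = sqrt \<rho>"
  have \<rho>: "0 < \<rho>" "\<rho> < 1" "\<rho> ^ K = r" using K r by (auto simp: \<rho>_def)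
  have c': "0 < c'" "c' < 1" "c' * c' = \<rho>" using \<rho> by (auto simp: c'_def)
  have pow: "r ^ (n div K) \<le> c' ^ n * c' ^ n / r" for n
  proof -
    \<comment> \<open>The incomplete block of \<open>n mod K\<close> floors costs at most a factor
      \<open>1 / r\<close>.\<close>
    have "r \<le> \<rho> ^ (n mod K)" using \<rho> K power_decreasing[of "n mod K" K \<rho>] by (simp add: less_imp_le)
    then have "r ^ (n div K) * r \<le> r ^ (n div K) * \<rho> ^ (n mod K)" using r by (intro mult_left_mono) auto
    also have "\<dots> = \<rho> ^ n" unfolding \<rho>(3)[symmetric] power_mult[symmetric] power_add[symmetric] by simp
    also have "\<dots> = c' ^ n * c' ^ n" unfolding c'(3)[symmetric] by (simp add: power_mult_distrib)
    finally show ?thesis using r by (simp add: field_simps)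
  qed
  \<comment> \<open>Where there are no tilings the quotient is 0 by convention, which is consistent
    because there are no thin ones either.\<close>
  define e where "e N = real (card (\<Union> (thin_components D M N))) / real (card (tilings D N))" for N
  have e0: "0 \<le> e N" for N by (simp add: e_def)
  have e: "e N \<le> c' ^ N * c' ^ N / r" for N
  proof (cases "card (tilings D N) = 0")
    case True
    then show ?thesis using c' r by (simp add: e_def)
  next
    case False
    have "real (card (\<Union> (thin_components D M N))) \<le> real (card {fs \<in> walks N {} {}. nv fs < M})"
      using thin_count(1) by simp
    also have "\<dots> \<le> r ^ (N div K) * real (card (tilings D N))" using dec[of N] by (simp add: card_tilings)
    finally have "e N \<le> r ^ (N div K)" using False by (simp add: e_def field_simps)
    then show ?thesis using pow[of N] by linarith
  qed
  have lim: "(\<lambda>N. c' ^ N / r) \<longlonglongrightarrow> 0"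
    using tendsto_divide[OF LIMSEQ_realpow_zero[of c'] tendsto_const[of r]] c' r by simp
  have "(\<lambda>N. e N / c' ^ N) \<longlonglongrightarrow> 0"
  proof (rule real_tendsto_sandwich[OF _ _ tendsto_const lim])
    show "\<forall>\<^sub>F N in sequentially. 0 \<le> e N / c' ^ N" using e0 c' by (intro always_eventually allI) simp
    show "\<forall>\<^sub>F N in sequentially. e N / c' ^ N \<le> c' ^ N / r"
      using e c' by (intro always_eventually allI) (simp add: field_simps)
  qed
  then have "e \<in> o(\<lambda>N. c' ^ N)" using c' by (intro smalloI_tendsto) auto
  moreover have "real (card (\<Union> (thin_components D M N))) = real (card (tilings D N)) * e N" for N
  proof (cases "card (tilings D N) = 0")
    case True
    have "finite (tilings D N)" unfolding tilings_eq using finite_walks by simp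
    then have "\<Union> (thin_components D M N) = {}" using True thin_count(2)[of M N] by simp
    then have "card (\<Union> (thin_components D M N)) = 0" by (simp only: card.empty)
    then show ?thesis using True by simp
  qed (simp add: e_def)
  ultimately show thesis using that c' by blast
qed

end
end

theorem theorem4:
  fixes D :: "(real ^ 2) set" and u :: "real ^ 3" and M :: nat
  assumes "quadriculated_disk D" and "balanced D"
    and "u \<in> {axis 1 1, - axis 1 1, axis 2 1, - axis 2 1}"
    and "regular_disk u D"
    and "even M"
    and "\<And>N t0 t1. t0 \<in> tilings D N \<Longrightarrow> t1 \<in> tilings D N \<Longrightarrow> twist u t0 = twist u t1 \<Longrightarrow>
           flip_equiv (stack N t0 (vert_tiling D M)) (stack N t1 (vert_tiling D M))"
  shows "\<exists>c b c' :: real. c \<in> \<rat> \<and> 0 < c' \<and> c' < 1 \<and>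
     (\<forall>N. \<forall>t\<in>tilings D N.
        twist u t \<in> \<int> \<and> - c * real N \<le> twist u t \<and> twist u t \<le> c * real N) \<and>
     (\<forall>N. \<forall>t::int. - c * real N + b \<le> of_int t \<and> of_int t \<le> c * real N - b \<longrightarrow>
        (\<exists>!F. F \<in> fat_components D M N \<and> component_twist u F = of_int t)) \<and>
     (\<forall>N. \<forall>t::int. \<exists>\<^sub>\<le>\<^sub>1F. F \<in> fat_components D M N \<and> component_twist u F = of_int t) \<and>
     (\<exists>e \<in> o(\<lambda>N::nat. c' ^ N). \<forall>N.
        real (card (\<Union> (thin_components D M N))) = real (card (tilings D N)) * e N)"
proof -
  obtain w \<omega> where \<omega>: "\<omega> = 1 \<or> \<omega> = - 1" and u: "u = \<omega> *\<^sub>R axis (ax w) 1"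
  proof -
    have "\<exists>w \<omega>. (\<omega> = 1 \<or> \<omega> = - 1) \<and> u = \<omega> *\<^sub>R axis (ax w) 1"
      using assms(3)
    proof (elim insertE emptyE)
      assume "u = axis 1 1"
      then show ?thesis by (intro exI[of _ True] exI[of _ 1]) (simp add: ax_def)
    next
      assume "u = - axis 1 1"
      then show ?thesis by (intro exI[of _ True] exI[of _ "- 1"]) (simp add: ax_def)
    next
      assume "u = axis 2 1"
      then show ?thesis by (intro exI[of _ False] exI[of _ 1]) (simp add: ax_def)
    next
      assume "u = - axis 2 1"
      then show ?thesis by (intro exI[of _ False] exI[of _ "- 1"]) (simp add: ax_def)
    qed
    then show thesis using that by blast
  qed
  interpret balanced_disk D w by unfold_locales (rule assms)+
  obtain q cs where loop: "(q, cs) \<in> loops"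
    and max: "\<And>p fs. (p, fs) \<in> loops \<Longrightarrow> Gs p fs * int (length cs) \<le> Gs q cs * int (length fs)"
    using max_mean_loop[OF charge_S] by blast
  obtain B where B: "B > 0"
    "\<And>N t. \<bar>4 * t\<bar> * int (length cs) + B \<le> Gs q cs * int N \<Longrightarrow> M \<le> N \<and> achieves (N - M) (4 * t)"
    using interior_values[OF squares_nonempty[OF assms(1)] squares_co_connected[OF assms(1)] loop assms(5)] by blast
  obtain c' :: real where c': "0 < c'" "c' < 1" "\<exists>e \<in> o(\<lambda>N::nat. c' ^ N). \<forall>N.
    real (card (\<Union> (thin_components D M N))) = real (card (tilings D N)) * e N"
    by (rule thin_decay[OF \<omega> u])
  define l where "l = real (length cs)"
  have l: "l > 0" using loop by (auto simp: loops_def l_def)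
  \<comment> \<open>\<open>Gs\<close> is four times the twist up to sign, so both constants arise by
    dividing the integer inequality for interior values by \<open>4 * l\<close>.\<close>
  define c where "c = of_int (Gs q cs) / (4 * l)"
  define b where "b = of_int B / (4 * l)"
  have "c \<in> \<rat>" by (simp add: c_def l_def)
  have bounds: "twist u t \<in> \<int> \<and> - c * real N \<le> twist u t \<and> twist u t \<le> c * real N" if "t \<in> tilings D N" for N t
    using twist_bounds[OF \<omega> u loop max that] unfolding c_def l_def abs_le_iff by auto
  have uniq: "F = F'" if "F \<in> fat_components D M N" "F' \<in> fat_components D M N"
    "component_twist u F = component_twist u F'" for F F' N
    by (rule fat_unique[OF \<omega> u assms(5,6) that])
  have ex: "\<exists>F. F \<in> fat_components D M N \<and> component_twist u F = of_int t"
    if t: "- c * real N + b \<le> of_int t \<and> of_int t \<le> c * real N - b" for N and t :: int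
  proof -
    have "\<bar>real_of_int t\<bar> + b \<le> c * real N" using t by linarith
    then have h: "(\<bar>real_of_int t\<bar> + b) * (4 * l) \<le> c * real N * (4 * l)"
      using l by (intro mult_right_mono) auto
    have e: "(\<bar>real_of_int t\<bar> + b) * (4 * l) = 4 * \<bar>real_of_int t\<bar> * l + b * (4 * l)"
      by (simp add: algebra_simps)
    have f: "b * (4 * l) = of_int B" "c * real N * (4 * l) = of_int (Gs q cs) * real N"
      using l by (simp_all add: b_def c_def)
    from h have "4 * \<bar>real_of_int t\<bar> * l + of_int B \<le> of_int (Gs q cs) * real N"
      unfolding e f .
    then have "real_of_int (\<bar>4 * t\<bar> * int (length cs) + B) \<le> real_of_int (Gs q cs * int N)"
      by (simp add: l_def abs_mult)
    then have h: "\<bar>4 * t\<bar> * int (length cs) + B \<le> Gs q cs * int N" by (simp only: of_int_le_iff)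
    have "\<bar>4 * (kap * t)\<bar> = \<bar>4 * t\<bar>" by (simp add: kap_def abs_mult)
    then have "M \<le> N \<and> achieves (N - M) (4 * (kap * t))" using B(2)[of "kap * t" N] h by simp
    then show ?thesis using fat_exists[OF \<omega> u assms(5)] by blast
  qed
  have 1: "\<forall>N. \<forall>t\<in>tilings D N. twist u t \<in> \<int> \<and> - c * real N \<le> twist u t \<and> twist u t \<le> c * real N"
    using bounds by blast
  have 2: "\<forall>N. \<forall>t::int. - c * real N + b \<le> of_int t \<and> of_int t \<le> c * real N - b \<longrightarrow>
        (\<exists>!F. F \<in> fat_components D M N \<and> component_twist u F = of_int t)"
  proof (intro allI impI)
    fix N and t :: int
    assume "- c * real N + b \<le> of_int t \<and> of_int t \<le> c * real N - b"
    from ex[OF this] obtain F where F: "F \<in> fat_components D M N" "component_twist u F = of_int t" by blast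
    show "\<exists>!F. F \<in> fat_components D M N \<and> component_twist u F = of_int t"
    proof (rule ex1I[of _ F])
      fix F' assume "F' \<in> fat_components D M N \<and> component_twist u F' = of_int t"
      then show "F' = F" using F by (intro uniq[of F' N F]) simp_all
    qed (use F in simp)
  qed
  have 3: "\<forall>N. \<forall>t::int. \<exists>\<^sub>\<le>\<^sub>1F. F \<in> fat_components D M N \<and> component_twist u F = of_int t"
    unfolding Uniq_def by (metis uniq)
  show ?thesis
    by (intro exI[of _ c] exI[of _ b] exI[of _ c'] conjI \<open>c \<in> \<rat>\<close> c' 1 2 3)
qed

end
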